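(* Let $\epsilon>0$ and $p\in(0,1)$. Set $\epsilon'=\epsilon/2$, $\alpha_x=\epsilon/(2D_x^2)$, $\alpha_y=\epsilon/(2D_y^2)$. Then the point $(\bar x,\bar y)$ returned by applying BoostSAA-C to $\Phi_\alpha$ with target accuracy $\epsilon'$ and failure probability $p$ satisfies $$\mathbb P\left(\Delta_\Phi(\bar x,\bar y)\le\epsilon\right)\ge 1-p,$$ and the total number of samples is bounded by $$\mathcal O\left(\ln^2\left(\frac{LD^2}{\epsilon}\right)\ln\left(\frac{\ln(LD^2/\epsilon)}{p}\right)\frac{\ell^2D^2}{\epsilon^2}\right).$$
   Context: $\|\cdot\|$ is the Euclidean norm. $\mathcal X\subset\mathbb R^{d_x}$, $\mathcal Y\subset\mathbb R^{d_y}$ are compact convex sets with diameters $D_x,D_y>0$, $D^2:=D_x^2+D_y^2$; $\xi\sim\mathcal P$; $\Phi(x,y)=\mathbb E[\Phi_\xi(x,y)]$. Convex-concave setting: for almost every $\xi$, $\Phi_\xi(\cdot,y)$ is convex on $\mathcal X$ for every $y\in\mathcal Y$ and $\Phi_\xi(x,\cdot)$ is concave on $\mathcal Y$ for every $x\in\mathcal X$ (no strong convexity/concavity). The duality gap is $\Delta_\Phi(\hat x,\hat y):=\max_{y\in\mathcal Y}\Phi(\hat x,y)-\min_{x\in\mathcal X}\Phi(x,\hat y)$. Assumption (smoothness): there are $L_x,L_y,L_{xy}>0$ such that for all $x_1,x_2\in\mathcal X$, $y_1,y_2\in\mathcal Y$: $\|\nabla_x \Phi(x_1,y_1)-\nabla_x\Phi(x_2,y_1)\|\le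 L_x\|x_1-x_2\|$, $\|\nabla_y \Phi(x_1,y_1)-\nabla_y\Phi(x_1,y_2)\|\le L_y\|y_1-y_2\|$, $\|\nabla_x \Phi(x_1,y_1)-\nabla_x\Phi(x_1,y_2)\|\le L_{xy}\|y_1-y_2\|$, $\|\nabla_y \Phi(x_1,y_1)-\nabla_y\Phi(x_2,y_1)\|\le L_{xy}\|x_1-x_2\|$. $L:=\max\{L_x,L_y,L_{xy}\}$. Assumption (Lipschitz): there are $\ell_x,\ell_y>0$ such that for almost every $\xi$, $\Phi_\xi(\cdot,y)$ is $\ell_x$-Lipschitz on $\mathcal X$ for every $y\in\mathcal Y$ and $\Phi_\xi(x,\cdot)$ is $\ell_y$-Lipschitz on $\mathcal Y$ for every $x\in\mathcal X$. $\ell:=\max\{\ell_x,\ell_y\}$. Regularized objective: $\Phi_\alpha(x,y):=\Phi(x,y)+\frac{\alpha_x}{2}\|x-x'\|^2-\frac{\alpha_y}{2}\|y-y'\|^2$ with $(x',y')\in\mathcal X\times\mathcal Y$ arbitrary; per-sample version $\Phi_{\alpha,\xi}:=\Phi_\xi+\frac{\alpha_x}{2}\|x-x'\|^2-\frac{\alpha_y}{2}\|y-y'\|^2$. It is strongly convex-strongly concave with moduli $(\mu_x,\mu_y):=(\alpha_x,\alpha_y)$ and smooth with constants $(\bar L_x,\bar L_y,L_{xy}):=(L_x+\alpha_x,L_y+\alpha_y,L_{xy})$. Applying BoostSAA-C to $\Phi_\alpha$ with accuracy $\epsilon'$ means running the procedure below with these $\mu_x,\mu_y,\bar L_x,\bar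 L_y,L_{xy}$, with the Lipschitz constants $\ell_x,\ell_y$ of the unregularized $\Phi_\xi$, and with $T=\left\lceil \log_2\max\left(\frac{\bar L_x}{\mu_x},\frac{\bar L_y}{\mu_y},\frac{L_{xy}^2}{\mu_x\mu_y}\right)\right\rceil$, $\delta=\frac{\epsilon'}{4+4T}$, $\lambda_x^i=\mu_x2^i$, $\lambda_y^i=\mu_y2^i$ ($0\le i\le T$), $\lambda_x^{-1}=\lambda_y^{-1}=0$. Stochastic gradients: $G_x(x,y,\xi):=\nabla_x\Phi_{\xi}(x,y)+\alpha_x(x-x')$, $G_y(x,y,\xi):=\nabla_y\Phi_\xi(x,y)-\alpha_y(y-y')$, unbiased for $\nabla_x\Phi_\alpha,\nabla_y\Phi_\alpha$ with variances at most $\sigma_x^2:=4\ell_x^2$, $\sigma_y^2:=4\ell_y^2$ (using $\|\nabla_x\Phi_\xi\|\le\ell_x$, $\|\nabla_y\Phi_\xi\|\le\ell_y$ on $\mathcal X\times\mathcal Y$). Extract$(\{z_j\}_{j=1}^m,\rho)$ for a pseudometric $\rho$: for each $j$ let $r_j=\min\{r\ge0:|\{k:\rho(z_j,z_k)\le r\}|>m/2\}$; let $\hat r$ be the $\lceil m/2\rceil$-th smallest of $r_1,\dots,r_m$; return $\{k:r_k\le\hat r\}$. SAA$(n,\lambda_x,\lambda_y,x^c,y^c)$: draw fresh i.i.d. $\xi_1,\dots,\xi_n\sim\mathcal P$ and return the saddle point $(\hat x,\hat y)$ of $\min_{x\in\mathcal X}\max_{y\in\mathcal Y}\frac1n\sum_{i=1}^n\Phi_{\alpha,\xi_i}(x,y)+\frac{\lambda_x}{2}\|x-x^c\|^2-\frac{\lambda_y}{2}\|y-y^c\|^2$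 (a center is irrelevant, "null", if its coefficient is $0$). RobustSAA$(n,m,\lambda_x,\lambda_y,x^c,y^c)$: call SAA$(n,\lambda_x,\lambda_y,x^c,y^c)$ independently $m$ times to get $(\hat x_j,\hat y_j)_{j=1}^m$; with $\rho$ the Euclidean distance pick arbitrary $k_1\in\text{Extract}(\{\hat x_j\},\rho)$, $k_2\in\text{Extract}(\{\hat y_j\},\rho)$; return $(\hat x_{k_1},\hat y_{k_2})$. Last-round oracle: $\mathcal M_x^w(\eta):=\text{SAA}(n,\lambda_x^T,0,x_T^c,\text{null})$ with $n=\left\lceil\frac{2}{\eta}\left(\frac{\ell_x^2}{\mu_x+\lambda_x^T}+\frac{\ell_y^2}{\mu_y}\right)\right\rceil$; $\mathcal M_y^w(\eta):=\text{SAA}(n,0,\lambda_y^T,\text{null},y_T^c)$ with $n=\left\lceil\frac{2}{\eta}\left(\frac{\ell_x^2}{\mu_x}+\frac{\ell_y^2}{\mu_y+\lambda_y^T}\right)\right\rceil$. Gradient$(x,y,\delta_G,m,\text{Flag})$: let $(G,\sigma)=(G_x,\sigma_x)$ if Flag $=1$, $(G_y,\sigma_y)$ if Flag $=0$; $n=\lceil 3\sigma^2/\delta_G^2\rceil$; for $j=1,\dots,m$ draw fresh i.i.d. $\xi_1,\dots,\xi_n$ and form $\frac1n\sum_{i=1}^n G(x,y,\xi_i)$; apply Extract (Euclidean distance) to these $m$ vectors and return one with arbitrary extracted index. FunctionGap$(\eta,m,\text{Flag})$, $m$ odd: (1) set $\delta_G=(\bar L_x+\lambda_x^T)\sqrt{\eta/(\mu_x+\lambda_x^T)}$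 if Flag $=1$, $\delta_G=(\bar L_y+\lambda_y^T)\sqrt{\eta/(\mu_y+\lambda_y^T)}$ if Flag $=0$. (2) Independently generate $(\hat x_j,\hat y_j)$, $j=1,\dots,m$, by calling $\mathcal M_x^w(\eta/3)$ if Flag $=1$, $\mathcal M_y^w(\eta/3)$ if Flag $=0$. (3) With $\rho_1$ the Euclidean distance compute $\mathcal I_1=\text{Extract}(\{\hat x_j\},\rho_1)$, $\mathcal I_2=\text{Extract}(\{\hat y_j\},\rho_1)$, pick arbitrary $k_1\in\mathcal I_1$, $k_2\in\mathcal I_2$, set $x_G=\hat x_{k_1}$, $y_G=\hat y_{k_2}$. (4) If Flag $=1$: $v=\text{Gradient}(x_G,y_G,\delta_G,m,1)+\lambda_x^T(x_G-x_T^c)$, $\rho_2(x_1,x_2)=|\langle v,x_1-x_2\rangle|$, $\mathcal I_3=\text{Extract}(\{\hat x_j\},\rho_2)$, return $\hat x_{k_3}$ for arbitrary $k_3\in\mathcal I_1\cap\mathcal I_3$. If Flag $=0$: $v=\text{Gradient}(x_G,y_G,\delta_G,m,0)-\lambda_y^T(y_G-y_T^c)$, $\rho_2(y_1,y_2)=|\langle v,y_1-y_2\rangle|$, $\mathcal I_3=\text{Extract}(\{\hat y_j\},\rho_2)$, return $\hat y_{k_3}$ for arbitrary $k_3\in\mathcal I_2\cap\mathcal I_3$. Constants: $M_x^T:=3+(18\sqrt2+45)\frac{\bar L_x+\lambda_x^T}{\mu_x+\lambda_x^T}+\frac{36L_{xy}}{\sqrt{(\mu_x+\lambda_x^T)\mu_y}}+\frac{9L_{xy}^2}{(\mu_x+\lambda_x^T)\mu_y}$,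 $M_y^T:=3+(18\sqrt2+45)\frac{\bar L_y+\lambda_y^T}{\mu_y+\lambda_y^T}+\frac{36L_{xy}}{\sqrt{\mu_x(\mu_y+\lambda_y^T)}}+\frac{9L_{xy}^2}{\mu_x(\mu_y+\lambda_y^T)}$. BoostSAA-C: let $m$ be whichever of $\lceil18\ln(\frac{2T+6}{p})\rceil$, $\lceil18\ln(\frac{2T+6}{p})\rceil+1$ is odd. For $i=0,\dots,T$: $n_x^{i-1}=\left\lceil\frac{54}{\delta}\left(\frac{\ell_x^2}{\mu_x+\lambda_x^{i-1}}+\frac{\ell_y^2}{\mu_y}\right)\right\rceil$, $n_y^{i-1}=\left\lceil\frac{54}{\delta}\left(\frac{\ell_x^2}{\mu_x}+\frac{\ell_y^2}{\mu_y+\lambda_y^{i-1}}\right)\right\rceil$; $x_i^c$ = $x$-component of RobustSAA$(n_x^{i-1},m,\lambda_x^{i-1},0,x_{i-1}^c,\text{null})$; $y_i^c$ = $y$-component of RobustSAA$(n_y^{i-1},m,0,\lambda_y^{i-1},\text{null},y_{i-1}^c)$ (centers of index $-1$ are irrelevant). Return $\bar x=\text{FunctionGap}(\delta/M_x^T,m,1)$ and $\bar y=\text{FunctionGap}(\delta/M_y^T,m,0)$. All calls use fresh independent samples. Conventions: $\mathcal O$ hides an absolute constant; each logarithm $\ln s$ inside $\mathcal O(\cdot)$ is read as $\max\{1,\ln s\}$; rounding up of individual sample sizes to integers is disregarded in the sample count. *)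

theory Defs
  imports "HOL-Probability.Probability"
begin

definition expected_objective ::
  "'s measure \<Rightarrow> ('s \<Rightarrow> 'x \<Rightarrow> 'y \<Rightarrow> real) \<Rightarrow> 'x \<Rightarrow> 'y \<Rightarrow> real" where
  "expected_objective P f x y = (\<integral>\<xi>. f \<xi> x y \<partial>P)"

text \<open>For a continuous function on compact sets both extrema are attained.\<close>

definition duality_gap ::
  "'x set \<Rightarrow> 'y set \<Rightarrow> ('x \<Rightarrow> 'y \<Rightarrow> real) \<Rightarrow> 'x \<Rightarrow> 'y \<Rightarrow> real" where
  "duality_gap X Y F xh yh = (SUP y\<in>Y. F xh y) - (INF x\<in>X. F x yh)"

definition saddle_point ::
  "'x set \<Rightarrow> 'y set \<Rightarrow> ('x \<Rightarrow> 'y \<Rightarrow> real) \<Rightarrow> 'x \<times> 'y \<Rightarrow> bool" where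
  "saddle_point X Y F z \<longleftrightarrow> fst z \<in> X \<and> snd z \<in> Y \<and>
     (\<forall>y\<in>Y. F (fst z) y \<le> F (fst z) (snd z)) \<and>
     (\<forall>x\<in>X. F (fst z) (snd z) \<le> F x (snd z))"

text \<open>Indices of the \<open>m\<close> points run over \<open>0, \<dots>, m - 1\<close>; the \<open>r\<close>-th smallest
  radius is entry \<open>r - 1\<close> of the sorted list.\<close>

definition extract_radius :: "nat \<Rightarrow> ('a \<Rightarrow> 'a \<Rightarrow> real) \<Rightarrow> (nat \<Rightarrow> 'a) \<Rightarrow> nat \<Rightarrow> real" where
  "extract_radius m \<rho> z j =
     (LEAST r. 0 \<le> r \<and> real (card {k. k < m \<and> \<rho> (z j) (z k) \<le> r}) > real m / 2)"

definition extract_set :: "nat \<Rightarrow> ('a \<Rightarrow> 'a \<Rightarrow> real) \<Rightarrow> (nat \<Rightarrow> 'a) \<Rightarrow> nat set" where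
  "extract_set m \<rho> z =
     (let r = extract_radius m \<rho> z;
          rhat = sort (map r [0..<m]) ! (nat \<lceil>real m / 2\<rceil> - 1)
      in {k. k < m \<and> r k \<le> rhat})"

text \<open>A stochastic saddle point problem as seen by the algorithm: feasible sets, per-sample
  objective, and per-sample partial gradients.\<close>

record ('s, 'x, 'y) problem =
  dom_x :: "'x set"
  dom_y :: "'y set"
  obj :: "'s \<Rightarrow> 'x \<Rightarrow> 'y \<Rightarrow> real"
  grad_x :: "'s \<Rightarrow> 'x \<Rightarrow> 'y \<Rightarrow> 'x"
  grad_y :: "'s \<Rightarrow> 'x \<Rightarrow> 'y \<Rightarrow> 'y"

text \<open>Numerical inputs of the algorithm: moduli, smoothness constants, Lipschitz constants,
  standard deviation bounds, target accuracy, and failure probability.\<close>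

record params =
  mu_x :: real
  mu_y :: real
  sm_x :: real
  sm_y :: real
  sm_xy :: real
  lip_x :: real
  lip_y :: real
  sig_x :: real
  sig_y :: real
  acc :: real
  fail :: real

definition SAA ::
  "('s, 'x::real_normed_vector, 'y::real_normed_vector) problem \<Rightarrow> nat \<Rightarrow> real \<Rightarrow> real \<Rightarrow>
   'x \<Rightarrow> 'y \<Rightarrow> (nat \<Rightarrow> 's) \<Rightarrow> 'x \<times> 'y" where
  "SAA Q n lx ly xc yc \<xi> = (THE z. saddle_point (dom_x Q) (dom_y Q)
     (\<lambda>x y. (1 / real n) * (\<Sum>i<n. obj Q (\<xi> i) x y)
        + lx / 2 * (norm (x - xc))\<^sup>2 - ly / 2 * (norm (y - yc))\<^sup>2) z)"

definition rounds :: "params \<Rightarrow> nat" where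
  "rounds c = nat \<lceil>log 2 (max (sm_x c / mu_x c)
     (max (sm_y c / mu_y c) ((sm_xy c)\<^sup>2 / (mu_x c * mu_y c))))\<rceil>"

definition delta :: "params \<Rightarrow> real" where
  "delta c = acc c / (4 + 4 * real (rounds c))"

definition reps :: "params \<Rightarrow> nat" where
  "reps c = (let k = nat \<lceil>18 * ln ((2 * real (rounds c) + 6) / fail c)\<rceil>
             in if odd k then k else k + 1)"

text \<open>Regularization weights and centers are indexed with a shift by one:
  argument \<open>i\<close> stands for the superscript (subscript) \<open>i - 1\<close>, so that argument \<open>0\<close>
  is the initial weight \<open>0\<close> and the irrelevant initial center.\<close>

fun lam :: "real \<Rightarrow> nat \<Rightarrow> real" where
  "lam \<mu> 0 = 0"
| "lam \<mu> (Suc i) = \<mu> * 2 ^ i"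

definition lamT_x :: "params \<Rightarrow> real" where
  "lamT_x c = lam (mu_x c) (Suc (rounds c))"

definition lamT_y :: "params \<Rightarrow> real" where
  "lamT_y c = lam (mu_y c) (Suc (rounds c))"

definition gap_const_x :: "params \<Rightarrow> real" where
  "gap_const_x c = 3 + (18 * sqrt 2 + 45) * ((sm_x c + lamT_x c) / (mu_x c + lamT_x c))
     + 36 * sm_xy c / sqrt ((mu_x c + lamT_x c) * mu_y c)
     + 9 * (sm_xy c)\<^sup>2 / ((mu_x c + lamT_x c) * mu_y c)"

definition gap_const_y :: "params \<Rightarrow> real" where
  "gap_const_y c = 3 + (18 * sqrt 2 + 45) * ((sm_y c + lamT_y c) / (mu_y c + lamT_y c))
     + 36 * sm_xy c / sqrt (mu_x c * (mu_y c + lamT_y c))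
     + 9 * (sm_xy c)\<^sup>2 / (mu_x c * (mu_y c + lamT_y c))"

definition eta_x :: "params \<Rightarrow> real" where
  "eta_x c = delta c / gap_const_x c"

definition eta_y :: "params \<Rightarrow> real" where
  "eta_y c = delta c / gap_const_y c"

definition delta_grad_x :: "params \<Rightarrow> real" where
  "delta_grad_x c = (sm_x c + lamT_x c) * sqrt (eta_x c / (mu_x c + lamT_x c))"

definition delta_grad_y :: "params \<Rightarrow> real" where
  "delta_grad_y c = (sm_y c + lamT_y c) * sqrt (eta_y c / (mu_y c + lamT_y c))"

text \<open>The sampling stages of a run: \<open>Center_x i\<close> and \<open>Center_y i\<close> are the two robust SAA
  calls of round \<open>i\<close>; \<open>Gap_x\<close>, \<open>Grad_x\<close> are the SAA calls and the gradient estimation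
  inside the first function gap call, \<open>Gap_y\<close>, \<open>Grad_y\<close> those inside the second one.
  Every stage consists of \<open>reps\<close> independent batches of the same size.\<close>

datatype stage = Center_x nat | Center_y nat | Gap_x | Grad_x | Gap_y | Grad_y

definition stages :: "params \<Rightarrow> stage set" where
  "stages c = Center_x ` {..rounds c} \<union> Center_y ` {..rounds c} \<union> {Gap_x, Grad_x, Gap_y, Grad_y}"

fun stage_time :: "params \<Rightarrow> stage \<Rightarrow> nat" where
  "stage_time c (Center_x i) = 2 * i"
| "stage_time c (Center_y i) = 2 * i + 1"
| "stage_time c Gap_x = 2 * rounds c + 2"
| "stage_time c Grad_x = 2 * rounds c + 3"
| "stage_time c Gap_y = 2 * rounds c + 4"
| "stage_time c Grad_y = 2 * rounds c + 5"

text \<open>Batch sizes before rounding up.\<close>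

fun raw_size :: "params \<Rightarrow> stage \<Rightarrow> real" where
  "raw_size c (Center_x i) = 54 / delta c *
     ((lip_x c)\<^sup>2 / (mu_x c + lam (mu_x c) i) + (lip_y c)\<^sup>2 / mu_y c)"
| "raw_size c (Center_y i) = 54 / delta c *
     ((lip_x c)\<^sup>2 / mu_x c + (lip_y c)\<^sup>2 / (mu_y c + lam (mu_y c) i))"
| "raw_size c Gap_x = 2 / (eta_x c / 3) *
     ((lip_x c)\<^sup>2 / (mu_x c + lamT_x c) + (lip_y c)\<^sup>2 / mu_y c)"
| "raw_size c Grad_x = 3 * (sig_x c)\<^sup>2 / (delta_grad_x c)\<^sup>2"
| "raw_size c Gap_y = 2 / (eta_y c / 3) *
     ((lip_x c)\<^sup>2 / mu_x c + (lip_y c)\<^sup>2 / (mu_y c + lamT_y c))"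
| "raw_size c Grad_y = 3 * (sig_y c)\<^sup>2 / (delta_grad_y c)\<^sup>2"

definition batch_size :: "params \<Rightarrow> stage \<Rightarrow> nat" where
  "batch_size c s = nat \<lceil>raw_size c s\<rceil>"

text \<open>Sample count of a run, disregarding the rounding of the batch sizes.\<close>

definition total_samples :: "params \<Rightarrow> real" where
  "total_samples c = (\<Sum>s\<in>stages c. real (reps c) * raw_size c s)"

text \<open>The samples of a run: \<open>\<omega> (s, j, i)\<close> is sample \<open>i\<close> of batch \<open>j\<close> of stage \<open>s\<close>.\<close>

definition sample_index :: "params \<Rightarrow> (stage \<times> nat \<times> nat) set" where
  "sample_index c = {(s, j, i). s \<in> stages c \<and> j < reps c \<and> i < batch_size c s}"

definition sample_space :: "'s measure \<Rightarrow> params \<Rightarrow> (stage \<times> nat \<times> nat \<Rightarrow> 's) measure" where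
  "sample_space P c = Pi\<^sub>M (sample_index c) (\<lambda>_. P)"

definition history :: "params \<Rightarrow> stage \<Rightarrow> (stage \<times> nat \<times> nat) set" where
  "history c s = {(s', j, i). (s', j, i) \<in> sample_index c \<and> stage_time c s' \<le> stage_time c s}"

text \<open>The arbitrary choices of indices: \<open>K s q\<close> is the rule for the \<open>q\<close>-th choice made after
  the samples of stage \<open>s\<close> are drawn. A rule may depend on all samples drawn so far, but not on
  those drawn later.\<close>

type_synonym 's picks = "stage \<Rightarrow> nat \<Rightarrow> (stage \<times> nat \<times> nat \<Rightarrow> 's) \<Rightarrow> nat"

definition pick :: "params \<Rightarrow> 's picks \<Rightarrow> (stage \<times> nat \<times> nat \<Rightarrow> 's) \<Rightarrow> stage \<Rightarrow> nat \<Rightarrow> nat" where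
  "pick c K \<omega> s q = K s q (restrict \<omega> (history c s))"

definition adapted_picks :: "'s measure \<Rightarrow> params \<Rightarrow> 's picks \<Rightarrow> bool" where
  "adapted_picks P c K \<longleftrightarrow>
     (\<forall>s\<in>stages c. \<forall>q. K s q \<in> measurable (Pi\<^sub>M (history c s) (\<lambda>_. P)) (count_space UNIV))"

text \<open>Solution of the \<open>j\<close>-th SAA problem of stage \<open>s\<close>, regularized only in \<open>x\<close> (only in \<open>y\<close>).
  The center belonging to weight \<open>0\<close> is irrelevant and taken to be the origin.\<close>

definition solve_x where
  "solve_x Q c \<omega> s i xc j =
     SAA Q (batch_size c s) (lam (mu_x c) i) 0 xc 0 (\<lambda>l. \<omega> (s, j, l))"

definition solve_y where
  "solve_y Q c \<omega> s i yc j =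
     SAA Q (batch_size c s) 0 (lam (mu_y c) i) 0 yc (\<lambda>l. \<omega> (s, j, l))"

text \<open>Combination of the first component of one and the second component of another candidate.\<close>

definition combine :: "(nat \<Rightarrow> 'x \<times> 'y) \<Rightarrow> nat \<Rightarrow> nat \<Rightarrow> 'x \<times> 'y" where
  "combine z k1 k2 = (fst (z k1), snd (z k2))"

primrec center_x ::
  "('s, 'x::real_normed_vector, 'y::real_normed_vector) problem \<Rightarrow> params \<Rightarrow> 's picks \<Rightarrow>
   (stage \<times> nat \<times> nat \<Rightarrow> 's) \<Rightarrow> nat \<Rightarrow> 'x" where
  "center_x Q c K \<omega> 0 = 0"
| "center_x Q c K \<omega> (Suc i) =
     fst (combine (solve_x Q c \<omega> (Center_x i) i (center_x Q c K \<omega> i))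
       (pick c K \<omega> (Center_x i) 1) (pick c K \<omega> (Center_x i) 2))"

primrec center_y ::
  "('s, 'x::real_normed_vector, 'y::real_normed_vector) problem \<Rightarrow> params \<Rightarrow> 's picks \<Rightarrow>
   (stage \<times> nat \<times> nat \<Rightarrow> 's) \<Rightarrow> nat \<Rightarrow> 'y" where
  "center_y Q c K \<omega> 0 = 0"
| "center_y Q c K \<omega> (Suc i) =
     snd (combine (solve_y Q c \<omega> (Center_y i) i (center_y Q c K \<omega> i))
       (pick c K \<omega> (Center_y i) 1) (pick c K \<omega> (Center_y i) 2))"

definition centerT_x where
  "centerT_x Q c K \<omega> = center_x Q c K \<omega> (Suc (rounds c))"

definition centerT_y where
  "centerT_y Q c K \<omega> = center_y Q c K \<omega> (Suc (rounds c))"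

definition gap_candidate_x where
  "gap_candidate_x Q c K \<omega> =
     solve_x Q c \<omega> Gap_x (Suc (rounds c)) (centerT_x Q c K \<omega>)"

definition gap_candidate_y where
  "gap_candidate_y Q c K \<omega> =
     solve_y Q c \<omega> Gap_y (Suc (rounds c)) (centerT_y Q c K \<omega>)"

text \<open>The point at which the gradient is estimated.\<close>

definition grad_point_x where
  "grad_point_x Q c K \<omega> =
     combine (gap_candidate_x Q c K \<omega>) (pick c K \<omega> Gap_x 1) (pick c K \<omega> Gap_x 2)"

definition grad_point_y where
  "grad_point_y Q c K \<omega> =
     combine (gap_candidate_y Q c K \<omega>) (pick c K \<omega> Gap_y 1) (pick c K \<omega> Gap_y 2)"

definition batch_grad_x where
  "batch_grad_x Q c K \<omega> j = (1 / real (batch_size c Grad_x)) *\<^sub>R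
     (\<Sum>i<batch_size c Grad_x. grad_x Q (\<omega> (Grad_x, j, i))
        (fst (grad_point_x Q c K \<omega>)) (snd (grad_point_x Q c K \<omega>)))"

definition batch_grad_y where
  "batch_grad_y Q c K \<omega> j = (1 / real (batch_size c Grad_y)) *\<^sub>R
     (\<Sum>i<batch_size c Grad_y. grad_y Q (\<omega> (Grad_y, j, i))
        (fst (grad_point_y Q c K \<omega>)) (snd (grad_point_y Q c K \<omega>)))"

definition direction_x where
  "direction_x Q c K \<omega> = batch_grad_x Q c K \<omega> (pick c K \<omega> Grad_x 1)
     + lamT_x c *\<^sub>R (fst (grad_point_x Q c K \<omega>) - centerT_x Q c K \<omega>)"

definition direction_y where
  "direction_y Q c K \<omega> = batch_grad_y Q c K \<omega> (pick c K \<omega> Grad_y 1)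
     - lamT_y c *\<^sub>R (snd (grad_point_y Q c K \<omega>) - centerT_y Q c K \<omega>)"

definition output_x where
  "output_x Q c K \<omega> = fst (gap_candidate_x Q c K \<omega> (pick c K \<omega> Grad_x 2))"

definition output_y where
  "output_y Q c K \<omega> = snd (gap_candidate_y Q c K \<omega> (pick c K \<omega> Grad_y 2))"

text \<open>All choices made on the run \<open>\<omega>\<close> are elements of the sets they have to be taken from.\<close>

definition valid_picks ::
  "('s, 'x::euclidean_space, 'y::euclidean_space) problem \<Rightarrow> params \<Rightarrow> 's picks \<Rightarrow>
   (stage \<times> nat \<times> nat \<Rightarrow> 's) \<Rightarrow> bool" where
  "valid_picks Q c K \<omega> \<longleftrightarrow>
     (\<forall>i\<le>rounds c.
        let z = solve_x Q c \<omega> (Center_x i) i (center_x Q c K \<omega> i) in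
          pick c K \<omega> (Center_x i) 1 \<in> extract_set (reps c) dist (\<lambda>j. fst (z j)) \<and>
          pick c K \<omega> (Center_x i) 2 \<in> extract_set (reps c) dist (\<lambda>j. snd (z j))) \<and>
     (\<forall>i\<le>rounds c.
        let z = solve_y Q c \<omega> (Center_y i) i (center_y Q c K \<omega> i) in
          pick c K \<omega> (Center_y i) 1 \<in> extract_set (reps c) dist (\<lambda>j. fst (z j)) \<and>
          pick c K \<omega> (Center_y i) 2 \<in> extract_set (reps c) dist (\<lambda>j. snd (z j))) \<and>
     (let z = gap_candidate_x Q c K \<omega>;
          v = direction_x Q c K \<omega>;
          I1 = extract_set (reps c) dist (\<lambda>j. fst (z j));
          I2 = extract_set (reps c) dist (\<lambda>j. snd (z j));
          I3 = extract_set (reps c) (\<lambda>a b. \<bar>v \<bullet> (a - b)\<bar>) (\<lambda>j. fst (z j)) in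
        pick c K \<omega> Gap_x 1 \<in> I1 \<and> pick c K \<omega> Gap_x 2 \<in> I2 \<and>
        pick c K \<omega> Grad_x 1 \<in> extract_set (reps c) dist (batch_grad_x Q c K \<omega>) \<and>
        pick c K \<omega> Grad_x 2 \<in> I1 \<inter> I3) \<and>
     (let z = gap_candidate_y Q c K \<omega>;
          v = direction_y Q c K \<omega>;
          I1 = extract_set (reps c) dist (\<lambda>j. fst (z j));
          I2 = extract_set (reps c) dist (\<lambda>j. snd (z j));
          I3 = extract_set (reps c) (\<lambda>a b. \<bar>v \<bullet> (a - b)\<bar>) (\<lambda>j. snd (z j)) in
        pick c K \<omega> Gap_y 1 \<in> I1 \<and> pick c K \<omega> Gap_y 2 \<in> I2 \<and>
        pick c K \<omega> Grad_y 1 \<in> extract_set (reps c) dist (batch_grad_y Q c K \<omega>) \<and>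
        pick c K \<omega> Grad_y 2 \<in> I2 \<inter> I3)"

definition regularized_problem ::
  "'x::real_normed_vector set \<Rightarrow> 'y::real_normed_vector set \<Rightarrow> ('s \<Rightarrow> 'x \<Rightarrow> 'y \<Rightarrow> real) \<Rightarrow>
   ('s \<Rightarrow> 'x \<Rightarrow> 'y \<Rightarrow> 'x) \<Rightarrow> ('s \<Rightarrow> 'x \<Rightarrow> 'y \<Rightarrow> 'y) \<Rightarrow> real \<Rightarrow> real \<Rightarrow> 'x \<Rightarrow> 'y \<Rightarrow>
   ('s, 'x, 'y) problem" where
  "regularized_problem X Y f gx gy \<alpha>x \<alpha>y x' y' =
    \<lparr> dom_x = X, dom_y = Y,
      obj = (\<lambda>\<xi> x y. f \<xi> x y + \<alpha>x / 2 * (norm (x - x'))\<^sup>2 - \<alpha>y / 2 * (norm (y - y'))\<^sup>2),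
      grad_x = (\<lambda>\<xi> x y. gx \<xi> x y + \<alpha>x *\<^sub>R (x - x')),
      grad_y = (\<lambda>\<xi> x y. gy \<xi> x y - \<alpha>y *\<^sub>R (y - y')) \<rparr>"

text \<open>The inputs for the regularized problem with weights \<open>\<alpha>x\<close>, \<open>\<alpha>y\<close> and accuracy \<open>\<epsilon>'\<close>. The
  Lipschitz constants are those of the objective without regularization.\<close>

definition regularized_params ::
  "real \<Rightarrow> real \<Rightarrow> real \<Rightarrow> real \<Rightarrow> real \<Rightarrow> real \<Rightarrow> real \<Rightarrow> real \<Rightarrow> real \<Rightarrow> params" where
  "regularized_params Lx Ly Lxy lx ly \<alpha>x \<alpha>y \<epsilon>' p =
    \<lparr> mu_x = \<alpha>x, mu_y = \<alpha>y, sm_x = Lx + \<alpha>x, sm_y = Ly + \<alpha>y, sm_xy = Lxy,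
      lip_x = lx, lip_y = ly, sig_x = 2 * lx, sig_y = 2 * ly, acc = \<epsilon>', fail = p \<rparr>"

text \<open>The logarithm as it is read inside the sample bound.\<close>

definition ln_ge1 :: "real \<Rightarrow> real" where
  "ln_ge1 s = max 1 (ln s)"

end

theory Submission
  imports Defs
begin

text \<open>One SAA batch is stable under the exchange of a sample, so that the expected gap of its saddle
  point against the population saddle point is at most twice the stability constant divided by the
  batch size. By Markov's inequality a batch is good with probability \<open>2 / 3\<close>; conditionally on
  the past the batches of a stage are independent, so by Hoeffding's inequality a majority of them is
  good except with probability \<open>p / (2 T + 6)\<close>, and there are \<open>2 T + 6\<close> stages. On the
  complement of all failures everything is deterministic: extraction loses a factor \<open>3\<close> in distance,
  the centers lie close to the proximal points, a telescoping argument over the doubling weights adds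
  up the losses of the rounds, and the last round controls the primal (dual) function value through
  the first-order expansion at its saddle point, the error in the gradient direction being filtered by
  the pseudometric of the third extraction.\<close>

section \<open>Strong convexity and saddle points\<close>

text \<open>Condition numbers must not enter the sample count. Doubling the weights lets the last
  one dominate the smoothness constants, so that the loss factor of the last step is at most 200;
  the price is T + 1 rounds, each losing a multiple of \<delta>, hence the division of the accuracy
  by 4 + 4 T.

  The obstacle is dependence. Centers, evaluation points and picks are random and rest on arbitrary
  choices, so a stage can be analysed only with its past frozen, and Fubini's theorem demands
  measurable events. Saddle points are therefore shown to depend measurably on samples and centers,
  which works because they are unique. Moreover the assumptions hold only almost surely, while a run
  is defined pointwise by definite descriptions; the analysis is carried out for data that are
  regular at every sample and is transferred at the end.

  The maximizing player is handled by exchanging the players and changing signs. Of the accuracy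
  \<epsilon>, half goes to the regularized problem and a quarter to each regularization
  term.\<close>

definition strongly_convex_on :: "'a::real_normed_vector set \<Rightarrow> real \<Rightarrow> ('a \<Rightarrow> real) \<Rightarrow> bool" where
  "strongly_convex_on S \<mu> g \<longleftrightarrow> (\<forall>x\<in>S. \<forall>y\<in>S. \<forall>t. 0 \<le> t \<and> t \<le> 1 \<longrightarrow>
     g ((1 - t) *\<^sub>R x + t *\<^sub>R y) \<le> (1 - t) * g x + t * g y - \<mu> / 2 * (t * (1 - t)) * (norm (x - y))\<^sup>2)"

lemma strongly_convex_onD:
  assumes "strongly_convex_on S \<mu> g" "x \<in> S" "y \<in> S" "0 \<le> t" "t \<le> 1"
  shows "g ((1 - t) *\<^sub>R x + t *\<^sub>R y) \<le> (1 - t) * g x + t * g y - \<mu> / 2 * (t * (1 - t)) * (norm (x - y))\<^sup>2"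
  using assms unfolding strongly_convex_on_def by blast

lemma norm_convex_combination_diff_power2:
  fixes x y c :: "'a::real_inner"
  shows "(norm ((1 - t) *\<^sub>R x + t *\<^sub>R y - c))\<^sup>2 =
    (1 - t) * (norm (x - c))\<^sup>2 + t * (norm (y - c))\<^sup>2 - (t * (1 - t)) * (norm (x - y))\<^sup>2"
  unfolding power2_norm_eq_inner
  by (simp add: inner_diff_left inner_diff_right inner_add_left inner_add_right inner_commute
      algebra_simps power2_eq_square)

text \<open>The preceding identity turns the defining inequality into an equality, whatever the sign
  of \<mu>.\<close>

lemma strongly_convex_on_quadratic:
  fixes c :: "'a::real_inner"
  shows "strongly_convex_on S \<mu> (\<lambda>x. \<mu> / 2 * (norm (x - c))\<^sup>2)"
  unfolding strongly_convex_on_def norm_convex_combination_diff_power2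
  by (simp add: field_simps)

lemma strongly_convex_on_add:
  assumes "strongly_convex_on S \<mu> g" "strongly_convex_on S \<nu> h"
  shows "strongly_convex_on S (\<mu> + \<nu>) (\<lambda>x. g x + h x)"
  unfolding strongly_convex_on_def
proof (intro ballI allI impI)
  fix x y t assume "x \<in> S" "y \<in> S" "0 \<le> t \<and> t \<le> (1::real)"
  with strongly_convex_onD[OF assms(1), of x y t] strongly_convex_onD[OF assms(2), of x y t]
  show "g ((1 - t) *\<^sub>R x + t *\<^sub>R y) + h ((1 - t) *\<^sub>R x + t *\<^sub>R y) \<le>
    (1 - t) * (g x + h x) + t * (g y + h y) - (\<mu> + \<nu>) / 2 * (t * (1 - t)) * (norm (x - y))\<^sup>2"
    by (simp add: algebra_simps add_divide_distrib)
qed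

lemma convex_on_imp_strongly_convex_on: "convex_on S g \<Longrightarrow> strongly_convex_on S 0 g"
  unfolding strongly_convex_on_def by (auto intro: convex_onD)

text \<open>Comparing \<open>x\<close> with the point at parameter \<open>t\<close> of the segment
  to \<open>z\<close> and dividing by \<open>t\<close> leaves a factor \<open>1 - t\<close> in front
  of the quadratic term; letting \<open>t\<close> tend to 0 removes it. No derivative enters, so the
  bound applies in \<open>sampled_saddle_problem\<close>, where samples are only Lipschitz.\<close>

lemma strongly_convex_on_growth:
  fixes x :: "'a::real_normed_vector"
  assumes sc: "strongly_convex_on S \<mu> g" and "convex S" and x: "x \<in> S"
    and min: "\<And>z. z \<in> S \<Longrightarrow> g x \<le> g z" and z: "z \<in> S"
  shows "g x + \<mu> / 2 * (norm (z - x))\<^sup>2 \<le> g z"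
proof -
  define b where "b = \<mu> / 2 * (norm (x - z))\<^sup>2"
  have *: "g x + (1 - t) * b \<le> g z" if t: "0 < t" "t \<le> 1" for t
  proof -
    have "(1 - t) *\<^sub>R x + t *\<^sub>R z \<in> S"
      using \<open>convex S\<close> x z t by (simp add: convexD)
    from min[OF this] strongly_convex_onD[OF sc x z, of t] t
    have "t * (g x + (1 - t) * b) \<le> t * g z" by (simp add: b_def algebra_simps)
    then show ?thesis using t by simp
  qed
  have "((\<lambda>t. g x + (1 - t) * b) \<longlongrightarrow> g x + (1 - 0) * b) (at_right 0)"
    by (intro tendsto_intros)
  then have "g x + (1 - 0) * b \<le> g z"
    by (rule tendsto_upperbound)
      (use * in \<open>auto simp: eventually_at_right[OF zero_less_one] intro!: exI[of _ 1]\<close>)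
  then show ?thesis by (simp add: b_def norm_minus_commute)
qed

lemma strongly_convex_on_minimizer_unique:
  fixes x :: "'a::real_normed_vector"
  assumes sc: "strongly_convex_on S \<mu> g" and "convex S" "\<mu> > 0" "x \<in> S" "y \<in> S"
    and "\<And>z. z \<in> S \<Longrightarrow> g x \<le> g z" "\<And>z. z \<in> S \<Longrightarrow> g y \<le> g z"
  shows "x = y"
proof -
  have "g x + \<mu> / 2 * (norm (y - x))\<^sup>2 \<le> g x"
    using strongly_convex_on_growth[OF sc \<open>convex S\<close> \<open>x \<in> S\<close> _ \<open>y \<in> S\<close>] assms by fastforce
  then show ?thesis using \<open>\<mu> > 0\<close>
    by (metis add_le_cancel_left add.right_neutral eq_iff_diff_eq_0 half_gt_zero_iff
        mult_pos_pos norm_minus_commute not_less power2_eq_square zero_less_norm_iff zero_less_power)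
qed

text \<open>The cross form does not mention the saddle value: it passes to limits, it is what best
  responses deliver, and it returns the two halves at \<open>x = a\<close> and
  \<open>y = b\<close>.\<close>

lemma saddle_point_iff:
  "saddle_point X Y F (a, b) \<longleftrightarrow> a \<in> X \<and> b \<in> Y \<and> (\<forall>x\<in>X. \<forall>y\<in>Y. F a y \<le> F x b)"
  unfolding saddle_point_def by (auto intro: order_trans)

lemma continuous_on_curried_compose:
  assumes "continuous_on (X \<times> Y) (\<lambda>(x, y). F x y)" "continuous_on S a" "continuous_on S b"
    and "\<And>v. v \<in> S \<Longrightarrow> a v \<in> X" "\<And>v. v \<in> S \<Longrightarrow> b v \<in> Y"
  shows "continuous_on S (\<lambda>v. F (a v) (b v))"
  using continuous_on_compose2[OF assms(1), of S "\<lambda>v. (a v, b v)"] assms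
  by (auto intro: continuous_on_Pair)

text \<open>Continuity is joint, as the continuity of the best response in
  \<open>strong_saddle_exists\<close> requires.\<close>

definition strong_saddle where
  "strong_saddle X Y \<mu> \<nu> F \<longleftrightarrow>
     compact X \<and> convex X \<and> X \<noteq> {} \<and> compact Y \<and> convex Y \<and> Y \<noteq> {} \<and> \<mu> > 0 \<and> \<nu> > 0 \<and>
     continuous_on (X \<times> Y) (\<lambda>(x, y). F x y) \<and>
     (\<forall>y\<in>Y. strongly_convex_on X \<mu> (\<lambda>x. F x y)) \<and>
     (\<forall>x\<in>X. strongly_convex_on Y \<nu> (\<lambda>y. - F x y))"

lemma strong_saddle_growth:
  fixes F :: "'x::real_normed_vector \<Rightarrow> 'y::real_normed_vector \<Rightarrow> real"
  assumes "strong_saddle X Y \<mu> \<nu> F" "saddle_point X Y F (a, b)" "x \<in> X" "y \<in> Y"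
  shows "F a b + \<mu> / 2 * (norm (x - a))\<^sup>2 \<le> F x b"
    and "F a y + \<nu> / 2 * (norm (y - b))\<^sup>2 \<le> F a b"
proof -
  show "F a b + \<mu> / 2 * (norm (x - a))\<^sup>2 \<le> F x b"
    using assms by (intro strongly_convex_on_growth[of X \<mu> "\<lambda>x. F x b"])
      (auto simp: strong_saddle_def saddle_point_def)
  have "- F a b + \<nu> / 2 * (norm (y - b))\<^sup>2 \<le> - F a y"
    using assms by (intro strongly_convex_on_growth[of Y \<nu> "\<lambda>y. - F a y"])
      (auto simp: strong_saddle_def saddle_point_def)
  then show "F a y + \<nu> / 2 * (norm (y - b))\<^sup>2 \<le> F a b" by simp
qed

text \<open>Adding the two growth inequalities cancels the saddle value, so that a difference of
  crossed values controls both distances at once.\<close>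

lemma strong_saddle_growth_gap:
  fixes F :: "'x::real_normed_vector \<Rightarrow> 'y::real_normed_vector \<Rightarrow> real"
  assumes "strong_saddle X Y \<mu> \<nu> F" "saddle_point X Y F z" "x \<in> X" "y \<in> Y"
  shows "\<mu> / 2 * (norm (x - fst z))\<^sup>2 + \<nu> / 2 * (norm (y - snd z))\<^sup>2 \<le> F x (snd z) - F (fst z) y"
  using strong_saddle_growth[of X Y \<mu> \<nu> F "fst z" "snd z" x y] assms by simp

lemma strong_saddle_unique:
  fixes F :: "'x::real_normed_vector \<Rightarrow> 'y::real_normed_vector \<Rightarrow> real"
  assumes "strong_saddle X Y \<mu> \<nu> F" "saddle_point X Y F z" "saddle_point X Y F w"
  shows "z = w"
proof -
  obtain a b a' b' where z: "z = (a, b)" and w: "w = (a', b')" by (cases z, cases w) 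
  from assms(2,3) have in': "a' \<in> X" "b' \<in> Y" "a \<in> X" "b \<in> Y" and le: "F a' b \<le> F a b'"
    by (auto simp: z w saddle_point_iff)
  have pos: "\<mu> > 0" "\<nu> > 0" using assms(1) by (auto simp: strong_saddle_def)
  have *: "\<mu> / 2 * (norm (a' - a))\<^sup>2 + \<nu> / 2 * (norm (b' - b))\<^sup>2 \<le> 0"
    using strong_saddle_growth_gap[OF assms(1,2) in'(1,2)] le by (simp add: z)
  have "0 \<le> \<mu> / 2 * (norm (a' - a))\<^sup>2" "0 \<le> \<nu> / 2 * (norm (b' - b))\<^sup>2"
    using pos by auto
  with * have "\<mu> / 2 * (norm (a' - a))\<^sup>2 = 0" "\<nu> / 2 * (norm (b' - b))\<^sup>2 = 0" by linarith+
  then show ?thesis using pos by (simp add: z w)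
qed

text \<open>A saddle point is a fixed point of the best response map, which is continuous because best
  responses are unique; Brouwer's theorem provides one.\<close>

lemma strong_saddle_exists:
  fixes F :: "'x::euclidean_space \<Rightarrow> 'y::euclidean_space \<Rightarrow> real"
  assumes "strong_saddle X Y \<mu> \<nu> F"
  shows "\<exists>z. saddle_point X Y F z"
proof -
  note S = assms[unfolded strong_saddle_def]
  let ?S = "X \<times> Y"
  have cont: "continuous_on ?S (\<lambda>(x, y). F x y)" using S by auto
  \<comment> \<open>The Nikaido-Isoda function: \<open>G z w\<close> splits into a term in
    \<open>fst w\<close> and one in \<open>snd w\<close>, and its minimizer over \<open>w\<close> is
    the pair of best responses to \<open>z\<close>.\<close>
  define G where "G z w = F (fst w) (snd z) - F (fst z) (snd w)" for z w
  have contG: "continuous_on S (\<lambda>v. G (u v) (w v))"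
    if "continuous_on S u" "continuous_on S w" "\<And>v. v \<in> S \<Longrightarrow> u v \<in> ?S" "\<And>v. v \<in> S \<Longrightarrow> w v \<in> ?S"
    for S :: "'z::topological_space set" and u w
    unfolding G_def
    by (intro continuous_on_diff continuous_on_curried_compose[OF cont] continuous_on_fst
        continuous_on_snd that(1,2)) (use that(3,4) in \<open>auto simp: mem_Times_iff\<close>)
  have compS: "compact ?S" "convex ?S" "?S \<noteq> {}" using S by (auto intro: compact_Times convex_Times)
  have ex: "\<exists>w\<in>?S. \<forall>w'\<in>?S. G z w \<le> G z w'" if "z \<in> ?S" for z
    by (rule continuous_attains_inf[OF compS(1,3)])
      (intro contG continuous_on_const continuous_on_id; use that in simp)
  have uniq: "w = w'" if z: "z \<in> ?S" and w: "w \<in> ?S" "w' \<in> ?S"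
    and m: "\<And>v. v \<in> ?S \<Longrightarrow> G z w \<le> G z v" "\<And>v. v \<in> ?S \<Longrightarrow> G z w' \<le> G z v" for z w w'
  proof -
    obtain x y where z': "z = (x, y)" "x \<in> X" "y \<in> Y" using z by auto
    obtain a b where w': "w = (a, b)" "a \<in> X" "b \<in> Y" using w by auto
    obtain a' b' where w'': "w' = (a', b')" "a' \<in> X" "b' \<in> Y" using w by auto
    have "a = a'"
      by (rule strongly_convex_on_minimizer_unique[of X \<mu> "\<lambda>x. F x y"])
        (use S z' w' w'' m(1)[of "(_, b)"] m(2)[of "(_, b')"] in \<open>auto simp: G_def\<close>)
    moreover have "b = b'"
      by (rule strongly_convex_on_minimizer_unique[of Y \<nu> "\<lambda>y. - F x y"])
        (use S z' w' w'' m(1)[of "(a, _)"] m(2)[of "(a', _)"] in \<open>auto simp: G_def\<close>)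
    ultimately show ?thesis by (simp add: w' w'')
  qed
  from ex obtain r where r: "\<And>z. z \<in> ?S \<Longrightarrow> r z \<in> ?S"
    and rmin: "\<And>z w'. z \<in> ?S \<Longrightarrow> w' \<in> ?S \<Longrightarrow> G z (r z) \<le> G z w'" by metis
  \<comment> \<open>By uniqueness the graph is described by inequalities between continuous
    functions. This makes it closed, and a map into a compact set with closed graph is
    continuous.\<close>
  have graph: "(\<lambda>z. Pair z (r z)) ` ?S = {v \<in> ?S \<times> ?S. \<forall>w'\<in>?S. G (fst v) (snd v) \<le> G (fst v) w'}" (is "?L = ?R")
  proof
    show "?L \<subseteq> ?R" 
    proof
      fix v assume "v \<in> ?L"
      then obtain z where "z \<in> ?S" "v = (z, r z)" by (elim imageE)
      then show "v \<in> ?R" using r[of z] rmin[of z] by simp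
    qed
    show "?R \<subseteq> ?L"
    proof
      fix v assume "v \<in> ?R"
      then have v: "fst v \<in> ?S" "snd v \<in> ?S" "\<And>w'. w' \<in> ?S \<Longrightarrow> G (fst v) (snd v) \<le> G (fst v) w'" by auto
      have "snd v = r (fst v)" by (rule uniq[OF v(1,2) r[OF v(1)] v(3) rmin[OF v(1)]])
      then have "v = (fst v, r (fst v))" by (simp add: prod_eq_iff)
      then show "v \<in> ?L" using v(1) by (rule image_eqI)
    qed
  qed
  have "continuous_on ?S r"
  proof (rule continuous_from_closed_graph[OF compS(1)])
    show "r \<in> ?S \<rightarrow> ?S" using r by auto
    have "closed (?S \<times> ?S)" using compS(1) by (intro closed_Times compact_imp_closed)
    have "closed {v \<in> ?S \<times> ?S. G (fst v) (snd v) \<le> G (fst v) w'}" if "w' \<in> ?S" for w'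
    proof (rule continuous_on_closed_Collect_le[OF _ _ \<open>closed (?S \<times> ?S)\<close>])
      show "continuous_on (?S \<times> ?S) (\<lambda>v. G (fst v) (snd v))"
        by (rule contG) (auto intro: continuous_on_fst continuous_on_snd continuous_on_id)
      show "continuous_on (?S \<times> ?S) (\<lambda>v. G (fst v) w')"
        by (rule contG) (use that in \<open>auto intro: continuous_on_fst continuous_on_id\<close>)
    qed
    then have "closed (\<Inter>w'\<in>?S. {v \<in> ?S \<times> ?S. G (fst v) (snd v) \<le> G (fst v) w'})" by (intro closed_INT ballI)
    moreover have "(\<Inter>w'\<in>?S. {v \<in> ?S \<times> ?S. G (fst v) (snd v) \<le> G (fst v) w'}) = ?R"
      using compS(3) by auto
    ultimately have "closed ?R" by simp
    then show "closed ((\<lambda>x. (x, r x)) ` ?S)"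
      unfolding graph .
  qed
  then obtain z where z: "z \<in> ?S" "r z = z"
    using brouwer[OF compS, of r] r by auto
  \<comment> \<open>At a fixed point the minimum of \<open>G z\<close> is \<open>G z z = 0\<close>,
    and its minimality is the cross inequality of a saddle point.\<close>
  have "0 \<le> G z (x, y)" if "x \<in> X" "y \<in> Y" for x y
    using rmin[OF z(1), of "(x, y)"] that unfolding z(2) by (simp add: G_def)
  then have "saddle_point X Y F (fst z, snd z)"
    using z(1) unfolding saddle_point_iff by (auto simp: G_def)
  then show ?thesis by blast
qed

lemma strong_saddle_the:
  fixes F :: "'x::euclidean_space \<Rightarrow> 'y::euclidean_space \<Rightarrow> real"
  assumes "strong_saddle X Y \<mu> \<nu> F"
  shows "saddle_point X Y F (THE z. saddle_point X Y F z)"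
  using strong_saddle_exists[OF assms] strong_saddle_unique[OF assms] by (metis theI)

section \<open>Robust extraction\<close>

text \<open>\<open>LEAST\<close> over the reals needs an attained minimum. The number of points
  within radius \<open>r\<close> changes only at the finitely many distances from
  \<open>z j\<close>, so below every admissible radius there is an admissible one in the finite set
  \<open>V\<close>.\<close>

lemma extract_radius:
  fixes \<rho> :: "'a \<Rightarrow> 'a \<Rightarrow> real"
  assumes r: "0 \<le> r" "real (card {k. k < m \<and> \<rho> (z j) (z k) \<le> r}) > real m / 2"
  shows "extract_radius m \<rho> z j \<le> r"
    and "real (card {k. k < m \<and> \<rho> (z j) (z k) \<le> extract_radius m \<rho> z j}) > real m / 2"
proof -
  define A where "A r \<longleftrightarrow> 0 \<le> r \<and> real (card {k. k < m \<and> \<rho> (z j) (z k) \<le> r}) > real m / 2" for r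
  define V where "V = insert 0 ((\<lambda>k. \<rho> (z j) (z k)) ` {..<m})"
  have fin: "finite V" by (simp add: V_def)
  have ex: "\<exists>v\<in>V. A v \<and> v \<le> r" if "A r" for r
  proof -
    define v where "v = Max {v \<in> V. v \<le> r}"
    have ne: "0 \<in> {v \<in> V. v \<le> r}" using that by (auto simp: V_def A_def)
    have fin': "finite {v \<in> V. v \<le> r}" using fin by simp
    have "v \<in> {v \<in> V. v \<le> r}" unfolding v_def using ne fin' by (intro Max_in) auto
    moreover have "0 \<le> v" unfolding v_def using ne fin' by (intro Max_ge) auto
    moreover have "{k. k < m \<and> \<rho> (z j) (z k) \<le> r} = {k. k < m \<and> \<rho> (z j) (z k) \<le> v}"
    proof -
      have "\<rho> (z j) (z k) \<le> v" if "k < m" "\<rho> (z j) (z k) \<le> r" for k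
        unfolding v_def using that fin' by (intro Max_ge) (auto simp: V_def)
      then show ?thesis using \<open>v \<in> {v \<in> V. v \<le> r}\<close> by auto
    qed
    ultimately show ?thesis using that by (auto simp: A_def)
  qed
  define v where "v = Min {v \<in> V. A v}"
  have "A r" using r by (simp add: A_def)
  have fin': "finite {v \<in> V. A v}" using fin by simp
  have v: "v \<in> {v \<in> V. A v}" unfolding v_def using fin' ex[OF \<open>A r\<close>] by (intro Min_in) auto
  have least: "v \<le> u" if "A u" for u
  proof -
    from ex[OF that] obtain w where "w \<in> V" "A w" "w \<le> u" by blast
    moreover from this have "v \<le> w" unfolding v_def using fin' by (intro Min_le) auto
    ultimately show ?thesis by simp
  qed
  have "extract_radius m \<rho> z j = (LEAST r. A r)" by (simp add: extract_radius_def A_def)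
  also have "\<dots> = v" using v least by (intro Least_equality) auto
  finally have eq: "extract_radius m \<rho> z j = v" .
  show "extract_radius m \<rho> z j \<le> r" using least[OF \<open>A r\<close>] eq by simp
  show "real (card {k. k < m \<and> \<rho> (z j) (z k) \<le> extract_radius m \<rho> z j}) > real m / 2"
    using v unfolding eq by (simp add: A_def)
qed

text \<open>The entries at most \<open>B\<close> form an initial segment of the sorted list, and
  sorting keeps their number.\<close>

lemma sort_nth_le:
  fixes xs :: "'a::linorder list"
  assumes "k < card {i. i < length xs \<and> xs ! i \<le> B}"
  shows "sort xs ! k \<le> B"
proof (rule ccontr)
  assume *: "\<not> sort xs ! k \<le> B"
  have "{i. i < length (sort xs) \<and> sort xs ! i \<le> B} \<subseteq> {..<k}"
  proof (intro subsetI, rule ccontr)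
    fix i assume i: "i \<in> {i. i < length (sort xs) \<and> sort xs ! i \<le> B}" "i \<notin> {..<k}"
    then have "sort xs ! k \<le> sort xs ! i" by (intro sorted_nth_mono) auto
    with i * show False by auto
  qed
  then have "card {i. i < length (sort xs) \<and> sort xs ! i \<le> B} \<le> k"
    using card_mono[of "{..<k}"] by fastforce
  moreover have "length (filter (\<lambda>x. x \<le> B) (sort xs)) = length (filter (\<lambda>x. x \<le> B) xs)"
    by (metis mset_filter mset_sort size_mset)
  ultimately show False using assms by (simp add: length_filter_conv_card)
qed

text \<open>The radius of a good point is at most \<open>2 r\<close>, hence so is that of every extracted point; the
  majority ball around the latter contains a good point.\<close>

lemma extract_set_near:
  fixes \<rho> :: "'a \<Rightarrow> 'a \<Rightarrow> real"
  assumes tri: "\<And>a b c. \<rho> a c \<le> \<rho> a b + \<rho> b c" and sym: "\<And>a b. \<rho> a b = \<rho> b a"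
    and r: "0 \<le> r" and maj: "real (card {j. j < m \<and> \<rho> (z j) w \<le> r}) > real m / 2"
    and k: "k \<in> extract_set m \<rho> z"
  shows "k < m" "\<rho> (z k) w \<le> 3 * r"
proof -
  let ?G = "{j. j < m \<and> \<rho> (z j) w \<le> r}" and ?R = "extract_radius m \<rho> z"
  have good: "?R j \<le> 2 * r" if "j \<in> ?G" for j
  proof (rule extract_radius(1))
    have "\<rho> (z j) (z i) \<le> 2 * r" if "i \<in> ?G" for i
      using tri[of "z j" "z i" w] sym[of w "z i"] that \<open>j \<in> ?G\<close> by simp
    then have "card ?G \<le> card {i. i < m \<and> \<rho> (z j) (z i) \<le> 2 * r}"
      by (intro card_mono) auto
    with maj show "real m / 2 < real (card {i. i < m \<and> \<rho> (z j) (z i) \<le> 2 * r})" by linarith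
  qed (use r in simp)
  have k': "k < m" "?R k \<le> sort (map ?R [0..<m]) ! (nat \<lceil>real m / 2\<rceil> - 1)"
    using k by (auto simp: extract_set_def Let_def)
  then show "k < m" by simp
  \<comment> \<open>Rank \<lceil>m / 2\<rceil> is the list index one less, and the strict majority
    of good points reaches this rank.\<close>
  have "nat \<lceil>real m / 2\<rceil> - 1 < card ?G"
  proof -
    have "\<lceil>real m / 2\<rceil> \<le> int (card ?G)" using maj by (simp add: ceiling_le_iff)
    moreover have "\<lceil>real m / 2\<rceil> > 0" using k' by simp
    ultimately show ?thesis by linarith
  qed
  also have "card ?G \<le> card {i. i < m \<and> ?R i \<le> 2 * r}" using good by (intro card_mono) auto
  also have "{i. i < m \<and> ?R i \<le> 2 * r} = {i. i < length (map ?R [0..<m]) \<and> map ?R [0..<m] ! i \<le> 2 * r}"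
    by auto
  finally have "sort (map ?R [0..<m]) ! (nat \<lceil>real m / 2\<rceil> - 1) \<le> 2 * r" by (rule sort_nth_le)
  with k' have Rk: "?R k \<le> 2 * r" by simp
  \<comment> \<open>A radius above all distances from \<open>z k\<close> is admissible, so the least
    one exists and its ball holds a majority even if \<open>z k\<close> itself is bad.\<close>
  have "real (card {i. i < m \<and> \<rho> (z k) (z i) \<le> ?R k}) > real m / 2"
  proof (rule extract_radius(2))
    let ?M = "Max ((\<lambda>i. \<rho> (z k) (z i)) ` {..<m})"
    have "\<rho> (z k) (z i) \<le> max 0 ?M" if "i < m" for i
      using that by (intro max.coboundedI2 Max_ge) auto
    then have "{i. i < m \<and> \<rho> (z k) (z i) \<le> max 0 ?M} = {..<m}" by auto
    then show "real m / 2 < real (card {i. i < m \<and> \<rho> (z k) (z i) \<le> max 0 ?M})"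
      using k' by simp
  qed simp
  \<comment> \<open>Two strict majorities among \<open>m\<close> indices cannot be disjoint.\<close>
  moreover have "{i. i < m \<and> \<rho> (z k) (z i) \<le> ?R k} \<inter> ?G \<noteq> {}" if "real (card {i. i < m \<and> \<rho> (z k) (z i) \<le> ?R k}) > real m / 2"
  proof
    assume "{i. i < m \<and> \<rho> (z k) (z i) \<le> ?R k} \<inter> ?G = {}"
    then have "card ({i. i < m \<and> \<rho> (z k) (z i) \<le> ?R k} \<union> ?G) =
      card {i. i < m \<and> \<rho> (z k) (z i) \<le> ?R k} + card ?G"
      by (intro card_Un_disjoint) auto
    moreover have "card ({i. i < m \<and> \<rho> (z k) (z i) \<le> ?R k} \<union> ?G) \<le> card {..<m}"
      by (intro card_mono) auto
    ultimately show False using maj that by simp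
  qed
  ultimately have "{i. i < m \<and> \<rho> (z k) (z i) \<le> ?R k} \<inter> ?G \<noteq> {}" by blast
  then obtain i where "\<rho> (z k) (z i) \<le> ?R k" "\<rho> (z i) w \<le> r" by auto
  with Rk tri[of "z k" w "z i"] show "\<rho> (z k) w \<le> 3 * r" by linarith
qed

section \<open>First-order bounds\<close>

text \<open>Gradients are taken within \<open>S\<close>, which need not be open, so the chain rule
  is applied within the image of the unit interval.\<close>

lemma has_derivative_along_segment:
  fixes h :: "'a::real_inner \<Rightarrow> real"
  assumes "convex S" "a \<in> S" "x \<in> S" "t \<in> {0..1}"
    and "(h has_derivative (\<lambda>d. g \<bullet> d)) (at (a + t *\<^sub>R (x - a)) within S)"
  shows "((\<lambda>t. h (a + t *\<^sub>R (x - a))) has_real_derivative g \<bullet> (x - a)) (at t within {0..1})"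
proof -
  have "(\<lambda>t. a + t *\<^sub>R (x - a)) ` {0..1} \<subseteq> S"
  proof
    fix u assume "u \<in> (\<lambda>t. a + t *\<^sub>R (x - a)) ` {0..1}"
    then obtain s where "s \<in> {0..1}" "u = (1 - s) *\<^sub>R a + s *\<^sub>R x" by (auto simp: algebra_simps)
    then show "u \<in> S" using assms by (simp add: convexD)
  qed
  then have "(h has_derivative (\<lambda>d. g \<bullet> d)) (at (a + t *\<^sub>R (x - a)) within (\<lambda>t. a + t *\<^sub>R (x - a)) ` {0..1})"
    using assms(5) by (rule has_derivative_subset[rotated])
  then have "((\<lambda>t. h (a + t *\<^sub>R (x - a))) has_derivative (\<lambda>s. g \<bullet> (s *\<^sub>R (x - a)))) (at t within {0..1})"
    by (rule has_derivative_in_compose[rotated]) (auto intro!: derivative_eq_intros)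
  then show ?thesis
    by (simp add: has_field_derivative_def mult.commute[of _ "g \<bullet> (x - a)"])
qed

text \<open>Subtracting the linear and the quadratic model along the segment leaves a function whose
  derivative is nonpositive by Cauchy-Schwarz.\<close>

lemma gradient_descent_bound:
  fixes h :: "'a::real_inner \<Rightarrow> real"
  assumes S: "convex S" "a \<in> S" "x \<in> S"
    and deriv: "\<And>u. u \<in> S \<Longrightarrow> (h has_derivative (\<lambda>d. g u \<bullet> d)) (at u within S)"
    and lip: "\<And>u. u \<in> S \<Longrightarrow> norm (g u - g a) \<le> L * norm (u - a)"
  shows "h x \<le> h a + g a \<bullet> (x - a) + L / 2 * (norm (x - a))\<^sup>2"
proof -
  define d where "d = x - a"
  define \<phi> where "\<phi> t = h (a + t *\<^sub>R d) - t * (g a \<bullet> d) - L / 2 * t\<^sup>2 * (norm d)\<^sup>2" for t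
  have in_S: "a + t *\<^sub>R d \<in> S" if "0 \<le> t" "t \<le> 1" for t
  proof -
    have "a + t *\<^sub>R d = (1 - t) *\<^sub>R a + t *\<^sub>R x" by (simp add: d_def algebra_simps)
    then show ?thesis using S that by (simp add: convexD)
  qed
  have D: "(\<phi> has_real_derivative (g (a + t *\<^sub>R d) - g a) \<bullet> d - L * t * (norm d)\<^sup>2) (at t within {0..1})"
    if "0 \<le> t" "t \<le> 1" for t
  proof -
    have 1: "((\<lambda>t. h (a + t *\<^sub>R d)) has_real_derivative g (a + t *\<^sub>R d) \<bullet> d) (at t within {0..1})"
      using that in_S[of t] deriv has_derivative_along_segment[of S a x t h] S by (simp add: d_def)
    have 2: "((\<lambda>t. t * (g a \<bullet> d)) has_real_derivative g a \<bullet> d) (at t within {0..1})"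
      by (auto intro!: derivative_eq_intros)
    have 3: "((\<lambda>t. L / 2 * t\<^sup>2 * (norm d)\<^sup>2) has_real_derivative L * t * (norm d)\<^sup>2) (at t within {0..1})"
      by (auto intro!: derivative_eq_intros)
    show ?thesis unfolding \<phi>_def inner_diff_left by (intro DERIV_diff 1 2 3)
  qed
  have "\<phi> 0 \<ge> \<phi> 1"
  proof (rule DERIV_nonpos_imp_decreasing_open[of 0 1 \<phi>])
    show "continuous_on {0..1::real} \<phi>"
      using D by (auto simp: continuous_on_eq_continuous_within intro!: DERIV_continuous)
    fix t :: real assume t: "0 < t" "t < 1"
    have "(g (a + t *\<^sub>R d) - g a) \<bullet> d \<le> norm (g (a + t *\<^sub>R d) - g a) * norm d"
      by (rule norm_cauchy_schwarz)
    also have "\<dots> \<le> (L * norm (t *\<^sub>R d)) * norm d"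
      using lip[OF in_S, of t] t by (intro mult_right_mono) auto
    finally have "(g (a + t *\<^sub>R d) - g a) \<bullet> d - L * t * (norm d)\<^sup>2 \<le> 0"
      using t by (simp add: power2_eq_square mult_ac)
    moreover have "at t within {0..1} = at t" using t by (intro at_within_interior) simp
    ultimately show "\<exists>y. (\<phi> has_real_derivative y) (at t) \<and> y \<le> 0"
      using D[of t] t by auto
  qed simp
  then show ?thesis by (simp add: \<phi>_def d_def)
qed

lemma difference_quotient_tendsto:
  fixes h :: "'a::real_inner \<Rightarrow> real"
  assumes "convex S" "a \<in> S" "x \<in> S" "(h has_derivative (\<lambda>d. g \<bullet> d)) (at a within S)"
  shows "((\<lambda>t. (h ((1 - t) *\<^sub>R a + t *\<^sub>R x) - h a) / t) \<longlongrightarrow> g \<bullet> (x - a)) (at_right 0)"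
proof -
  have eq: "a + t *\<^sub>R (x - a) = (1 - t) *\<^sub>R a + t *\<^sub>R x" for t by (simp add: algebra_simps)
  have "((\<lambda>t. h (a + t *\<^sub>R (x - a))) has_real_derivative g \<bullet> (x - a)) (at 0 within {0..1})"
    by (rule has_derivative_along_segment) (use assms in auto)
  then show ?thesis
    unfolding eq by (simp add: has_field_derivative_iff at_within_Icc_at_right)
qed

lemma convex_on_gradient_le:
  fixes h :: "'a::real_inner \<Rightarrow> real"
  assumes h: "convex_on S h" and S: "a \<in> S" "x \<in> S" and deriv: "(h has_derivative (\<lambda>d. g \<bullet> d)) (at a within S)"
  shows "g \<bullet> (x - a) \<le> h x - h a"
proof (rule tendsto_upperbound[OF difference_quotient_tendsto[OF convex_on_imp_convex[OF h] S deriv]])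
  have "(h ((1 - t) *\<^sub>R a + t *\<^sub>R x) - h a) / t \<le> h x - h a" if "0 < t" "t \<le> 1" for t
    using convex_onD[OF h, of t a x] S that by (simp add: divide_simps algebra_simps)
  then show "\<forall>\<^sub>F t in at_right 0. (h ((1 - t) *\<^sub>R a + t *\<^sub>R x) - h a) / t \<le> h x - h a"
    by (auto simp: eventually_at_right[OF zero_less_one] intro!: exI[of _ 1])
qed simp

lemma minimizer_gradient_nonneg:
  fixes h :: "'a::real_inner \<Rightarrow> real"
  assumes S: "convex S" "a \<in> S" "x \<in> S" and deriv: "(h has_derivative (\<lambda>d. g \<bullet> d)) (at a within S)"
    and min: "\<And>u. u \<in> S \<Longrightarrow> h a \<le> h u"
  shows "0 \<le> g \<bullet> (x - a)"
proof (rule tendsto_lowerbound[OF difference_quotient_tendsto[OF S deriv]])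
  have "0 \<le> (h ((1 - t) *\<^sub>R a + t *\<^sub>R x) - h a) / t" if "0 < t" "t \<le> 1" for t
    using min[of "(1 - t) *\<^sub>R a + t *\<^sub>R x"] S that by (simp add: convexD)
  then show "\<forall>\<^sub>F t in at_right 0. 0 \<le> (h ((1 - t) *\<^sub>R a + t *\<^sub>R x) - h a) / t"
    by (auto simp: eventually_at_right[OF zero_less_one] intro!: exI[of _ 1])
qed simp

lemma strongly_convex_on_imp_convex_on:
  assumes "strongly_convex_on S \<mu> g" "convex S" "\<mu> \<ge> 0"
  shows "convex_on S g"
proof (rule convex_onI)
  fix t :: real and x y assume "0 < t" "t < 1" "x \<in> S" "y \<in> S"
  moreover from this have "0 \<le> \<mu> / 2 * (t * (1 - t)) * (norm (x - y))\<^sup>2" using assms(3) by simp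
  ultimately show "g ((1 - t) *\<^sub>R x + t *\<^sub>R y) \<le> (1 - t) * g x + t * g y"
    using strongly_convex_onD[OF assms(1), of x y t] by simp
qed fact

lemma sqrt_bound_of_quadratic:
  assumes "\<mu> / 2 * r\<^sup>2 \<le> \<eta>" "\<mu> > 0"
  shows "r \<le> sqrt (2 * \<eta> / \<mu>)"
  using assms by (intro real_le_rsqrt) (simp add: field_simps)

lemma candidate_near:
  fixes a :: "'x::real_normed_vector" and b :: "'y::real_normed_vector"
  assumes H: "strong_saddle X Y \<mu> \<nu> H" and sp: "saddle_point X Y H (a, b)" and z: "z \<in> X \<times> Y"
    and gap: "H (fst z) b - H a (snd z) \<le> \<eta>"
  shows "norm (fst z - a) \<le> sqrt (2 * \<eta> / \<mu>)" "norm (snd z - b) \<le> sqrt (2 * \<eta> / \<nu>)"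
proof -
  have pos: "\<mu> > 0" "\<nu> > 0" using H by (auto simp: strong_saddle_def)
  have "\<mu> / 2 * (norm (fst z - a))\<^sup>2 + \<nu> / 2 * (norm (snd z - b))\<^sup>2 \<le> \<eta>"
    using strong_saddle_growth_gap[OF H sp, of "fst z" "snd z"] z gap by (auto simp: mem_Times_iff)
  moreover have "0 \<le> \<mu> / 2 * (norm (fst z - a))\<^sup>2" "0 \<le> \<nu> / 2 * (norm (snd z - b))\<^sup>2"
    using pos by auto
  ultimately have "\<mu> / 2 * (norm (fst z - a))\<^sup>2 \<le> \<eta>" "\<nu> / 2 * (norm (snd z - b))\<^sup>2 \<le> \<eta>"
    by linarith+
  then show "norm (fst z - a) \<le> sqrt (2 * \<eta> / \<mu>)" "norm (snd z - b) \<le> sqrt (2 * \<eta> / \<nu>)"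
    using pos by (blast intro: sqrt_bound_of_quadratic)+
qed

text \<open>A small gap places both components near the saddle point, so one majority of good
  candidates is a majority for both extractions, although these may select different indices. The
  factor 3 is the loss of \<open>extract_set_near\<close>.\<close>

lemma extracted_candidates_near:
  fixes a :: "'x::euclidean_space" and b :: "'y::euclidean_space"
  assumes H: "strong_saddle X Y \<mu> \<nu> H" and sp: "saddle_point X Y H (a, b)"
    and z: "\<And>j. z j \<in> X \<times> Y" and "\<eta> > 0"
    and maj: "real (card {j. j < m \<and> H (fst (z j)) b - H a (snd (z j)) \<le> \<eta>}) > real m / 2"
  shows "k \<in> extract_set m dist (\<lambda>j. fst (z j)) \<Longrightarrow> norm (fst (z k) - a) \<le> 3 * sqrt (2 * \<eta> / \<mu>)"
    and "k \<in> extract_set m dist (\<lambda>j. snd (z j)) \<Longrightarrow> norm (snd (z k) - b) \<le> 3 * sqrt (2 * \<eta> / \<nu>)"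
proof -
  have pos: "\<mu> > 0" "\<nu> > 0" using H by (auto simp: strong_saddle_def)
  note near = candidate_near[OF H sp z]
  have maj': "real m / 2 < real (card {j. j < m \<and> P j})"
    if "\<And>j. H (fst (z j)) b - H a (snd (z j)) \<le> \<eta> \<Longrightarrow> P j" for P
  proof -
    have "card {j. j < m \<and> H (fst (z j)) b - H a (snd (z j)) \<le> \<eta>} \<le> card {j. j < m \<and> P j}"
      using that by (intro card_mono) auto
    then show ?thesis using maj by linarith
  qed
  show "norm (fst (z k) - a) \<le> 3 * sqrt (2 * \<eta> / \<mu>)" if "k \<in> extract_set m dist (\<lambda>j. fst (z j))"
    using extract_set_near(2)[of dist "sqrt (2 * \<eta> / \<mu>)" m "\<lambda>j. fst (z j)" a k, OF dist_triangle dist_commute _ _ that]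
      maj'[of "\<lambda>j. dist (fst (z j)) a \<le> sqrt (2 * \<eta> / \<mu>)"] near pos \<open>\<eta> > 0\<close> by (simp add: dist_norm)
  show "norm (snd (z k) - b) \<le> 3 * sqrt (2 * \<eta> / \<nu>)" if "k \<in> extract_set m dist (\<lambda>j. snd (z j))"
    using extract_set_near(2)[of dist "sqrt (2 * \<eta> / \<nu>)" m "\<lambda>j. snd (z j)" b k, OF dist_triangle dist_commute _ _ that]
      maj'[of "\<lambda>j. dist (snd (z j)) b \<le> sqrt (2 * \<eta> / \<nu>)"] near pos \<open>\<eta> > 0\<close> by (simp add: dist_norm)
qed

text \<open>Expand \<open>H\<close> in its first argument around \<open>a\<close> for fixed
  \<open>y\<close> and split the linear term at \<open>g a b\<close>. The part with
  \<open>g a b\<close> is small on good candidates by convexity and optimality, and the pseudometric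
  passes this on to \<open>k3\<close>; nearness to \<open>a\<close> alone would bound it only by a
  multiple of sqrt \<eta>. The other part, of order \<open>M * norm (y - b)\<close>, is absorbed by
  strong concavity in \<open>y\<close>.\<close>

lemma function_gap_bound:
  fixes H :: "'x::euclidean_space \<Rightarrow> 'y::euclidean_space \<Rightarrow> real"
  assumes H: "strong_saddle X Y \<mu> \<nu> H" and sp: "saddle_point X Y H (a, b)"
    and deriv: "\<And>x y. x \<in> X \<Longrightarrow> y \<in> Y \<Longrightarrow> ((\<lambda>u. H u y) has_derivative (\<lambda>d. g x y \<bullet> d)) (at x within X)"
    and smx: "\<And>x1 x2 y. x1 \<in> X \<Longrightarrow> x2 \<in> X \<Longrightarrow> y \<in> Y \<Longrightarrow> norm (g x1 y - g x2 y) \<le> L * norm (x1 - x2)"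
    and smy: "\<And>x y1 y2. x \<in> X \<Longrightarrow> y1 \<in> Y \<Longrightarrow> y2 \<in> Y \<Longrightarrow> norm (g x y1 - g x y2) \<le> M * norm (y1 - y2)"
    and "L \<ge> 0" "M \<ge> 0" "\<eta> > 0"
    and z: "\<And>j. z j \<in> X \<times> Y"
    and maj: "real (card {j. j < m \<and> H (fst (z j)) b - H a (snd (z j)) \<le> \<eta>}) > real m / 2"
    and k1: "k1 \<in> extract_set m dist (\<lambda>j. fst (z j))"
    and k2: "k2 \<in> extract_set m dist (\<lambda>j. snd (z j))"
    and v: "norm (v - g (fst (z k1)) (snd (z k2))) \<le> 3 * (L * sqrt (\<eta> / \<mu>))"
    and k3: "k3 \<in> extract_set m dist (\<lambda>j. fst (z j))"
      "k3 \<in> extract_set m (\<lambda>s t. \<bar>v \<bullet> (s - t)\<bar>) (\<lambda>j. fst (z j))"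
    and y: "y \<in> Y"
  shows "H (fst (z k3)) y \<le> H a b + \<eta> * (3 + (18 * sqrt 2 + 45) * (L / \<mu>)
    + 36 * M / sqrt (\<mu> * \<nu>) + 9 * M\<^sup>2 / (\<mu> * \<nu>))"
proof -
  have pos: "\<mu> > 0" "\<nu> > 0" and cX: "convex X" using H by (auto simp: strong_saddle_def)
  have ab: "a \<in> X" "b \<in> Y" using sp by (auto simp: saddle_point_iff)
  have zX: "fst (z j) \<in> X" "snd (z j) \<in> Y" for j using z[of j] by auto
  define A where "A = sqrt (2 * \<eta> / \<mu>)"
  define B where "B = sqrt (2 * \<eta> / \<nu>)"
  define E where "E = norm (v - g a b)"
  have nn: "A \<ge> 0" "B \<ge> 0" "E \<ge> 0" using pos \<open>\<eta> > 0\<close> by (auto simp: A_def B_def E_def)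
  note near = extracted_candidates_near[OF H sp z \<open>\<eta> > 0\<close> maj, folded A_def B_def]
  \<comment> \<open>The three errors of \<open>v\<close> as an estimate of \<open>g a b\<close>:
    sampling, and the displacement of the evaluation point in each argument.\<close>
  have E: "E \<le> 3 * (L * sqrt (\<eta> / \<mu>)) + L * (3 * A) + M * (3 * B)"
  proof -
    let ?x = "fst (z k1)" and ?y = "snd (z k2)"
    have "E = norm ((v - g ?x ?y) + (g ?x ?y - g a ?y) + (g a ?y - g a b))" by (simp add: E_def)
    also have "\<dots> \<le> norm (v - g ?x ?y) + norm (g ?x ?y - g a ?y) + norm (g a ?y - g a b)"
      by (intro norm_triangle_mono order_refl)
    also have "\<dots> \<le> 3 * (L * sqrt (\<eta> / \<mu>)) + L * (3 * A) + M * (3 * B)"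
      using smx[of ?x a ?y] smy[of a ?y b] zX ab near(1)[OF k1] near(2)[OF k2] v \<open>L \<ge> 0\<close> \<open>M \<ge> 0\<close>
      by (intro add_mono) (auto intro: order_trans mult_left_mono)
    finally show ?thesis .
  qed
  have inner_v: "\<bar>(v - g a b) \<bullet> w\<bar> \<le> E * norm w" for w
    unfolding E_def by (rule Cauchy_Schwarz_ineq2)
  \<comment> \<open>For a good candidate the inner product with \<open>g a b\<close> lies between 0,
    by optimality of \<open>a\<close>, and \<eta>, by convexity. Replacing \<open>g a b\<close> by
    \<open>v\<close> costs at most \<open>E * A\<close>.\<close>
  have good: "\<bar>v \<bullet> (fst (z j) - a)\<bar> \<le> \<eta> + E * A" if j: "H (fst (z j)) b - H a (snd (z j)) \<le> \<eta>" for j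
  proof -
    have "convex_on X (\<lambda>x. H x b)"
      using H ab by (intro strongly_convex_on_imp_convex_on[of X \<mu>]) (auto simp: strong_saddle_def)
    then have "g a b \<bullet> (fst (z j) - a) \<le> H (fst (z j)) b - H a b"
      using ab zX deriv by (intro convex_on_gradient_le)
    moreover have "H a (snd (z j)) \<le> H a b" using sp zX[of j] by (auto simp: saddle_point_def)
    moreover have "0 \<le> g a b \<bullet> (fst (z j) - a)"
      by (rule minimizer_gradient_nonneg[of X _ _ "\<lambda>x. H x b"])
        (use sp ab zX deriv cX in \<open>auto simp: saddle_point_def\<close>)
    moreover have "norm (fst (z j) - a) \<le> A" unfolding A_def by (rule candidate_near(1)[OF H sp z j])
    then have "E * norm (fst (z j) - a) \<le> E * A" using nn by (intro mult_left_mono)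
    ultimately show ?thesis
      using inner_v[of "fst (z j) - a"] j by (simp add: inner_diff_left)
  qed
  have "card {j. j < m \<and> H (fst (z j)) b - H a (snd (z j)) \<le> \<eta>} \<le>
    card {j. j < m \<and> \<bar>v \<bullet> (fst (z j) - a)\<bar> \<le> \<eta> + E * A}"
    using good by (intro card_mono) auto
  then have maj3: "real m / 2 < real (card {j. j < m \<and> \<bar>v \<bullet> (fst (z j) - a)\<bar> \<le> \<eta> + E * A})"
    using maj by linarith
  have v3: "\<bar>v \<bullet> (fst (z k3) - a)\<bar> \<le> 3 * (\<eta> + E * A)"
  proof (rule extract_set_near(2)[where \<rho> = "\<lambda>s t. \<bar>v \<bullet> (s - t)\<bar>" and z = "\<lambda>j. fst (z j)", OF _ _ _ maj3 k3(2)])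
    show "\<bar>v \<bullet> (s - u)\<bar> \<le> \<bar>v \<bullet> (s - t)\<bar> + \<bar>v \<bullet> (t - u)\<bar>" for s t u
      by (simp add: inner_diff_right)
    show "\<bar>v \<bullet> (s - t)\<bar> = \<bar>v \<bullet> (t - s)\<bar>" for s t by (simp add: inner_diff_right abs_minus_commute)
    show "0 \<le> \<eta> + E * A" using nn \<open>\<eta> > 0\<close> by simp
  qed
  define x where "x = fst (z k3)"
  have xX: "x \<in> X" using zX by (simp add: x_def)
  have xa: "norm (x - a) \<le> 3 * A" using near(1)[OF k3(1)] by (simp add: x_def)
  \<comment> \<open>Extraction triples \<open>\<eta> + E * A\<close>, and returning from
    \<open>v\<close> to \<open>g a b\<close> over a distance \<open>3 * A\<close> adds another
    \<open>3 * (E * A)\<close>.\<close>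
  have g3: "g a b \<bullet> (x - a) \<le> 3 * \<eta> + 6 * (E * A)"
    using inner_v[of "x - a"] v3 mult_left_mono[OF xa nn(3)]
    by (simp add: x_def[symmetric] inner_diff_left)
  have "H x y \<le> H a y + g a y \<bullet> (x - a) + L / 2 * (norm (x - a))\<^sup>2"
    by (rule gradient_descent_bound[of X]) (use cX ab xX y deriv smx in auto)
  moreover have "H a y + \<nu> / 2 * (norm (y - b))\<^sup>2 \<le> H a b"
    by (rule strong_saddle_growth(2)[OF H sp ab(1) y])
  moreover have "(g a y - g a b) \<bullet> (x - a) \<le> M * norm (y - b) * (3 * A)"
  proof -
    have "(g a y - g a b) \<bullet> (x - a) \<le> norm (g a y - g a b) * norm (x - a)" by (rule norm_cauchy_schwarz)
    also have "\<dots> \<le> M * norm (y - b) * (3 * A)"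
      using smy ab y xa nn \<open>M \<ge> 0\<close> by (intro mult_mono) auto
    finally show ?thesis .
  qed
  moreover have "M * norm (y - b) * (3 * A) - \<nu> / 2 * (norm (y - b))\<^sup>2 \<le> M\<^sup>2 / (2 * \<nu>) * (9 * A\<^sup>2)"
  proof -
    \<comment> \<open>Completing the square maximizes the concave quadratic in
      \<open>norm (y - b)\<close>.\<close>
    have "0 \<le> (\<nu> * norm (y - b) - M * (3 * A))\<^sup>2 / (2 * \<nu>)" using pos by simp
    also have "\<dots> = M\<^sup>2 / (2 * \<nu>) * (9 * A\<^sup>2) - (M * norm (y - b) * (3 * A) - \<nu> / 2 * (norm (y - b))\<^sup>2)"
      using pos by (simp add: power2_eq_square field_simps)
    finally show ?thesis by simp
  qed
  moreover have "L / 2 * (norm (x - a))\<^sup>2 \<le> L / 2 * (9 * A\<^sup>2)"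
    using power_mono[OF xa, of 2] \<open>L \<ge> 0\<close> by (intro mult_left_mono) (auto simp: power_mult_distrib)
  moreover have "6 * (E * A) \<le> 6 * ((3 * (L * sqrt (\<eta> / \<mu>)) + L * (3 * A) + M * (3 * B)) * A)"
    using E nn by (intro mult_left_mono mult_right_mono) auto
  ultimately have le: "H x y \<le> H a b + 3 * \<eta> + 6 * ((3 * (L * sqrt (\<eta> / \<mu>)) + L * (3 * A) + M * (3 * B)) * A)
    + M\<^sup>2 / (2 * \<nu>) * (9 * A\<^sup>2) + L / 2 * (9 * A\<^sup>2)"
    using g3 by (simp add: inner_diff_left)
  have A2: "A * A = 2 * \<eta> / \<mu>" using pos \<open>\<eta> > 0\<close> by (simp add: A_def)
  have BA: "B * A = 2 * \<eta> / sqrt (\<mu> * \<nu>)"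
  proof -
    have "B * A = sqrt ((2 * \<eta>)\<^sup>2 / (\<mu> * \<nu>))"
      unfolding A_def B_def real_sqrt_mult[symmetric] by (simp add: power2_eq_square mult_ac)
    also have "\<dots> = 2 * \<eta> / sqrt (\<mu> * \<nu>)"
      using \<open>\<eta> > 0\<close> unfolding real_sqrt_divide by (subst real_sqrt_abs) simp
    finally show ?thesis .
  qed
  have sA: "sqrt (\<eta> / \<mu>) * A = sqrt 2 * \<eta> / \<mu>"
    using pos \<open>\<eta> > 0\<close> by (simp add: A_def real_sqrt_divide real_sqrt_mult)
  \<comment> \<open>Origin of the constants: 18 sqrt 2 comes from the sampling error of the
    gradient, 36 for \<open>L\<close> and for \<open>M\<close> from the displacement of its
    evaluation point, and 45 is 36 + 9 with 9 from the second-order term of the expansion.\<close>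
  have "6 * ((3 * (L * sqrt (\<eta> / \<mu>)) + L * (3 * A) + M * (3 * B)) * A) =
     18 * L * (sqrt (\<eta> / \<mu>) * A) + 18 * L * (A * A) + 18 * M * (B * A)"
    by (simp add: algebra_simps)
  also have "\<dots> = 18 * sqrt 2 * \<eta> * (L / \<mu>) + 36 * \<eta> * (L / \<mu>) + \<eta> * (36 * M / sqrt (\<mu> * \<nu>))"
    unfolding sA A2 BA by (simp add: algebra_simps)
  finally have 1: "6 * ((3 * (L * sqrt (\<eta> / \<mu>)) + L * (3 * A) + M * (3 * B)) * A) = \<dots>" .
  have 2: "M\<^sup>2 / (2 * \<nu>) * (9 * A\<^sup>2) = \<eta> * (9 * M\<^sup>2 / (\<mu> * \<nu>))"
    using A2 pos by (simp add: power2_eq_square field_simps)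
  have 3: "L / 2 * (9 * A\<^sup>2) = 9 * \<eta> * (L / \<mu>)"
    using A2 pos by (simp add: power2_eq_square field_simps)
  show ?thesis using le unfolding 1 2 3 x_def by (simp add: algebra_simps)
qed

section \<open>Doubling proximal weights and the total loss of one player\<close>

lemma lam_nonneg: "\<mu> \<ge> 0 \<Longrightarrow> lam \<mu> i \<ge> 0"
  by (cases i) auto

text \<open>The error of a center is controlled by the modulus of the old round but paid for with
  the weight of the new one. Doubling keeps this price at 2; the first round, which starts from
  weight 0, pays 1.\<close>

lemma lam_ratio:
  assumes "\<mu> > 0"
  shows "lam \<mu> (Suc i) / (\<mu> + lam \<mu> i) \<le> (if i = 0 then 1 else 2)"
proof (cases i)
  case (Suc j)
  have "\<mu> * 2 ^ Suc j \<le> 2 * (\<mu> + \<mu> * 2 ^ j)" using assms by simp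
  moreover have "\<mu> + \<mu> * 2 ^ j > 0" using assms by (simp add: add_pos_pos)
  ultimately show ?thesis using Suc by (simp add: divide_le_eq)
qed (use assms in auto)

text \<open>Comparing the saddle point of one round with that of the next one costs only the squared
  distance of the center from the former.\<close>

lemma proximal_chain:
  fixes F :: "'x::real_normed_vector \<Rightarrow> 'y \<Rightarrow> real"
  assumes "\<mu> > 0" "\<delta> \<ge> 0"
    and sp: "\<And>i. i \<le> Suc T \<Longrightarrow> saddle_point X Y (\<lambda>x y. F x y + lam \<mu> i / 2 * (norm (x - c i))\<^sup>2) (a i, b i)"
    and near: "\<And>i. i \<le> T \<Longrightarrow> (\<mu> + lam \<mu> i) * (norm (c (Suc i) - a i))\<^sup>2 \<le> 2 * \<delta>"
    and final: "\<And>y. y \<in> Y \<Longrightarrow> F x y + lam \<mu> (Suc T) / 2 * (norm (x - c (Suc T)))\<^sup>2 \<le>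
      F (a (Suc T)) (b (Suc T)) + lam \<mu> (Suc T) / 2 * (norm (a (Suc T) - c (Suc T)))\<^sup>2 + \<delta>"
    and y: "y \<in> Y"
  shows "F x y \<le> F (a 0) (b 0) + (2 * real T + 2) * \<delta>"
proof -
  \<comment> \<open>The price of a round: the new proximal term at the old saddle point.\<close>
  define q where "q i = lam \<mu> (Suc i) / 2 * (norm (c (Suc i) - a i))\<^sup>2" for i
  have q: "q i \<le> (if i = 0 then 1 else 2) * \<delta>" if "i \<le> T" for i
  proof -
    have pos: "\<mu> + lam \<mu> i > 0" using \<open>\<mu> > 0\<close> lam_nonneg[of \<mu> i] by simp
    then have "(norm (c (Suc i) - a i))\<^sup>2 \<le> 2 * \<delta> / (\<mu> + lam \<mu> i)"
      using near[OF that] by (simp add: field_simps)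
    then have "q i \<le> lam \<mu> (Suc i) / 2 * (2 * \<delta> / (\<mu> + lam \<mu> i))"
      unfolding q_def using \<open>\<mu> > 0\<close> by (intro mult_left_mono) auto
    also have "\<dots> = lam \<mu> (Suc i) / (\<mu> + lam \<mu> i) * \<delta>" by simp
    also have "\<dots> \<le> (if i = 0 then 1 else 2) * \<delta>"
      by (intro mult_right_mono lam_ratio assms)
    finally show ?thesis .
  qed
  \<comment> \<open>\<open>a i\<close> is inserted as a competitor at the saddle point of round
    \<open>Suc i\<close>.\<close>
  have val: "F (a (Suc i)) (b (Suc i)) + lam \<mu> (Suc i) / 2 * (norm (a (Suc i) - c (Suc i)))\<^sup>2 \<le>
      F (a i) (b (Suc i)) + q i" if "i \<le> T" for i
    using sp[of "Suc i"] sp[of i] that by (auto simp: saddle_point_def q_def norm_minus_commute)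
  \<comment> \<open>The invariant must hold for all \<open>y\<close>, since the next round evaluates
    it at \<open>b (Suc i)\<close>. The subtracted \<delta> records the cheaper first round; with
    the last round and the final \<delta> the total becomes 2 T + 2.\<close>
  have up: "F (a i) y \<le> F (a 0) (b 0) + 2 * real i * \<delta> - (if i = 0 then 0 else \<delta>)"
    if "i \<le> T" "y \<in> Y" for i y
    using that
  proof (induction i arbitrary: y)
    case 0
    then show ?case using sp[of 0] by (simp add: saddle_point_def)
  next
    case (Suc i)
    have "F (a (Suc i)) y + lam \<mu> (Suc i) / 2 * (norm (a (Suc i) - c (Suc i)))\<^sup>2 \<le>
        F (a (Suc i)) (b (Suc i)) + lam \<mu> (Suc i) / 2 * (norm (a (Suc i) - c (Suc i)))\<^sup>2"
      using sp[of "Suc i"] Suc.prems by (auto simp: saddle_point_def)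
    also have "\<dots> \<le> F (a i) (b (Suc i)) + q i" using val Suc.prems by simp
    finally have "F (a (Suc i)) y \<le> F (a i) (b (Suc i)) + q i"
      using \<open>\<mu> > 0\<close> by (smt (verit) lam_nonneg half_gt_zero_iff mult_nonneg_nonneg zero_le_power2 divide_nonneg_nonneg)
    moreover have "F (a i) (b (Suc i)) \<le> F (a 0) (b 0) + 2 * real i * \<delta> - (if i = 0 then 0 else \<delta>)"
      using Suc sp[of "Suc i"] by (auto simp: saddle_point_def)
    ultimately show ?case using q[of i] Suc.prems by (auto simp: algebra_simps split: if_splits)
  qed
  have "F x y \<le> F x y + lam \<mu> (Suc T) / 2 * (norm (x - c (Suc T)))\<^sup>2" using \<open>\<mu> > 0\<close> by simp
  also have "\<dots> \<le> F (a T) (b (Suc T)) + q T + \<delta>" using final[OF y] val[of T] by simp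
  also have "F (a T) (b (Suc T)) \<le> F (a 0) (b 0) + 2 * real T * \<delta> - (if T = 0 then 0 else \<delta>)"
    using sp[of "Suc T"] by (intro up) (auto simp: saddle_point_def)
  finally show ?thesis using q[of T] by (auto simp: algebra_simps split: if_splits)
qed

text \<open>Together with the next lemma, this symmetry lets the maximizing player inherit the
  bounds proved for the minimizing one.\<close>

lemma saddle_point_swap:
  "saddle_point Y X (\<lambda>y x. - h x y) (prod.swap z) \<longleftrightarrow> saddle_point X Y h z"
  by (auto simp: saddle_point_def)

lemma strong_saddle_swap:
  fixes h :: "'x::real_normed_vector \<Rightarrow> 'y::real_normed_vector \<Rightarrow> real"
  assumes "strong_saddle X Y \<mu> \<nu> h"
  shows "strong_saddle Y X \<nu> \<mu> (\<lambda>y x. - h x y)"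
proof -
  have "continuous_on (Y \<times> X) (\<lambda>v. - h (snd v) (fst v))"
    using assms unfolding strong_saddle_def
    by (intro continuous_on_minus continuous_on_curried_compose[of X Y h])
      (auto intro: continuous_on_fst continuous_on_snd continuous_on_id)
  with assms show ?thesis by (auto simp: strong_saddle_def case_prod_unfold)
qed

text \<open>The deterministic core for the minimizing player: sampling enters only through the
  majorities \<open>maj\<close>, \<open>majT\<close> and \<open>majG\<close>. The family
  \<open>H\<close> and the points \<open>s\<close> are parameters, so that the population
  objectives, and with exchanged players their negatives, can be substituted.\<close>

lemma boosted_side:
  fixes F :: "'x::euclidean_space \<Rightarrow> 'y::euclidean_space \<Rightarrow> real" and \<mu> L :: real and T :: nat
  defines "\<mu>' \<equiv> \<mu> + lam \<mu> (Suc T)" and "L' \<equiv> L + lam \<mu> (Suc T)"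
  assumes "\<delta> > 0" "L \<ge> 0" "M \<ge> 0" "\<eta> > 0"
    and S: "\<And>i. strong_saddle X Y (\<mu> + lam \<mu> i) \<nu> (H i)"
    and H: "\<And>i. H i = (\<lambda>x y. F x y + lam \<mu> i / 2 * (norm (x - c i))\<^sup>2)"
    and sp: "\<And>i. saddle_point X Y (H i) (s i)"
    and zs: "\<And>i j. zs i j \<in> X \<times> Y"
    and maj: "\<And>i. i \<le> T \<Longrightarrow> real (card {j. j < m \<and>
      H i (fst (zs i j)) (snd (s i)) - H i (fst (s i)) (snd (zs i j)) \<le> \<delta> / 9}) > real m / 2"
    and ks: "\<And>i. i \<le> T \<Longrightarrow> ks i \<in> extract_set m dist (\<lambda>j. fst (zs i j))"
    and c: "\<And>i. i \<le> T \<Longrightarrow> c (Suc i) = fst (zs i (ks i))"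
    and deriv: "\<And>x y. x \<in> X \<Longrightarrow> y \<in> Y \<Longrightarrow> ((\<lambda>u. F u y) has_derivative (\<lambda>d. g x y \<bullet> d)) (at x within X)"
    and smx: "\<And>x1 x2 y. x1 \<in> X \<Longrightarrow> x2 \<in> X \<Longrightarrow> y \<in> Y \<Longrightarrow> norm (g x1 y - g x2 y) \<le> L * norm (x1 - x2)"
    and smy: "\<And>x y1 y2. x \<in> X \<Longrightarrow> y1 \<in> Y \<Longrightarrow> y2 \<in> Y \<Longrightarrow> norm (g x y1 - g x y2) \<le> M * norm (y1 - y2)"
    and z: "\<And>j. z j \<in> X \<times> Y"
    and majT: "real (card {j. j < m \<and>
      H (Suc T) (fst (z j)) (snd (s (Suc T))) - H (Suc T) (fst (s (Suc T))) (snd (z j)) \<le> \<eta>}) > real m / 2"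
    and k1: "k1 \<in> extract_set m dist (\<lambda>j. fst (z j))"
    and k2: "k2 \<in> extract_set m dist (\<lambda>j. snd (z j))"
    and majG: "real (card {j. j < m \<and> norm (G j - g (fst (z k1)) (snd (z k2))) \<le> L' * sqrt (\<eta> / \<mu>')}) > real m / 2"
    and kG: "kG \<in> extract_set m dist G"
    and v: "v = G kG + lam \<mu> (Suc T) *\<^sub>R (fst (z k1) - c (Suc T))"
    and k3: "k3 \<in> extract_set m dist (\<lambda>j. fst (z j))"
      "k3 \<in> extract_set m (\<lambda>s t. \<bar>v \<bullet> (s - t)\<bar>) (\<lambda>j. fst (z j))"
    and \<eta>: "\<eta> * (3 + (18 * sqrt 2 + 45) * (L' / \<mu>') + 36 * M / sqrt (\<mu>' * \<nu>) + 9 * M\<^sup>2 / (\<mu>' * \<nu>)) = \<delta>"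
    and y: "y \<in> Y"
  shows "F (fst (z k3)) y \<le> F (fst (s 0)) (snd (s 0)) + (2 * real T + 2) * \<delta>"
proof -
  have \<mu>: "\<mu> > 0" using S[of 0] by (simp add: strong_saddle_def)
  have lam: "lam \<mu> (Suc T) \<ge> 0" using \<mu> by simp
  have \<mu>': "\<mu>' > 0" and L': "L' \<ge> 0" using \<mu> lam \<open>L \<ge> 0\<close> unfolding \<mu>'_def L'_def by linarith+
  have sp': "saddle_point X Y (H i) (fst (s i), snd (s i))" for i using sp[of i] by simp
  show ?thesis
  proof (rule proximal_chain[OF \<mu>, of \<delta> T X Y F c "\<lambda>i. fst (s i)" "\<lambda>i. snd (s i)"])
    show "saddle_point X Y (\<lambda>x y. F x y + lam \<mu> i / 2 * (norm (x - c i))\<^sup>2) (fst (s i), snd (s i))" for i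
      using sp[of i] by (simp add: H)
    show "(\<mu> + lam \<mu> i) * (norm (c (Suc i) - fst (s i)))\<^sup>2 \<le> 2 * \<delta>" if i: "i \<le> T" for i
    proof -
      let ?\<mu> = "\<mu> + lam \<mu> i"
      have pos: "?\<mu> > 0" using \<mu> lam_nonneg[of \<mu> i] by simp
      \<comment> \<open>The extraction factor 3 gets squared: gaps of size
        \<open>\<delta> / 9\<close> leave exactly \<open>2 * \<delta>\<close> after multiplication
        by the modulus.\<close>
      have "norm (c (Suc i) - fst (s i)) \<le> 3 * sqrt (2 * (\<delta> / 9) / ?\<mu>)"
        using extracted_candidates_near(1)[OF S[of i] sp'[of i] zs[of i] _ maj[OF i] ks[OF i]]
          \<open>\<delta> > 0\<close> c[OF i] by simp
      then have "(norm (c (Suc i) - fst (s i)))\<^sup>2 \<le> (3 * sqrt (2 * (\<delta> / 9) / ?\<mu>))\<^sup>2"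
        by (intro power_mono) auto
      also have "\<dots> = 2 * \<delta> / ?\<mu>"
      proof -
        have "(3 * sqrt (2 * (\<delta> / 9) / t))\<^sup>2 = 2 * \<delta> / t" if "t > 0" for t
          using that \<open>\<delta> > 0\<close> by (simp add: power_mult_distrib field_simps)
        from this[OF pos] show ?thesis .
      qed
      finally show ?thesis using pos by (simp add: field_simps)
    qed
    \<comment> \<open>The gradient of the proximal term is known exactly, so adding it at the
      evaluation point leaves the estimation error unchanged.\<close>
    define g' where "g' x y = g x y + lam \<mu> (Suc T) *\<^sub>R (x - c (Suc T))" for x y
    have Gnear: "norm (G kG - g (fst (z k1)) (snd (z k2))) \<le> 3 * (L' * sqrt (\<eta> / \<mu>'))"
      using extract_set_near(2)[of dist "L' * sqrt (\<eta> / \<mu>')" m G "g (fst (z k1)) (snd (z k2))" kG,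
          OF dist_triangle dist_commute _ _ kG] majG L' \<mu>' \<open>\<eta> > 0\<close>
      by (simp add: dist_norm)
    show "F (fst (z k3)) y + lam \<mu> (Suc T) / 2 * (norm (fst (z k3) - c (Suc T)))\<^sup>2
         \<le> F (fst (s (Suc T))) (snd (s (Suc T))) +
            lam \<mu> (Suc T) / 2 * (norm (fst (s (Suc T)) - c (Suc T)))\<^sup>2 + \<delta>" if y: "y \<in> Y" for y
    proof -
      have "H (Suc T) (fst (z k3)) y \<le> H (Suc T) (fst (s (Suc T))) (snd (s (Suc T))) +
        \<eta> * (3 + (18 * sqrt 2 + 45) * (L' / \<mu>') + 36 * M / sqrt (\<mu>' * \<nu>) + 9 * M\<^sup>2 / (\<mu>' * \<nu>))"
      proof (rule function_gap_bound[of X Y \<mu>' \<nu> "H (Suc T)" _ _ g' L' M \<eta> z m k1 k2 v k3 y])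
        show "((\<lambda>u. H (Suc T) u y) has_derivative (\<lambda>d. g' x y \<bullet> d)) (at x within X)" if "x \<in> X" "y \<in> Y" for x y
        proof -
          have "((\<lambda>u. lam \<mu> (Suc T) / 2 * ((u - c (Suc T)) \<bullet> (u - c (Suc T)))) has_derivative
              (\<lambda>d. (lam \<mu> (Suc T) *\<^sub>R (x - c (Suc T))) \<bullet> d)) (at x within X)"
            by (auto intro!: derivative_eq_intros simp: fun_eq_iff inner_commute algebra_simps)
          with deriv[OF that] show ?thesis
            unfolding H g'_def power2_norm_eq_inner inner_add_left by (rule has_derivative_add)
        qed
        show "norm (g' x1 y - g' x2 y) \<le> L' * norm (x1 - x2)" if "x1 \<in> X" "x2 \<in> X" "y \<in> Y" for x1 x2 y
        proof -
          have "g' x1 y - g' x2 y = (g x1 y - g x2 y) + lam \<mu> (Suc T) *\<^sub>R (x1 - x2)"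
            by (simp add: g'_def algebra_simps)
          also have "norm \<dots> \<le> L * norm (x1 - x2) + lam \<mu> (Suc T) * norm (x1 - x2)"
            using smx[OF that] lam by (intro norm_triangle_mono) auto
          finally show ?thesis by (simp add: L'_def algebra_simps)
        qed
        show "norm (g' x y1 - g' x y2) \<le> M * norm (y1 - y2)" if "x \<in> X" "y1 \<in> Y" "y2 \<in> Y" for x y1 y2
          using smy[OF that] by (simp add: g'_def)
        show "norm (v - g' (fst (z k1)) (snd (z k2))) \<le> 3 * (L' * sqrt (\<eta> / \<mu>'))"
          using Gnear by (simp add: v g'_def)
      qed (use S[of "Suc T"] sp'[of "Suc T"] L' \<open>M \<ge> 0\<close> \<open>\<eta> > 0\<close> z majT k1 k2 k3 y in \<open>simp_all add: \<mu>'_def\<close>)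
      then show ?thesis unfolding \<eta> H by simp
    qed
  qed (use \<open>\<delta> > 0\<close> y in auto)
qed

section \<open>Measurable selections and majority votes\<close>

text \<open>For closed \<open>C\<close>, membership of \<open>s w\<close> in \<open>C\<close> is a
  countable condition: for every tolerance, some point of a countable dense part of \<open>K\<close>
  passes the cross inequalities against a countable dense set. Such points accumulate at an exact
  saddle point in \<open>C\<close> by compactness, and uniqueness identifies it with
  \<open>s w\<close>.\<close>

lemma measurable_unique_saddle_point:
  fixes F :: "'w \<Rightarrow> 'x::euclidean_space \<Rightarrow> 'y::euclidean_space \<Rightarrow> real"
  assumes X: "compact X" and Y: "compact Y"
    and meas: "\<And>x y. x \<in> X \<Longrightarrow> y \<in> Y \<Longrightarrow> (\<lambda>w. F w x y) \<in> borel_measurable M"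
    and cont: "\<And>w. w \<in> space M \<Longrightarrow> continuous_on (X \<times> Y) (\<lambda>v. F w (fst v) (snd v))"
    and sp: "\<And>w. w \<in> space M \<Longrightarrow> saddle_point X Y (F w) (s w)"
    and uniq: "\<And>w z. w \<in> space M \<Longrightarrow> saddle_point X Y (F w) z \<Longrightarrow> z = s w"
  shows "s \<in> borel_measurable M"
  unfolding borel_eq_closed
proof (rule measurable_measure_of)
  fix C :: "('x \<times> 'y) set" assume "C \<in> Collect closed"
  then have C: "closed C" by simp
  define K where "K = C \<inter> (X \<times> Y)"
  have cXY: "compact (X \<times> Y)" using X Y by (rule compact_Times)
  have K: "compact K" unfolding K_def using C cXY by (intro closed_Int_compact)
  obtain D where D: "countable D" "D \<subseteq> K" "K \<subseteq> closure D" using separable by blast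
  obtain E where E: "countable E" "E \<subseteq> X \<times> Y" "X \<times> Y \<subseteq> closure E" using separable by blast
  have saddle: "saddle_point X Y (F w) z \<longleftrightarrow> z \<in> X \<times> Y \<and> (\<forall>v\<in>X \<times> Y. F w (fst z) (snd v) \<le> F w (fst v) (snd z))" for w z
    unfolding saddle_point_def by (cases z) (auto intro: order_trans)
  have "s -` C \<inter> space M = {w \<in> space M. \<forall>n::nat. \<exists>d\<in>D. \<forall>v\<in>E.
    F w (fst d) (snd v) \<le> F w (fst v) (snd d) + inverse (real (Suc n))}" (is "?L = ?R")
  proof (intro set_eqI iffI)
    fix w assume w: "w \<in> ?L"
    then have wM: "w \<in> space M" and sC: "s w \<in> C" by auto
    have sXY: "s w \<in> X \<times> Y" using sp[OF wM] by (auto simp: saddle)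
    \<comment> \<open>Uniform continuity provides one \<delta> for all test points
      \<open>v\<close>.\<close>
    have uc: "uniformly_continuous_on (X \<times> Y) (\<lambda>v. F w (fst v) (snd v))"
      using cont[OF wM] cXY by (intro compact_uniformly_continuous)
    have "\<exists>d\<in>D. \<forall>v\<in>E. F w (fst d) (snd v) \<le> F w (fst v) (snd d) + inverse (real (Suc n))" for n
    proof -
      let ?e = "inverse (real (Suc n))"
      obtain \<delta> where \<delta>: "\<delta> > 0" "\<And>v v'. v \<in> X \<times> Y \<Longrightarrow> v' \<in> X \<times> Y \<Longrightarrow> dist v' v < \<delta> \<Longrightarrow>
          dist (F w (fst v') (snd v')) (F w (fst v) (snd v)) < ?e / 2"
        using uc unfolding uniformly_continuous_on_def by (metis half_gt_zero inverse_positive_iff_positive of_nat_0_less_iff zero_less_Suc)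
      have "s w \<in> closure D" using D sC sXY by (auto simp: K_def)
      then obtain d where d: "d \<in> D" "dist d (s w) < \<delta>" using \<delta>(1) closure_approachable by blast
      have dXY: "d \<in> X \<times> Y" using d D by (auto simp: K_def)
      have "F w (fst d) (snd v) \<le> F w (fst v) (snd d) + ?e" if "v \<in> E" for v
      proof -
        have v: "v \<in> X \<times> Y" using that E by auto
        have "dist (fst d, snd v) (fst (s w), snd v) < \<delta>" "dist (fst v, snd d) (fst v, snd (s w)) < \<delta>"
          using d(2) dist_fst_le[of d "s w"] dist_snd_le[of d "s w"] by (simp_all add: dist_Pair_Pair)
        with \<delta>(2)[of "(fst (s w), snd v)" "(fst d, snd v)"] \<delta>(2)[of "(fst v, snd (s w))" "(fst v, snd d)"]
        have "dist (F w (fst d) (snd v)) (F w (fst (s w)) (snd v)) < ?e / 2"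
          "dist (F w (fst v) (snd d)) (F w (fst v) (snd (s w))) < ?e / 2"
          using dXY sXY v by (auto simp: mem_Times_iff)
        moreover have "F w (fst (s w)) (snd v) \<le> F w (fst v) (snd (s w))"
          using sp[OF wM] v by (auto simp: saddle)
        ultimately show ?thesis unfolding dist_real_def by linarith
      qed
      with d(1) show ?thesis by blast
    qed
    with wM show "w \<in> ?R" by blast
  next
    fix w assume "w \<in> ?R"
    then have wM: "w \<in> space M" and "\<forall>n. \<exists>d\<in>D. \<forall>v\<in>E. F w (fst d) (snd v) \<le> F w (fst v) (snd d) + inverse (real (Suc n))"
      by auto
    then obtain d where d: "\<And>n. d n \<in> D"
      "\<And>n v. v \<in> E \<Longrightarrow> F w (fst (d n)) (snd v) \<le> F w (fst v) (snd (d n)) + inverse (real (Suc n))" by metis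
    have "\<forall>n. d n \<in> K" using d D by auto
    then obtain l r where l: "l \<in> K" and r: "strict_mono r" and lim: "(d \<circ> r) \<longlonglongrightarrow> l"
      using K unfolding compact_def by metis
    have lim': "(\<lambda>n. d (r n)) \<longlonglongrightarrow> l" using lim by (simp add: o_def)
    have lXY: "l \<in> X \<times> Y" and dXY: "d n \<in> X \<times> Y" for n using l d D by (auto simp: K_def)
    have F_lim: "(\<lambda>n. F w (fst (u n)) (snd (u n))) \<longlonglongrightarrow> F w (fst u0) (snd u0)"
      if "u \<longlonglongrightarrow> u0" "u0 \<in> X \<times> Y" "\<And>n. u n \<in> X \<times> Y" for u u0
      using cont[OF wM] that unfolding continuous_on_sequentially by (auto simp: o_def)
    have le: "F w (fst l) (snd v) \<le> F w (fst v) (snd l)" if "v \<in> E" for v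
    proof (rule LIMSEQ_le)
      have v: "v \<in> X \<times> Y" using that E by auto
      show "(\<lambda>n. F w (fst (d (r n))) (snd v)) \<longlonglongrightarrow> F w (fst l) (snd v)"
        using F_lim[OF tendsto_Pair[OF tendsto_fst[OF lim'] tendsto_const], of "snd v"] lXY dXY v
        by (simp add: mem_Times_iff)
      have "(\<lambda>n. F w (fst v) (snd (d (r n)))) \<longlonglongrightarrow> F w (fst v) (snd l)"
        using F_lim[OF tendsto_Pair[OF tendsto_const tendsto_snd[OF lim']], of "fst v"] lXY dXY v
        by (simp add: mem_Times_iff)
      moreover have "(\<lambda>n. inverse (real (Suc (r n)))) \<longlonglongrightarrow> 0"
        using LIMSEQ_subseq_LIMSEQ[OF LIMSEQ_inverse_real_of_nat r] by (simp add: o_def)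
      ultimately show "(\<lambda>n. F w (fst v) (snd (d (r n))) + inverse (real (Suc (r n)))) \<longlonglongrightarrow> F w (fst v) (snd l)"
        using tendsto_add by fastforce
    qed (use d(2)[OF that] in auto)
    let ?Z = "{v \<in> X \<times> Y. F w (fst l) (snd v) \<le> F w (fst v) (snd l)}"
    have "closed ?Z"
    proof (rule continuous_on_closed_Collect_le)
      show "continuous_on (X \<times> Y) (\<lambda>v. F w (fst l) (snd v))"
        by (rule continuous_on_compose2[OF cont[OF wM], of _ "\<lambda>v. (fst l, snd v)", simplified])
          (use lXY in \<open>auto intro!: continuous_on_Pair continuous_on_snd continuous_on_id\<close>)
      show "continuous_on (X \<times> Y) (\<lambda>v. F w (fst v) (snd l))"
        by (rule continuous_on_compose2[OF cont[OF wM], of _ "\<lambda>v. (fst v, snd l)", simplified])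
          (use lXY in \<open>auto intro!: continuous_on_Pair continuous_on_fst continuous_on_id\<close>)
    qed (use cXY in \<open>rule compact_imp_closed\<close>)
    then have "closure E \<subseteq> ?Z" using E le by (intro closure_minimal) auto
    then have "saddle_point X Y (F w) l" using E(3) lXY unfolding saddle by blast
    from uniq[OF wM this] l wM show "w \<in> ?L" by (auto simp: K_def)
  qed
  also have "\<dots> \<in> sets M"
  proof (intro sets.sets_Collect_countable_All sets.sets_Collect_countable_Ex'[OF _ D(1)] sets.sets_Collect_countable_All'[OF _ E(1)])
    fix n :: nat and d v assume "d \<in> D" "v \<in> E"
    then have "fst d \<in> X" "snd d \<in> Y" "fst v \<in> X" "snd v \<in> Y" using D E by (auto simp: K_def)
    then show "{w \<in> space M. F w (fst d) (snd v) \<le> F w (fst v) (snd d) + inverse (real (Suc n))} \<in> sets M"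
      using meas by (intro borel_measurable_le borel_measurable_add borel_measurable_const)
  qed
  finally show "s -` C \<inter> space M \<in> sets M" .
qed auto

text \<open>A measurable function is approximated by functions with values in a countable dense set.\<close>

lemma measurable_Caratheodory:
  fixes g :: "'w \<Rightarrow> 'e::{metric_space, second_countable_topology} \<Rightarrow> 'b::metric_space"
  assumes meas: "\<And>z. z \<in> Z \<Longrightarrow> (\<lambda>w. g w z) \<in> borel_measurable M"
    and cont: "\<And>w. w \<in> space M \<Longrightarrow> continuous_on Z (g w)"
    and u [measurable]: "u \<in> borel_measurable M" and uZ: "\<And>w. w \<in> space M \<Longrightarrow> u w \<in> Z"
  shows "(\<lambda>w. g w (u w)) \<in> borel_measurable M"
proof (cases "space M = {}")
  case False
  obtain D where D: "countable D" "D \<subseteq> Z" "Z \<subseteq> closure D" using separable by blast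
  have ne: "D \<noteq> {}" using D(3) False uZ by fastforce
  define d where "d = from_nat_into D"
  have d: "d k \<in> Z" for k using from_nat_into[OF ne, of k] D by (auto simp: d_def)
  \<comment> \<open>The first dense point within \<open>1 / (n + 1)\<close> of \<open>u w\<close> is
    a measurable choice with countably many values, for which measurability of \<open>g\<close> in
    its first argument is enough.\<close>
  define K where "K n w = (LEAST k. dist (d k) (u w) < inverse (real (Suc n)))" for n w
  have K: "dist (d (K n w)) (u w) < inverse (real (Suc n))" if "w \<in> space M" for n w
  proof -
    have "u w \<in> closure D" using uZ[OF that] D by auto
    then obtain v where "v \<in> D" "dist v (u w) < inverse (real (Suc n))"
      using closure_approachable[of "u w" D] by (metis inverse_positive_iff_positive of_nat_0_less_iff zero_less_Suc)
    moreover then obtain k where "d k = v" using D(1) by (metis d_def from_nat_into_surj)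
    ultimately have "\<exists>k. dist (d k) (u w) < inverse (real (Suc n))" by auto
    then show ?thesis unfolding K_def by (rule LeastI_ex)
  qed
  have K_meas: "K n \<in> measurable M (count_space UNIV)" for n
    unfolding K_def by measurable
  show ?thesis
  proof (rule borel_measurable_LIMSEQ_metric)
    show "(\<lambda>w. g w (d (K n w))) \<in> borel_measurable M" for n
      by (rule measurable_compose_countable[OF _ K_meas]) (rule meas[OF d])
    fix w assume w: "w \<in> space M"
    have "(\<lambda>n. dist (d (K n w)) (u w)) \<longlonglongrightarrow> 0"
      by (rule tendsto_sandwich[OF _ _ tendsto_const LIMSEQ_inverse_real_of_nat])
        (auto intro!: always_eventually less_imp_le K[OF w] simp del: of_nat_Suc)
    then have "(\<lambda>n. d (K n w)) \<longlonglongrightarrow> u w" using tendsto_dist_iff by blast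
    with cont[OF w] d uZ[OF w] show "(\<lambda>n. g w (d (K n w))) \<longlonglongrightarrow> g w (u w)"
      unfolding continuous_on_sequentially by (auto simp: o_def)
  qed
next
  case True
  then show ?thesis by (simp add: measurable_def)
qed

section \<open>Majority votes over independent batches\<close>

lemma sets_Collect_card_le:
  fixes m :: nat
  assumes P: "\<And>j. j < m \<Longrightarrow> {\<omega> \<in> space M. P j \<omega>} \<in> sets M"
  shows "{\<omega> \<in> space M. real (card {j. j < m \<and> P j \<omega>}) \<le> r} \<in> sets M"
proof -
  have "(\<lambda>\<omega>. \<Sum>j<m. indicator {\<omega> \<in> space M. P j \<omega>} \<omega> :: real) \<in> borel_measurable M"
    using P by (intro borel_measurable_sum borel_measurable_indicator) auto
  then have "{\<omega> \<in> space M. (\<Sum>j<m. indicator {\<omega> \<in> space M. P j \<omega>} \<omega>) \<le> r} \<in> sets M"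
    by (intro borel_measurable_le) auto
  also have "{\<omega> \<in> space M. (\<Sum>j<m. indicator {\<omega> \<in> space M. P j \<omega>} \<omega>) \<le> r} =
    {\<omega> \<in> space M. real (card {j. j < m \<and> P j \<omega>}) \<le> r}"
  proof (intro Collect_cong conj_cong refl)
    fix \<omega> assume "\<omega> \<in> space M"
    then have "(\<Sum>j<m. indicator {\<omega> \<in> space M. P j \<omega>} \<omega> :: real) =
      (\<Sum>j<m. if j \<in> {j. P j \<omega>} then 1 else 0)"
      by (intro sum.cong) (auto simp: indicator_def)
    also have "\<dots> = (\<Sum>j\<in>{..<m} \<inter> {j. P j \<omega>}. 1)"
      by (rule sum.inter_restrict[symmetric]) simp
    also have "{..<m} \<inter> {j. P j \<omega>} = {j. j < m \<and> P j \<omega>}" by auto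
    finally show "((\<Sum>j<m. indicator {\<omega> \<in> space M. P j \<omega>} \<omega>) \<le> r) = (real (card {j. j < m \<and> P j \<omega>}) \<le> r)"
      by simp
  qed
  finally show ?thesis .
qed

context prob_space
begin

text \<open>The expected number of good batches is at least 2 m / 3, and a failure lies at least m /
  6 below it. Hoeffding's exponent 2 (m / 6)^2 / m equals m / 18, the origin of the 18 in
  \<open>reps\<close>.\<close>

lemma majority_failure_le:
  assumes indep: "indep_vars N Z {..<m}" and A: "\<And>j. j < m \<Longrightarrow> A j \<in> sets (N j)"
    and p: "\<And>j. j < m \<Longrightarrow> prob (Z j -` A j \<inter> space M) \<ge> 2 / 3" and "m > 0"
  shows "prob {\<omega> \<in> space M. real (card {j. j < m \<and> Z j \<omega> \<in> A j}) \<le> real m / 2} \<le> exp (- real m / 18)"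
proof -
  define I where "I j \<omega> = (indicator (A j) (Z j \<omega>) :: real)" for j \<omega>
  have Z: "random_variable (N j) (Z j)" if "j < m" for j using indep that by (auto simp: indep_vars_def)
  have indep': "indep_vars (\<lambda>_. borel) I {..<m}"
    unfolding I_def using A by (intro indep_vars_compose2[OF indep]) auto
  interpret H: Hoeffding_ineq M "{..<m}" I "\<lambda>_. 0" "\<lambda>_. 1" "\<Sum>j<m. expectation (I j)"
    by unfold_locales (auto simp: indep' I_def indicator_def)
  have E: "expectation (I j) \<ge> 2 / 3" if "j < m" for j
  proof -
    have "expectation (I j) = expectation (indicator (Z j -` A j \<inter> space M))"
      by (intro Bochner_Integration.integral_cong) (auto simp: I_def indicator_def)
    then show ?thesis using p[OF that] measurable_sets[OF Z[OF that] A[OF that]] by simp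
  qed
  have "(\<Sum>j<m. (2 / 3 :: real)) \<le> (\<Sum>j<m. expectation (I j))" using E by (intro sum_mono) auto
  then have mean: "2 / 3 * real m \<le> (\<Sum>j<m. expectation (I j))" by simp
  have card: "(\<Sum>j<m. I j \<omega>) = real (card {j. j < m \<and> Z j \<omega> \<in> A j})" for \<omega>
  proof -
    have "(\<Sum>j<m. I j \<omega>) = (\<Sum>j\<in>{..<m} \<inter> {j. Z j \<omega> \<in> A j}. 1)"
      unfolding I_def by (simp add: sum.inter_restrict indicator_def)
    also have "{..<m} \<inter> {j. Z j \<omega> \<in> A j} = {j. j < m \<and> Z j \<omega> \<in> A j}" by auto
    finally show ?thesis by simp
  qed
  have "prob {\<omega> \<in> space M. real (card {j. j < m \<and> Z j \<omega> \<in> A j}) \<le> real m / 2} \<le>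
    prob {\<omega> \<in> space M. (\<Sum>j<m. I j \<omega>) \<le> (\<Sum>j<m. expectation (I j)) - real m / 6}"
  proof (rule finite_measure_mono)
    have "I j \<in> borel_measurable M" if "j < m" for j using H.random_variable that by auto
    then have "(\<lambda>\<omega>. \<Sum>j<m. I j \<omega>) \<in> borel_measurable M" by (intro borel_measurable_sum) auto
    then show "{\<omega> \<in> space M. (\<Sum>j<m. I j \<omega>) \<le> (\<Sum>j<m. expectation (I j)) - real m / 6} \<in> events"
      by (intro borel_measurable_le) auto
  qed (use mean in \<open>auto simp: card\<close>)
  also have "\<dots> \<le> exp (-2 * (real m / 6)\<^sup>2 / (\<Sum>j<m. (1 - 0)\<^sup>2))"
    using \<open>m > 0\<close> by (intro H.Hoeffding_ineq_le) auto
  also have "-2 * (real m / 6)\<^sup>2 / (\<Sum>j<m. (1 - 0)\<^sup>2) = - real m / 18"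
    using \<open>m > 0\<close> by (simp add: power2_eq_square)
  finally show ?thesis .
qed

lemma prob_space_power: "prob_space (Pi\<^sub>M I (\<lambda>_. M))"
  by (intro prob_space_PiM prob_space_axioms)

text \<open>The batches \<open>j < m\<close> occupy the coordinates \<open>e j i\<close>. The set of good batches may depend on
  the remaining coordinates, on which one conditions by Fubini's theorem.\<close>

lemma conditional_majority_failure_le:
  fixes e :: "nat \<Rightarrow> nat \<Rightarrow> 'i" and n m :: nat
  defines "J \<equiv> {e j i | j i. j < m \<and> i < n}"
  assumes fin: "finite I" and inj: "inj_on (\<lambda>(j, i). e j i) ({..<m} \<times> {..<n})"
    and JI: "\<And>j i. j < m \<Longrightarrow> i < n \<Longrightarrow> e j i \<in> I" and "m > 0"
    and B: "B \<in> sets (Pi\<^sub>M I (\<lambda>_. M))"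
    and G: "\<And>\<omega>. \<omega> \<in> space (Pi\<^sub>M I (\<lambda>_. M)) \<Longrightarrow> \<exists>G\<in>sets (Pi\<^sub>M {..<n} (\<lambda>_. M)).
      measure (Pi\<^sub>M {..<n} (\<lambda>_. M)) G \<ge> 2 / 3 \<and>
      (\<forall>\<omega>'\<in>B. (\<forall>k. k \<notin> J \<longrightarrow> \<omega>' k = \<omega> k) \<longrightarrow>
        real (card {j. j < m \<and> (\<lambda>i\<in>{..<n}. \<omega>' (e j i)) \<in> G}) \<le> real m / 2)"
  shows "measure (Pi\<^sub>M I (\<lambda>_. M)) B \<le> exp (- real m / 18)"
proof -
  let ?P = "\<lambda>I. Pi\<^sub>M I (\<lambda>_. M)"
  interpret pr: product_sigma_finite "\<lambda>_. M" by unfold_locales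
  have J: "J \<subseteq> I" using JI by (auto simp: J_def)
  have finJ: "finite J" using finite_subset[OF J fin] .
  interpret PJ: prob_space "?P J" by (rule prob_space_power)
  interpret PI: prob_space "?P I" by (rule prob_space_power)
  interpret PK: prob_space "?P (I - J)" by (rule prob_space_power)
  let ?m = "merge (I - J) J"
  have IJ: "(I - J) \<union> J = I" using J by auto
  have mm: "?m \<in> measurable (?P (I - J) \<Otimes>\<^sub>M ?P J) (?P I)" using measurable_merge[of "I - J" J "\<lambda>_. M"] IJ by simp
  have distr: "distr (?P (I - J) \<Otimes>\<^sub>M ?P J) (?P I) ?m = ?P I"
    using pr.distr_merge[of "I - J" J] fin finJ unfolding IJ by blast
  have block: "measure (?P J) {x \<in> space (?P J). ?m (\<omega>, x) \<in> B} \<le> exp (- real m / 18)"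
    if \<omega>: "\<omega> \<in> space (?P (I - J))" for \<omega>
  proof -
    \<comment> \<open>The batch coordinates may be filled arbitrarily: what the resulting event says
      about \<open>B\<close> concerns only points that agree off \<open>J\<close>.\<close>
    obtain x0 where x0: "x0 \<in> space (?P J)" using PJ.not_empty by blast
    have "?m (\<omega>, x0) \<in> space (?P I)"
      using measurable_space[OF mm, of "(\<omega>, x0)"] \<omega> x0 by (simp add: space_pair_measure)
    from G[OF this] obtain G where G: "G \<in> sets (?P {..<n})" "measure (?P {..<n}) G \<ge> 2 / 3"
      and G': "\<And>\<omega>'. \<omega>' \<in> B \<Longrightarrow> \<forall>k. k \<notin> J \<longrightarrow> \<omega>' k = ?m (\<omega>, x0) k \<Longrightarrow>
        real (card {j. j < m \<and> (\<lambda>i\<in>{..<n}. \<omega>' (e j i)) \<in> G}) \<le> real m / 2" by auto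
    define Z where "Z j x = (\<lambda>i\<in>{..<n}. x (e j i))" for j and x :: "'i \<Rightarrow> 'a"
    have Zm: "Z j \<in> measurable (?P J) (?P {..<n})" if "j < m" for j
      unfolding Z_def using that by (intro measurable_restrict measurable_component_singleton) (auto simp: J_def)
    \<comment> \<open>Read through its own reindexing, every batch is a copy of the same product of
      \<open>n\<close> factors, so one event \<open>G\<close> serves all of them.\<close>
    have distrZ: "distr (?P J) (?P {..<n}) (Z j) = ?P {..<n}" if "j < m" for j
      unfolding Z_def
    proof (rule distr_PiM_reindex)
      show "inj_on (e j) {..<n}" using inj that by (auto simp: inj_on_def)
      show "e j \<in> {..<n} \<rightarrow> J" using that by (auto simp: J_def)
    qed (rule prob_space_axioms)
    have "PJ.indep_vars (\<lambda>k. M) (\<lambda>k x. x k) J"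
    \<comment> \<open>For \<open>n = 0\<close> there are no coordinates, and independence is
      immediate from its definition.\<close>
    proof (cases "J = {}")
      case False
      have "distr (?P J) (?P J) (\<lambda>x. \<lambda>k\<in>J. x k) = distr (?P J) (?P J) (\<lambda>x. x)"
        by (intro distr_cong) (auto simp: space_PiM PiE_def extensional_restrict)
      moreover have "distr (?P J) M (\<lambda>x. x k) = M" if "k \<in> J" for k
        using that by (intro distr_PiM_component prob_space_axioms)
      ultimately show ?thesis
        using False by (subst PJ.indep_vars_iff_distr_eq_PiM') (auto cong: PiM_cong)
    next
      case True
      show ?thesis unfolding PJ.indep_vars_def PJ.indep_sets_def by (simp add: True)
    qed
    then have "PJ.indep_vars (\<lambda>j. ?P (e j ` {..<n})) (\<lambda>j x. restrict (\<lambda>k. x k) (e j ` {..<n})) {..<m}"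
    proof (rule PJ.indep_vars_restrict)
      show "e j ` {..<n} \<subseteq> J" if "j \<in> {..<m}" for j using that by (auto simp: J_def)
      show "disjoint_family_on (\<lambda>j. e j ` {..<n}) {..<m}"
        using inj by (fastforce simp: disjoint_family_on_def inj_on_def)
    qed
    then have "PJ.indep_vars (\<lambda>_. ?P {..<n}) (\<lambda>j x. \<lambda>i\<in>{..<n}. restrict (\<lambda>k. x k) (e j ` {..<n}) (e j i)) {..<m}"
      by (rule PJ.indep_vars_compose2[where Y = "\<lambda>j y. \<lambda>i\<in>{..<n}. y (e j i)"])
        (intro measurable_restrict measurable_component_singleton, auto)
    then have indep: "PJ.indep_vars (\<lambda>_. ?P {..<n}) Z {..<m}"
      by (rule PJ.indep_vars_cong[THEN iffD1, rotated -1]) (auto simp: Z_def fun_eq_iff)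
    have "measure (?P J) {x \<in> space (?P J). ?m (\<omega>, x) \<in> B} \<le>
      measure (?P J) {x \<in> space (?P J). real (card {j. j < m \<and> Z j x \<in> G}) \<le> real m / 2}"
    proof (rule PJ.finite_measure_mono)
      have "{x \<in> space (?P J). Z j x \<in> G} \<in> sets (?P J)" if "j < m" for j
        using measurable_sets[OF Zm[OF that] G(1)] by (simp add: vimage_def Int_def conj_commute)
      then show "{x \<in> space (?P J). real (card {j. j < m \<and> Z j x \<in> G}) \<le> real m / 2} \<in> sets (?P J)"
        by (rule sets_Collect_card_le)
      show "{x \<in> space (?P J). ?m (\<omega>, x) \<in> B} \<subseteq>
        {x \<in> space (?P J). real (card {j. j < m \<and> Z j x \<in> G}) \<le> real m / 2}"
      proof safe
        fix x assume x: "x \<in> space (?P J)" "?m (\<omega>, x) \<in> B"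
        have "\<forall>k. k \<notin> J \<longrightarrow> ?m (\<omega>, x) k = ?m (\<omega>, x0) k" by (simp add: merge_def)
        from G'[OF x(2) this]
        have "real (card {j. j < m \<and> (\<lambda>i\<in>{..<n}. ?m (\<omega>, x) (e j i)) \<in> G}) \<le> real m / 2" .
        moreover have "(\<lambda>i\<in>{..<n}. ?m (\<omega>, x) (e j i)) = Z j x" if "j < m" for j
          using that by (auto simp: Z_def merge_def J_def fun_eq_iff)
        then have "{j. j < m \<and> (\<lambda>i\<in>{..<n}. ?m (\<omega>, x) (e j i)) \<in> G} = {j. j < m \<and> Z j x \<in> G}" by auto
        ultimately show "real (card {j. j < m \<and> Z j x \<in> G}) \<le> real m / 2" by simp
      qed
    qed
    also have "\<dots> \<le> exp (- real m / 18)"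
    proof (rule PJ.majority_failure_le[OF indep G(1) _ \<open>m > 0\<close>])
      fix j assume "j < m"
      have "measure (?P {..<n}) G = measure (distr (?P J) (?P {..<n}) (Z j)) G" by (simp add: distrZ[OF \<open>j < m\<close>])
      also have "\<dots> = measure (?P J) (Z j -` G \<inter> space (?P J))"
        by (rule measure_distr[OF Zm[OF \<open>j < m\<close>] G(1)])
      finally show "2 / 3 \<le> measure (?P J) (Z j -` G \<inter> space (?P J))" using G(2) by simp
    qed
    finally show ?thesis .
  qed
  let ?B = "?m -` B \<inter> space (?P (I - J) \<Otimes>\<^sub>M ?P J)"
  have Bm: "?B \<in> sets (?P (I - J) \<Otimes>\<^sub>M ?P J)" using mm B by (rule measurable_sets)
  have "emeasure (?P I) B = emeasure (distr (?P (I - J) \<Otimes>\<^sub>M ?P J) (?P I) ?m) B" by (simp add: distr)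
  also have "\<dots> = emeasure (?P (I - J) \<Otimes>\<^sub>M ?P J) ?B" by (rule emeasure_distr[OF mm B])
  also have "\<dots> = (\<integral>\<^sup>+\<omega>. emeasure (?P J) (Pair \<omega> -` ?B) \<partial>?P (I - J))"
    by (rule PJ.emeasure_pair_measure_alt[OF Bm])
  also have "\<dots> \<le> (\<integral>\<^sup>+\<omega>. ennreal (exp (- real m / 18)) \<partial>?P (I - J))"
  proof (rule nn_integral_mono)
    fix \<omega> assume "\<omega> \<in> space (?P (I - J))"
    moreover from this have "Pair \<omega> -` ?B = {x \<in> space (?P J). ?m (\<omega>, x) \<in> B}"
      by (auto simp: space_pair_measure)
    ultimately show "emeasure (?P J) (Pair \<omega> -` ?B) \<le> ennreal (exp (- real m / 18))"
      using block by (simp add: PJ.emeasure_eq_measure ennreal_leI)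
  qed
  also have "\<dots> = ennreal (exp (- real m / 18))" by (simp add: PK.emeasure_space_1)
  finally show ?thesis by (simp add: PI.emeasure_eq_measure)
qed

end

section \<open>Convex-concave Lipschitz functions and the stability of saddle points\<close>

definition convex_concave_lipschitz where
  "convex_concave_lipschitz X Y lx ly h \<longleftrightarrow>
     (\<forall>y\<in>Y. convex_on X (\<lambda>x. h x y) \<and> lx-lipschitz_on X (\<lambda>x. h x y)) \<and>
     (\<forall>x\<in>X. concave_on Y (\<lambda>y. h x y) \<and> ly-lipschitz_on Y (\<lambda>y. h x y))"

lemma convex_concave_lipschitz_diff_le:
  fixes h :: "'x::real_normed_vector \<Rightarrow> 'y::real_normed_vector \<Rightarrow> real"
  assumes "convex_concave_lipschitz X Y lx ly h" "a \<in> X" "x \<in> X" "b \<in> Y" "y \<in> Y"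
  shows "\<bar>h a b - h x y\<bar> \<le> lx * norm (a - x) + ly * norm (b - y)"
proof -
  have "\<bar>h a b - h x b\<bar> \<le> lx * norm (a - x)" "\<bar>h x b - h x y\<bar> \<le> ly * norm (b - y)"
    using assms lipschitz_onD[of lx X "\<lambda>x. h x b" a x] lipschitz_onD[of ly Y "\<lambda>y. h x y" b y]
    by (auto simp: convex_concave_lipschitz_def dist_norm)
  then show ?thesis by linarith
qed

lemma convex_concave_lipschitz_continuous:
  fixes h :: "'x::real_normed_vector \<Rightarrow> 'y::real_normed_vector \<Rightarrow> real"
  assumes h: "convex_concave_lipschitz X Y lx ly h"
  shows "continuous_on (X \<times> Y) (\<lambda>(x, y). h x y)"
  unfolding continuous_on
proof (rule ballI)
  fix v assume v: "v \<in> X \<times> Y"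
  have "((\<lambda>u. (case u of (x, y) \<Rightarrow> h x y) - (case v of (x, y) \<Rightarrow> h x y)) \<longlongrightarrow> 0) (at v within X \<times> Y)"
  proof (rule Lim_null_comparison)
    show "\<forall>\<^sub>F u in at v within X \<times> Y.
      norm ((case u of (x, y) \<Rightarrow> h x y) - (case v of (x, y) \<Rightarrow> h x y)) \<le>
        lx * norm (fst u - fst v) + ly * norm (snd u - snd v)"
      unfolding eventually_at_filter using v
      by (auto intro!: always_eventually convex_concave_lipschitz_diff_le[OF h])
    have "((\<lambda>u. lx * norm (fst u - fst v) + ly * norm (snd u - snd v)) \<longlongrightarrow>
      lx * norm (fst v - fst v) + ly * norm (snd v - snd v)) (at v within X \<times> Y)"
      by (intro tendsto_intros)
    then show "((\<lambda>u. lx * norm (fst u - fst v) + ly * norm (snd u - snd v)) \<longlongrightarrow> 0) (at v within X \<times> Y)"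
      by simp
  qed
  then show "((\<lambda>(x, y). h x y) \<longlongrightarrow> (\<lambda>(x, y). h x y) v) (at v within X \<times> Y)"
    by (simp add: LIM_zero_iff)
qed

text \<open>All defining inequalities survive integration. The sample measure yields the population
  objective, the uniform distribution on the indices of a batch yields the sample average.\<close>

lemma convex_concave_lipschitz_integral:
  fixes g :: "'w \<Rightarrow> 'x::real_normed_vector \<Rightarrow> 'y::real_normed_vector \<Rightarrow> real"
  assumes M: "prob_space M" and cc: "\<And>w. convex_concave_lipschitz X Y lx ly (g w)"
    and int: "\<And>x y. x \<in> X \<Longrightarrow> y \<in> Y \<Longrightarrow> integrable M (\<lambda>w. g w x y)"
    and "convex X" "convex Y"
  shows "convex_concave_lipschitz X Y lx ly (\<lambda>x y. \<integral>w. g w x y \<partial>M)"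
proof -
  interpret prob_space M by fact
  have lip: "\<bar>(\<integral>w. g w a b \<partial>M) - (\<integral>w. g w x y \<partial>M)\<bar> \<le> lx * norm (a - x) + ly * norm (b - y)"
    if "a \<in> X" "x \<in> X" "b \<in> Y" "y \<in> Y" for a x b y
  proof -
    have "\<bar>(\<integral>w. g w a b \<partial>M) - (\<integral>w. g w x y \<partial>M)\<bar> = \<bar>\<integral>w. g w a b - g w x y \<partial>M\<bar>"
      using int that by simp
    also have "\<dots> \<le> (\<integral>w. \<bar>g w a b - g w x y\<bar> \<partial>M)"
      using integral_norm_bound[of M "\<lambda>w. g w a b - g w x y"] by simp
    also have "\<dots> \<le> lx * norm (a - x) + ly * norm (b - y)"
      using int that convex_concave_lipschitz_diff_le[OF cc]
      by (intro integral_le_const integrable_abs Bochner_Integration.integrable_diff) auto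
    finally show ?thesis .
  qed
  have ge0: "lx \<ge> 0" if "y \<in> Y" for y
    using cc that unfolding convex_concave_lipschitz_def by (meson lipschitz_on_nonneg)
  have ge0': "ly \<ge> 0" if "x \<in> X" for x
    using cc that unfolding convex_concave_lipschitz_def by (meson lipschitz_on_nonneg)
  have conv: "convex_on X (\<lambda>x. \<integral>w. g w x y \<partial>M)" if y: "y \<in> Y" for y
  proof (rule convex_onI)
    fix t :: real and a x assume t: "0 < t" "t < 1" and X: "a \<in> X" "x \<in> X"
    then have in_X: "(1 - t) *\<^sub>R a + t *\<^sub>R x \<in> X" using \<open>convex X\<close> by (simp add: convexD)
    have "g w ((1 - t) *\<^sub>R a + t *\<^sub>R x) y \<le> (1 - t) * g w a y + t * g w x y" for w
      using cc[of w] y t X by (intro convex_onD[of X "\<lambda>x. g w x y"]) (auto simp: convex_concave_lipschitz_def)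
    then have "(\<integral>w. g w ((1 - t) *\<^sub>R a + t *\<^sub>R x) y \<partial>M) \<le> (\<integral>w. (1 - t) * g w a y + t * g w x y \<partial>M)"
      using int y X in_X by (intro integral_mono) auto
    then show "(\<integral>w. g w ((1 - t) *\<^sub>R a + t *\<^sub>R x) y \<partial>M) \<le>
      (1 - t) * (\<integral>w. g w a y \<partial>M) + t * (\<integral>w. g w x y \<partial>M)"
      using int y X by simp
  qed fact
  have conc: "convex_on Y (\<lambda>y. - (\<integral>w. g w x y \<partial>M))" if x: "x \<in> X" for x
  proof (rule convex_onI)
    fix t :: real and b y assume t: "0 < t" "t < 1" and Y: "b \<in> Y" "y \<in> Y"
    then have in_Y: "(1 - t) *\<^sub>R b + t *\<^sub>R y \<in> Y" using \<open>convex Y\<close> by (simp add: convexD)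
    have "- g w x ((1 - t) *\<^sub>R b + t *\<^sub>R y) \<le> (1 - t) * (- g w x b) + t * (- g w x y)" for w
      using cc[of w] x t Y by (intro convex_onD[of Y "\<lambda>y. - g w x y"]) (auto simp: convex_concave_lipschitz_def concave_on_def)
    then have "(1 - t) * g w x b + t * g w x y \<le> g w x ((1 - t) *\<^sub>R b + t *\<^sub>R y)" for w
      by (simp add: minus_mult_right[symmetric] algebra_simps)
    then have "(\<integral>w. (1 - t) * g w x b + t * g w x y \<partial>M) \<le> (\<integral>w. g w x ((1 - t) *\<^sub>R b + t *\<^sub>R y) \<partial>M)"
      using int x Y in_Y by (intro integral_mono) auto
    then show "- (\<integral>w. g w x ((1 - t) *\<^sub>R b + t *\<^sub>R y) \<partial>M) \<le>
      (1 - t) * - (\<integral>w. g w x b \<partial>M) + t * - (\<integral>w. g w x y \<partial>M)"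
      using int x Y by simp
  qed fact
  show ?thesis
    unfolding convex_concave_lipschitz_def concave_on_def
    using conv conc lip[of _ _ y y for y] lip[of x x for x] ge0 ge0'
    by (auto intro!: lipschitz_onI simp: dist_norm)
qed

lemma convex_concave_lipschitz_average:
  fixes g :: "nat \<Rightarrow> 'x::real_normed_vector \<Rightarrow> 'y::real_normed_vector \<Rightarrow> real"
  assumes "\<And>i. convex_concave_lipschitz X Y lx ly (g i)" "n > 0" "convex X" "convex Y"
  shows "convex_concave_lipschitz X Y lx ly (\<lambda>x y. 1 / real n * (\<Sum>i<n. g i x y))"
proof -
  let ?p = "measure_pmf (pmf_of_set {..<n})"
  have "convex_concave_lipschitz X Y lx ly (\<lambda>x y. \<integral>i. g i x y \<partial>?p)"
    using assms by (intro convex_concave_lipschitz_integral prob_space_measure_pmf integrable_measure_pmf_finite)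
      (auto simp: set_pmf_of_set lessThan_empty_iff)
  also have "(\<lambda>x y. \<integral>i. g i x y \<partial>?p) = (\<lambda>x y. 1 / real n * (\<Sum>i<n. g i x y))"
    using \<open>n > 0\<close> by (simp add: integral_pmf_of_set lessThan_empty_iff)
  finally show ?thesis .
qed

text \<open>The sampling analysis sees only the joint modulus and the continuity of a player's
  regularization and proximal term.\<close>

definition strong_penalty where
  "strong_penalty S \<mu> p \<longleftrightarrow> \<mu> > 0 \<and> strongly_convex_on S \<mu> p \<and> continuous_on S p"

lemma strong_saddle_penalized:
  fixes h :: "'x::real_normed_vector \<Rightarrow> 'y::real_normed_vector \<Rightarrow> real"
  assumes "compact X" "convex X" "X \<noteq> {}" "compact Y" "convex Y" "Y \<noteq> {}"
    and h: "convex_concave_lipschitz X Y lx ly h"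
    and p: "strong_penalty X \<mu> p" and q: "strong_penalty Y \<nu> q"
  shows "strong_saddle X Y \<mu> \<nu> (\<lambda>x y. h x y + p x - q y)"
proof -
  have "continuous_on (X \<times> Y) (\<lambda>v. p (fst v))" "continuous_on (X \<times> Y) (\<lambda>v. q (snd v))"
    using p q by (auto intro!: continuous_on_compose2[of X p _ fst] continuous_on_compose2[of Y q _ snd]
      continuous_on_fst continuous_on_snd continuous_on_id simp: strong_penalty_def)
  then have "continuous_on (X \<times> Y) (\<lambda>(x, y). h x y + p x - q y)"
    using convex_concave_lipschitz_continuous[OF h] unfolding case_prod_unfold
    by (intro continuous_on_add continuous_on_diff)
  moreover have "strongly_convex_on X \<mu> (\<lambda>x. h x y + p x - q y)" if "y \<in> Y" for y
  proof -
    have "strongly_convex_on X (0 + \<mu>) (\<lambda>x. h x y + p x)"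
      using h p that by (intro strongly_convex_on_add convex_on_imp_strongly_convex_on)
        (auto simp: convex_concave_lipschitz_def strong_penalty_def)
    then show ?thesis unfolding strongly_convex_on_def by (simp add: algebra_simps)
  qed
  moreover have "strongly_convex_on Y \<nu> (\<lambda>y. - (h x y + p x - q y))" if "x \<in> X" for x
  proof -
    have "strongly_convex_on Y (0 + \<nu>) (\<lambda>y. - h x y + q y)"
      using h q that by (intro strongly_convex_on_add convex_on_imp_strongly_convex_on)
        (auto simp: convex_concave_lipschitz_def strong_penalty_def concave_on_def)
    then show ?thesis unfolding strongly_convex_on_def by (simp add: algebra_simps)
  qed
  ultimately show ?thesis using assms by (simp add: strong_saddle_def strong_penalty_def)
qed

text \<open>Each objective grows away from its own saddle point. Evaluating either growth inequality
  at the other saddle point and adding them leaves only differences of \<open>u\<close> and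
  \<open>v\<close>, bounded by the Lipschitz-weighted distance. The square of that distance is thus
  at most a multiple of itself.\<close>

lemma saddle_point_stability:
  fixes h1 h2 :: "'x::real_normed_vector \<Rightarrow> 'y::real_normed_vector \<Rightarrow> real"
  assumes h1: "strong_saddle X Y \<mu> \<nu> h1" "saddle_point X Y h1 z1"
    and h2: "strong_saddle X Y \<mu> \<nu> h2" "saddle_point X Y h2 z2"
    and diff: "\<And>x y. x \<in> X \<Longrightarrow> y \<in> Y \<Longrightarrow> h1 x y - h2 x y = \<kappa> * (u x y - v x y)"
    and u: "convex_concave_lipschitz X Y lx ly u" and v: "convex_concave_lipschitz X Y lx ly v"
    and "\<kappa> \<ge> 0"
  shows "lx * norm (fst z2 - fst z1) + ly * norm (snd z2 - snd z1) \<le> 2 * \<kappa> * (lx\<^sup>2 / \<mu> + ly\<^sup>2 / \<nu>)"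
proof -
  have pos: "\<mu> > 0" "\<nu> > 0" using h1 by (auto simp: strong_saddle_def)
  have z: "fst z1 \<in> X" "snd z1 \<in> Y" "fst z2 \<in> X" "snd z2 \<in> Y"
    using h1(2) h2(2) by (auto simp: saddle_point_def)
  have nn: "0 \<le> lx" "0 \<le> ly"
    using u z unfolding convex_concave_lipschitz_def by (auto intro: lipschitz_on_nonneg)
  define a where "a = norm (fst z2 - fst z1)"
  define b where "b = norm (snd z2 - snd z1)"
  define s where "s = lx * a + ly * b"
  define R where "R = lx\<^sup>2 / \<mu> + ly\<^sup>2 / \<nu>"
  have "\<mu> / 2 * a\<^sup>2 + \<nu> / 2 * b\<^sup>2 \<le> h1 (fst z2) (snd z1) - h1 (fst z1) (snd z2)"
    using strong_saddle_growth_gap[OF h1 z(3,4)] by (simp add: a_def b_def)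
  moreover have "\<mu> / 2 * a\<^sup>2 + \<nu> / 2 * b\<^sup>2 \<le> h2 (fst z1) (snd z2) - h2 (fst z2) (snd z1)"
    using strong_saddle_growth_gap[OF h2 z(1,2)] by (simp add: a_def b_def norm_minus_commute)
  ultimately have "\<mu> * a\<^sup>2 + \<nu> * b\<^sup>2 \<le> \<kappa> * ((u (fst z2) (snd z1) - u (fst z1) (snd z2)) +
      (v (fst z1) (snd z2) - v (fst z2) (snd z1)))"
    using diff[OF z(3,2)] diff[OF z(1,4)] by (simp add: algebra_simps)
  also have "\<dots> \<le> \<kappa> * (s + s)"
    using convex_concave_lipschitz_diff_le[OF u z(3,1,2,4)] convex_concave_lipschitz_diff_le[OF v z(1,3,4,2)] \<open>\<kappa> \<ge> 0\<close>
    by (intro mult_left_mono add_mono) (auto simp: s_def a_def b_def norm_minus_commute)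
  finally have le: "\<mu> * a\<^sup>2 + \<nu> * b\<^sup>2 \<le> 2 * \<kappa> * s" by simp
  have "s\<^sup>2 \<le> R * (\<mu> * a\<^sup>2 + \<nu> * b\<^sup>2)"
  proof -
    \<comment> \<open>Cauchy-Schwarz with weights \<mu> and \<nu>; this square is its
      defect.\<close>
    have "0 \<le> (lx * \<nu> * b - ly * \<mu> * a)\<^sup>2 / (\<mu> * \<nu>)" using pos by simp
    also have "\<dots> = R * (\<mu> * a\<^sup>2 + \<nu> * b\<^sup>2) - s\<^sup>2"
      using pos by (simp add: R_def s_def power2_eq_square field_simps)
    finally show ?thesis by simp
  qed
  also have "\<dots> \<le> R * (2 * \<kappa> * s)" using pos le by (intro mult_left_mono) (auto simp: R_def)
  finally have "s * s \<le> (2 * \<kappa> * R) * s" by (simp add: power2_eq_square mult_ac)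
  moreover have "s \<ge> 0" "R \<ge> 0" using nn pos by (auto simp: s_def a_def b_def R_def)
  ultimately have "s \<le> 2 * \<kappa> * R" using \<open>\<kappa> \<ge> 0\<close> by (cases "s = 0") auto
  then show ?thesis by (simp add: s_def a_def b_def R_def)
qed

section \<open>Batches that are good with probability at least two thirds\<close>

lemma (in prob_space) prob_le_of_expectation_le:
  fixes u :: "'a \<Rightarrow> real"
  assumes "integrable M u" "\<And>x. x \<in> space M \<Longrightarrow> 0 \<le> u x" "expectation u \<le> \<eta> / 3" "\<eta> > 0"
  shows "prob {x \<in> space M. u x \<le> \<eta>} \<ge> 2 / 3"
proof -
  have [measurable]: "u \<in> borel_measurable M" using assms by auto
  have "prob {x \<in> space M. u x \<ge> \<eta>} \<le> expectation u / \<eta>"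
    using assms by (intro integral_Markov_inequality_measure[of _ _ "space M"]) auto
  also have "\<dots> \<le> 1 / 3" using assms by (simp add: field_simps)
  finally have "prob {x \<in> space M. u x \<ge> \<eta>} \<le> 1 / 3" .
  moreover have "prob (space M - {x \<in> space M. u x \<le> \<eta>}) \<le> prob {x \<in> space M. u x \<ge> \<eta>}"
    by (intro finite_measure_mono) auto
  ultimately show ?thesis by (subst (asm) prob_compl) auto
qed

lemma measurable_PiM_sample:
  assumes "i \<in> I" "g \<in> measurable M N"
  shows "(\<lambda>\<omega>. g (\<omega> i)) \<in> measurable (Pi\<^sub>M I (\<lambda>_. M)) N"
  using measurable_component_singleton[OF assms(1)] assms(2) by (rule measurable_compose)

context prob_space
begin

text \<open>Integrating out the last sample first makes the cross term vanish because the mean is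
  zero, so the second moments add up by induction.\<close>

lemma centered_sum_second_moment:
  fixes g :: "'a \<Rightarrow> 'v::euclidean_space"
  assumes g [measurable]: "g \<in> borel_measurable M" and mean: "(\<integral>\<xi>. g \<xi> \<partial>M) = 0"
    and bd: "\<And>\<xi>. norm (g \<xi>) \<le> B"
  shows "(\<integral>\<omega>. (norm (\<Sum>i<n. g (\<omega> i)))\<^sup>2 \<partial>Pi\<^sub>M {..<n} (\<lambda>_. M)) \<le> real n * B\<^sup>2"
proof (induction n)
  case (Suc n)
  let ?P = "\<lambda>I. Pi\<^sub>M I (\<lambda>_::nat. M)"
  interpret pr: product_sigma_finite "\<lambda>_::nat. M" by unfold_locales
  interpret Pn: prob_space "?P {..<n}" by (rule prob_space_power)
  interpret PS: prob_space "?P {..<Suc n}" by (rule prob_space_power)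
  have B: "B \<ge> 0" using bd norm_ge_zero order_trans by blast
  have gi: "integrable M g" by (rule integrable_const_bound[of _ B]) (auto simp: bd)
  have gi2: "integrable M (\<lambda>\<xi>. (norm (g \<xi>))\<^sup>2)"
    by (rule integrable_const_bound[of _ "B\<^sup>2"]) (auto intro!: power_mono bd)
  have sum_meas: "(\<lambda>\<omega>. \<Sum>i<k. g (\<omega> i)) \<in> borel_measurable (?P {..<k})" for k
    by (intro borel_measurable_sum measurable_PiM_sample g) auto
  have sum_bd: "(norm (\<Sum>i<k. g (\<omega> i)))\<^sup>2 \<le> (real k * B)\<^sup>2" for k \<omega>
  proof (rule power_mono)
    show "norm (\<Sum>i<k. g (\<omega> i)) \<le> real k * B"
      using sum_norm_le[of "{..<k}" "\<lambda>i. g (\<omega> i)" "\<lambda>_. B"] bd by simp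
  qed simp
  have int: "integrable (?P {..<k}) (\<lambda>\<omega>. (norm (\<Sum>i<k. g (\<omega> i)))\<^sup>2)" for k
  proof -
    interpret Pk: prob_space "?P {..<k}" by (rule prob_space_power)
    show ?thesis
      by (rule Pk.integrable_const_bound[of _ "(real k * B)\<^sup>2"])
        (use sum_bd in \<open>auto intro!: borel_measurable_power borel_measurable_norm sum_meas\<close>)
  qed
  have ins: "{..<Suc n} = insert n {..<n}" by auto
  have "(\<integral>\<omega>. (norm (\<Sum>i<Suc n. g (\<omega> i)))\<^sup>2 \<partial>?P {..<Suc n}) =
      (\<integral>\<omega>. (\<integral>\<xi>. (norm (\<Sum>i<Suc n. g (fun_upd \<omega> n \<xi> i)))\<^sup>2 \<partial>M) \<partial>?P {..<n})"
    using int[of "Suc n"] unfolding ins by (intro pr.product_integral_insert) auto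
  also have "\<dots> = (\<integral>\<omega>. (norm (\<Sum>i<n. g (\<omega> i)))\<^sup>2 + (\<integral>\<xi>. (norm (g \<xi>))\<^sup>2 \<partial>M) \<partial>?P {..<n})"
  proof (rule Bochner_Integration.integral_cong[OF refl])
    fix \<omega>
    let ?S = "\<Sum>i<n. g (\<omega> i)"
    have "(norm (\<Sum>i<Suc n. g (fun_upd \<omega> n \<xi> i)))\<^sup>2 = (norm ?S)\<^sup>2 + 2 * (?S \<bullet> g \<xi>) + (norm (g \<xi>))\<^sup>2" for \<xi>
    proof -
      have "(\<Sum>i<Suc n. g (fun_upd \<omega> n \<xi> i)) = ?S + g \<xi>" by simp
      then show ?thesis
        by (simp add: power2_norm_eq_inner inner_add_left inner_add_right inner_commute)
    qed
    then have "(\<integral>\<xi>. (norm (\<Sum>i<Suc n. g (fun_upd \<omega> n \<xi> i)))\<^sup>2 \<partial>M) =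
      (\<integral>\<xi>. (norm ?S)\<^sup>2 + 2 * (?S \<bullet> g \<xi>) + (norm (g \<xi>))\<^sup>2 \<partial>M)" by simp
    also have "\<dots> = (norm ?S)\<^sup>2 + 2 * (?S \<bullet> (\<integral>\<xi>. g \<xi> \<partial>M)) + (\<integral>\<xi>. (norm (g \<xi>))\<^sup>2 \<partial>M)"
      using gi gi2 by (simp add: prob_space)
    finally show "(\<integral>\<xi>. (norm (\<Sum>i<Suc n. g (fun_upd \<omega> n \<xi> i)))\<^sup>2 \<partial>M) =
      (norm ?S)\<^sup>2 + (\<integral>\<xi>. (norm (g \<xi>))\<^sup>2 \<partial>M)" by (simp add: mean)
  qed
  also have "\<dots> = (\<integral>\<omega>. (norm (\<Sum>i<n. g (\<omega> i)))\<^sup>2 \<partial>?P {..<n}) + (\<integral>\<xi>. (norm (g \<xi>))\<^sup>2 \<partial>M)"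
    using int[of n] by (simp add: Pn.prob_space)
  also have "(\<integral>\<xi>. (norm (g \<xi>))\<^sup>2 \<partial>M) \<le> B\<^sup>2"
    by (rule integral_le_const[OF gi2]) (auto intro!: power_mono bd)
  finally show ?case using Suc.IH by (simp add: algebra_simps)
qed simp

text \<open>A function bounded by \<open>B\<close> deviates from its mean by at most
  \<open>2 * B\<close>, so the mean square error of the average is at most 4 B^2 / n, and the
  required size makes this a third of the squared tolerance. For \<open>B = lx\<close> the deviation
  bound is the parameter \<open>sig_x\<close>.\<close>

lemma sample_mean_near:
  fixes g :: "'a \<Rightarrow> 'v::euclidean_space"
  assumes g [measurable]: "g \<in> borel_measurable M" and bd: "\<And>\<xi>. norm (g \<xi>) \<le> B"
    and "\<eta> > 0" "n > 0" and n: "real n \<ge> 3 * (2 * B)\<^sup>2 / \<eta>\<^sup>2"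
  shows "{\<omega> \<in> space (Pi\<^sub>M {..<n} (\<lambda>_. M)).
      norm ((1 / real n) *\<^sub>R (\<Sum>i<n. g (\<omega> i)) - (\<integral>\<xi>. g \<xi> \<partial>M)) \<le> \<eta>} \<in> sets (Pi\<^sub>M {..<n} (\<lambda>_. M)) \<and>
    measure (Pi\<^sub>M {..<n} (\<lambda>_. M)) {\<omega> \<in> space (Pi\<^sub>M {..<n} (\<lambda>_. M)).
      norm ((1 / real n) *\<^sub>R (\<Sum>i<n. g (\<omega> i)) - (\<integral>\<xi>. g \<xi> \<partial>M)) \<le> \<eta>} \<ge> 2 / 3"
proof -
  let ?P = "Pi\<^sub>M {..<n} (\<lambda>_. M)"
  interpret Pn: prob_space ?P by (rule prob_space_power)
  define m where "m = (\<integral>\<xi>. g \<xi> \<partial>M)"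
  have gi: "integrable M g" by (rule integrable_const_bound[of _ B]) (auto simp: bd)
  have B: "B \<ge> 0" using bd norm_ge_zero order_trans by blast
  have mB: "norm m \<le> B"
  proof -
    have "norm m \<le> (\<integral>\<xi>. norm (g \<xi>) \<partial>M)" unfolding m_def by (rule integral_norm_bound)
    also have "\<dots> \<le> B" using gi bd by (intro integral_le_const) auto
    finally show ?thesis .
  qed
  have cbd: "norm (g \<xi> - m) \<le> 2 * B" for \<xi>
    using norm_triangle_ineq4[of "g \<xi>" m] bd[of \<xi>] mB by simp
  have dev: "(1 / real n) *\<^sub>R (\<Sum>i<n. g (\<omega> i)) - m = (1 / real n) *\<^sub>R (\<Sum>i<n. g (\<omega> i) - m)" for \<omega>
    using \<open>n > 0\<close> by (simp add: sum_subtractf scaleR_diff_right sum_constant_scaleR)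
  define u where "u \<omega> = (norm ((1 / real n) *\<^sub>R (\<Sum>i<n. g (\<omega> i)) - m))\<^sup>2" for \<omega>
  have "(\<lambda>\<omega>. \<Sum>i<n. g (\<omega> i)) \<in> borel_measurable ?P"
    by (intro borel_measurable_sum measurable_PiM_sample g) auto
  then have sm: "(\<lambda>\<omega>. (1 / real n) *\<^sub>R (\<Sum>i<n. g (\<omega> i)) - m) \<in> borel_measurable ?P"
    by measurable
  have um: "u \<in> borel_measurable ?P" unfolding u_def using sm by measurable
  have u_eq: "u \<omega> = (norm (\<Sum>i<n. g (\<omega> i) - m))\<^sup>2 / (real n)\<^sup>2" for \<omega>
    unfolding u_def dev by (simp add: power_mult_distrib power_divide)
  have "norm (\<Sum>i<n. g (\<omega> i) - m) \<le> real n * (2 * B)" for \<omega>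
    using sum_norm_le[of "{..<n}" "\<lambda>i. g (\<omega> i) - m" "\<lambda>_. 2 * B"] cbd by simp
  then have ubd: "u \<omega> \<le> (real n * (2 * B))\<^sup>2 / (real n)\<^sup>2" for \<omega>
    unfolding u_eq by (intro divide_right_mono power_mono) auto
  have u0: "0 \<le> u \<omega>" for \<omega> by (simp add: u_def)
  have ui: "integrable ?P u"
    by (rule Pn.integrable_const_bound[OF _ um, of "(real n * (2 * B))\<^sup>2 / (real n)\<^sup>2"])
      (use ubd in \<open>auto simp: u_def\<close>)
  have "(\<integral>\<xi>. g \<xi> - m \<partial>M) = 0" using gi by (simp add: m_def prob_space)
  then have "(\<integral>\<omega>. (norm (\<Sum>i<n. g (\<omega> i) - m))\<^sup>2 \<partial>?P) \<le> real n * (2 * B)\<^sup>2"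
    by (intro centered_sum_second_moment cbd) auto
  then have "Pn.expectation u \<le> real n * (2 * B)\<^sup>2 / (real n)\<^sup>2"
    unfolding u_eq by (simp add: divide_right_mono)
  also have "\<dots> \<le> \<eta>\<^sup>2 / 3"
    using n \<open>n > 0\<close> \<open>\<eta> > 0\<close> by (simp add: field_simps power2_eq_square)
  finally have "Pn.prob {\<omega> \<in> space ?P. u \<omega> \<le> \<eta>\<^sup>2} \<ge> 2 / 3"
    using \<open>\<eta> > 0\<close> u0 by (intro Pn.prob_le_of_expectation_le ui) auto
  moreover have "u \<omega> \<le> \<eta>\<^sup>2 \<longleftrightarrow> norm ((1 / real n) *\<^sub>R (\<Sum>i<n. g (\<omega> i)) - m) \<le> \<eta>" for \<omega>
    unfolding u_def using \<open>\<eta> > 0\<close> by (auto simp: abs_le_square_iff[symmetric])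
  ultimately show ?thesis using sm unfolding m_def by (auto intro!: borel_measurable_le)
qed

end

section \<open>Sample average approximation\<close>

lemma
  fixes z :: "'w \<Rightarrow> 'a::topological_space \<times> 'b::topological_space"
  assumes "z \<in> borel_measurable M"
  shows borel_measurable_fst_compose: "(\<lambda>w. fst (z w)) \<in> borel_measurable M"
    and borel_measurable_snd_compose: "(\<lambda>w. snd (z w)) \<in> borel_measurable M"
  by (rule measurable_compose[OF assms borel_measurable_continuous_onI[OF continuous_on_fst[OF continuous_on_id]]],
      rule measurable_compose[OF assms borel_measurable_continuous_onI[OF continuous_on_snd[OF continuous_on_id]]])

text \<open>Regularity is demanded at every \<open>\<xi>\<close>: the solution of a batch is a
  definite description, and with a saddle point for each sample vector it is a measurable function
  without exceptional sets.\<close>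

locale sampled_saddle_problem = prob_space P for P :: "'s measure" +
  fixes X :: "'x::euclidean_space set" and Y :: "'y::euclidean_space set"
    and f :: "'s \<Rightarrow> 'x \<Rightarrow> 'y \<Rightarrow> real" and lx ly :: real
  assumes X: "compact X" "convex X" "X \<noteq> {}" and Y: "compact Y" "convex Y" "Y \<noteq> {}"
    and f_cc: "\<And>\<xi>. convex_concave_lipschitz X Y lx ly (f \<xi>)"
    and f_integrable: "\<And>x y. x \<in> X \<Longrightarrow> y \<in> Y \<Longrightarrow> integrable P (\<lambda>\<xi>. f \<xi> x y)"
begin

abbreviation \<Phi> where "\<Phi> \<equiv> expected_objective P f"

definition empirical where
  "empirical n p q \<xi> = (\<lambda>x y. 1 / real n * (\<Sum>i<n. f (\<xi> i) x y) + p x - q y)"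

definition saa where
  "saa n p q \<xi> = (THE z. saddle_point X Y (empirical n p q \<xi>) z)"

lemma lip_nonneg: "lx \<ge> 0" "ly \<ge> 0"
  using f_cc X(3) Y(3) unfolding convex_concave_lipschitz_def by (meson lipschitz_on_nonneg ex_in_conv)+

lemma \<Phi>_cc: "convex_concave_lipschitz X Y lx ly \<Phi>"
  using convex_concave_lipschitz_integral[OF prob_space_axioms f_cc f_integrable X(2) Y(2)]
  by (simp add: expected_objective_def[abs_def])

lemma strong_saddle_population:
  assumes "strong_penalty X \<mu> p" "strong_penalty Y \<nu> q"
  shows "strong_saddle X Y \<mu> \<nu> (\<lambda>x y. \<Phi> x y + p x - q y)"
  by (rule strong_saddle_penalized[OF X Y \<Phi>_cc assms])

lemma strong_saddle_empirical:
  assumes "strong_penalty X \<mu> p" "strong_penalty Y \<nu> q" "n > 0"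
  shows "strong_saddle X Y \<mu> \<nu> (empirical n p q \<xi>)"
  unfolding empirical_def
  by (rule strong_saddle_penalized[OF X Y convex_concave_lipschitz_average[where g = "\<lambda>i. f (\<xi> i)",
        OF f_cc assms(3) X(2) Y(2)] assms(1,2)])

lemma saa_saddle_point:
  assumes "strong_penalty X \<mu> p" "strong_penalty Y \<nu> q" "n > 0"
  shows "saddle_point X Y (empirical n p q \<xi>) (saa n p q \<xi>)"
  unfolding saa_def by (rule strong_saddle_the[OF strong_saddle_empirical[OF assms]])

lemma saa_in:
  assumes "strong_penalty X \<mu> p" "strong_penalty Y \<nu> q" "n > 0"
  shows "saa n p q \<xi> \<in> X \<times> Y"
  using saa_saddle_point[OF assms, of \<xi>] by (auto simp: saddle_point_def mem_Times_iff)

lemma saa_cong: "(\<And>i. i < n \<Longrightarrow> \<xi> i = \<xi>' i) \<Longrightarrow> saa n p q \<xi> = saa n p q \<xi>'"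
  by (simp add: saa_def empirical_def)

lemma strong_saddle_continuous:
  "strong_saddle X Y \<mu> \<nu> h \<Longrightarrow> continuous_on (X \<times> Y) (\<lambda>v. h (fst v) (snd v))"
  by (simp add: strong_saddle_def case_prod_unfold)

text \<open>The penalties vary with the outcome as the samples do, because the centers are
  themselves results of earlier stages.\<close>

lemma saa_measurable:
  assumes p: "\<And>w. strong_penalty X \<mu> (p w)" and q: "\<And>w. strong_penalty Y \<nu> (q w)" and "n > 0"
    and pm: "\<And>x. x \<in> X \<Longrightarrow> (\<lambda>w. p w x) \<in> borel_measurable M"
    and qm: "\<And>y. y \<in> Y \<Longrightarrow> (\<lambda>w. q w y) \<in> borel_measurable M"
    and fm: "\<And>i x y. i < n \<Longrightarrow> x \<in> X \<Longrightarrow> y \<in> Y \<Longrightarrow> (\<lambda>w. f (\<zeta> w i) x y) \<in> borel_measurable M"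
  shows "(\<lambda>w. saa n (p w) (q w) (\<zeta> w)) \<in> borel_measurable M"
proof (rule measurable_unique_saddle_point[OF X(1) Y(1), where F = "\<lambda>w. empirical n (p w) (q w) (\<zeta> w)"])
  note S = strong_saddle_empirical[OF p q \<open>n > 0\<close>]
  show "(\<lambda>w. empirical n (p w) (q w) (\<zeta> w) x y) \<in> borel_measurable M" if "x \<in> X" "y \<in> Y" for x y
    unfolding empirical_def using that
    by (intro borel_measurable_add borel_measurable_diff borel_measurable_times borel_measurable_const
        borel_measurable_sum pm qm fm) auto
  show "continuous_on (X \<times> Y) (\<lambda>v. empirical n (p w) (q w) (\<zeta> w) (fst v) (snd v))" for w
    by (rule strong_saddle_continuous[OF S])
  show "saddle_point X Y (empirical n (p w) (q w) (\<zeta> w)) (saa n (p w) (q w) (\<zeta> w))" for w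
    by (rule saa_saddle_point[OF p q \<open>n > 0\<close>])
  show "z = saa n (p w) (q w) (\<zeta> w)" if "saddle_point X Y (empirical n (p w) (q w) (\<zeta> w)) z" for w z
    by (rule strong_saddle_unique[OF S that saa_saddle_point[OF p q \<open>n > 0\<close>]])
qed

lemma f_measurable: "x \<in> X \<Longrightarrow> y \<in> Y \<Longrightarrow> (\<lambda>\<xi>. f \<xi> x y) \<in> borel_measurable P"
  using f_integrable by auto

lemma continuous_on_f: "continuous_on (X \<times> Y) (\<lambda>v. f \<xi> (fst v) (snd v))"
  using convex_concave_lipschitz_continuous[OF f_cc] by (simp add: case_prod_unfold)

lemma measurable_f_compose:
  assumes "\<zeta> \<in> measurable M P" "z \<in> borel_measurable M" "\<And>w. w \<in> space M \<Longrightarrow> z w \<in> X \<times> Y"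
  shows "(\<lambda>w. f (\<zeta> w) (fst (z w)) (snd (z w))) \<in> borel_measurable M"
  by (rule measurable_Caratheodory[where g = "\<lambda>w v. f (\<zeta> w) (fst v) (snd v)" and Z = "X \<times> Y"])
    (use assms continuous_on_f in \<open>auto intro!: measurable_compose[OF assms(1)] f_measurable\<close>)

lemma strong_penalty_bounded: "strong_penalty S \<mu> p \<Longrightarrow> compact S \<Longrightarrow> \<exists>B. \<forall>x\<in>S. \<bar>p x\<bar> \<le> B"
  using compact_imp_bounded[OF compact_continuous_image[of S p]]
  by (auto simp: strong_penalty_def bounded_iff)

text \<open>Exchanging a sample with an independent one moves the saddle point only a little, while the
  average over the exchanged samples of the empirical gap is nonpositive.\<close>

lemma saa_expected_gap:
  assumes p: "strong_penalty X \<mu> p" and q: "strong_penalty Y \<nu> q" and n: "n > 0"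
    and x: "x \<in> X" and y: "y \<in> Y"
  defines "gap \<equiv> \<lambda>\<xi>. (\<Phi> (fst (saa n p q \<xi>)) y + p (fst (saa n p q \<xi>)) - q y) -
    (\<Phi> x (snd (saa n p q \<xi>)) + p x - q (snd (saa n p q \<xi>)))"
  shows "integrable (Pi\<^sub>M {..<n} (\<lambda>_. P)) gap"
    and "(\<integral>\<xi>. gap \<xi> \<partial>Pi\<^sub>M {..<n} (\<lambda>_. P)) \<le> 2 / real n * (lx\<^sup>2 / \<mu> + ly\<^sup>2 / \<nu>)"
proof -
  let ?P = "\<lambda>I. Pi\<^sub>M I (\<lambda>_::nat. P)"
  interpret pr: product_sigma_finite "\<lambda>_::nat. P" by unfold_locales
  \<comment> \<open>Indices below \<open>n\<close> form the batch; index \<open>n\<close> is an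
    independent fresh sample.\<close>
  define N where "N = ?P {..n}"
  interpret Pn: prob_space "?P {..<n}" by (rule prob_space_power)
  interpret N: prob_space N unfolding N_def by (rule prob_space_power)
  let ?z = "saa n p q"
  have zin: "fst (?z \<xi>) \<in> X" "snd (?z \<xi>) \<in> Y" for \<xi>
    using saa_in[OF p q n, of \<xi>] by (auto simp: mem_Times_iff)
  have zm: "?z \<in> borel_measurable (?P I)" if "{..<n} \<subseteq> I" for I
  proof (rule saa_measurable[where p = "\<lambda>_. p" and q = "\<lambda>_. q", OF p q n])
    show "(\<lambda>\<xi>. f (\<xi> i) a b) \<in> borel_measurable (?P I)" if "i < n" "a \<in> X" "b \<in> Y" for i a b
      by (rule measurable_PiM_sample[where g = "\<lambda>s. f s a b"])
        (use that \<open>{..<n} \<subseteq> I\<close> f_measurable in auto)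
  qed auto
  have zm_fst: "(\<lambda>\<xi>. fst (?z \<xi>)) \<in> borel_measurable (?P I)"
    and zm_snd: "(\<lambda>\<xi>. snd (?z \<xi>)) \<in> borel_measurable (?P I)" if "{..<n} \<subseteq> I" for I
    by (rule borel_measurable_fst_compose[OF zm[OF that]], rule borel_measurable_snd_compose[OF zm[OF that]])
  obtain Bp Bq where Bp: "\<And>x. x \<in> X \<Longrightarrow> \<bar>p x\<bar> \<le> Bp" and Bq: "\<And>y. y \<in> Y \<Longrightarrow> \<bar>q y\<bar> \<le> Bq"
    using strong_penalty_bounded[OF p X(1)] strong_penalty_bounded[OF q Y(1)] by blast
  define r where "r \<xi> = p (fst (?z \<xi>)) - q y - p x + q (snd (?z \<xi>))" for \<xi>
  have pm: "(\<lambda>\<xi>. p (fst (?z \<xi>))) \<in> borel_measurable (?P I)" if "{..<n} \<subseteq> I" for I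
    by (rule measurable_Caratheodory[where g = "\<lambda>w. p" and Z = X])
      (use p zin zm_fst[OF that] in \<open>auto simp: strong_penalty_def\<close>)
  have qm: "(\<lambda>\<xi>. q (snd (?z \<xi>))) \<in> borel_measurable (?P I)" if "{..<n} \<subseteq> I" for I
    by (rule measurable_Caratheodory[where g = "\<lambda>w. q" and Z = Y])
      (use q zin zm_snd[OF that] in \<open>auto simp: strong_penalty_def\<close>)
  have r_int: "integrable (?P I) r" if "{..<n} \<subseteq> I" for I
  proof -
    interpret PI': prob_space "?P I" by (rule prob_space_power)
    have "\<bar>r \<xi>\<bar> \<le> 2 * Bp + 2 * Bq" for \<xi>
      using Bp[OF zin(1)[of \<xi>]] Bq[OF zin(2)[of \<xi>]] Bp[OF x] Bq[OF y] unfolding r_def by linarith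
    then show ?thesis
      unfolding r_def using pm[OF that] qm[OF that]
      by (intro PI'.integrable_const_bound[of _ "2 * Bp + 2 * Bq"] borel_measurable_add borel_measurable_diff)
        (auto simp: r_def)
  qed
  \<comment> \<open>The part of the gap that depends on the sample at which it is evaluated;
    \<open>r\<close> collects the penalties, which do not.\<close>
  define D where "D z s = f s (fst z) y - f s x (snd z)" for z s
  define B where "B = lx * diameter X + ly * diameter Y"
  have D_bd: "\<bar>D (?z \<xi>) s\<bar> \<le> B" for \<xi> s
  proof -
    have "\<bar>D (?z \<xi>) s\<bar> \<le> lx * norm (fst (?z \<xi>) - x) + ly * norm (y - snd (?z \<xi>))"
      unfolding D_def by (rule convex_concave_lipschitz_diff_le[OF f_cc zin(1) x y zin(2)])
    also have "\<dots> \<le> B"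
      unfolding B_def using X Y zin[of \<xi>] x y lip_nonneg
      by (intro add_mono mult_left_mono)
        (auto simp: dist_norm[symmetric] intro!: diameter_bounded_bound compact_imp_bounded)
    finally show ?thesis .
  qed
  have D_meas: "(\<lambda>w. D (?z (\<tau> w)) (\<zeta> w)) \<in> borel_measurable M'"
    if \<zeta>: "\<zeta> \<in> measurable M' P" and \<tau>: "\<tau> \<in> measurable M' (?P I)" and I: "{..<n} \<subseteq> I" for \<zeta> \<tau> I and M' :: "'w measure"
  proof -
    have 1: "(\<lambda>w. (fst (?z (\<tau> w)), y)) \<in> borel_measurable M'" "(\<lambda>w. (x, snd (?z (\<tau> w)))) \<in> borel_measurable M'"
      using measurable_compose[OF \<tau> zm_fst[OF I]] measurable_compose[OF \<tau> zm_snd[OF I]]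
      by (auto intro!: borel_measurable_Pair)
    have "(\<lambda>w. f (\<zeta> w) (fst (?z (\<tau> w))) y) \<in> borel_measurable M'"
      using measurable_f_compose[OF \<zeta> 1(1)] zin y by simp
    moreover have "(\<lambda>w. f (\<zeta> w) x (snd (?z (\<tau> w)))) \<in> borel_measurable M'"
      using measurable_f_compose[OF \<zeta> 1(2)] zin x by simp
    ultimately show ?thesis unfolding D_def by (rule borel_measurable_diff)
  qed
  have idN: "(\<lambda>w. w) \<in> measurable N (?P {..n})" by (simp add: N_def)
  have comp: "(\<lambda>w. w i) \<in> measurable N P" if "i \<le> n" for i
    unfolding N_def using that by (intro measurable_component_singleton) auto
  have sub: "{..<n} \<subseteq> {..n}" by auto
  have DN_int: "integrable N (\<lambda>w. D (?z (\<tau> w)) (w i))" if "\<tau> \<in> measurable N (?P {..n})" "i \<le> n" for \<tau> i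
    using D_bd by (intro N.integrable_const_bound[of _ B] D_meas[OF comp[OF that(2)] that(1) sub]) auto
  have gap_eq: "gap \<xi> = (\<integral>s. D (?z \<xi>) s \<partial>P) + r \<xi>" for \<xi>
  proof -
    have "(\<integral>s. D (?z \<xi>) s \<partial>P) = \<Phi> (fst (?z \<xi>)) y - \<Phi> x (snd (?z \<xi>))"
      unfolding D_def expected_objective_def using f_integrable zin x y
      by (intro Bochner_Integration.integral_diff) auto
    then show ?thesis by (simp add: gap_def r_def)
  qed
  have Di: "integrable P (D (?z \<xi>))" for \<xi>
    unfolding D_def using f_integrable zin x y by auto
  have gap_bd: "\<bar>\<integral>s. D (?z \<xi>) s \<partial>P\<bar> \<le> B" for \<xi>
  proof -
    have "\<bar>\<integral>s. D (?z \<xi>) s \<partial>P\<bar> \<le> (\<integral>s. \<bar>D (?z \<xi>) s\<bar> \<partial>P)"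
      using integral_norm_bound[of P "D (?z \<xi>)"] by simp
    also have "\<dots> \<le> B" using Di D_bd by (intro integral_le_const) auto
    finally show ?thesis .
  qed
  have "(\<lambda>w. D (?z (fst w)) (snd w)) \<in> borel_measurable (?P {..<n} \<Otimes>\<^sub>M P)"
    by (rule D_meas[OF measurable_snd measurable_fst]) simp
  then have "(\<lambda>\<xi>. \<integral>s. D (?z \<xi>) s \<partial>P) \<in> borel_measurable (?P {..<n})"
    by (intro borel_measurable_lebesgue_integral) (simp add: case_prod_unfold)
  then have I1: "integrable (?P {..<n}) (\<lambda>\<xi>. \<integral>s. D (?z \<xi>) s \<partial>P)"
    using gap_bd by (intro Pn.integrable_const_bound[of _ B]) auto
  show "integrable (?P {..<n}) gap"
    unfolding gap_eq[abs_def] using I1 r_int by (intro Bochner_Integration.integrable_add) auto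
  have ins: "{..n} = insert n {..<n}" by auto
  have G_int: "integrable N (\<lambda>w. D (?z w) (w n) + r w)"
    using DN_int[OF idN, of n] r_int[OF sub] by (simp add: N_def)
  \<comment> \<open>The solution reads only indices below \<open>n\<close>, so integration over
    index \<open>n\<close> evaluates it at an independent sample.\<close>
  have zupd: "?z (fun_upd \<xi> n s) = ?z \<xi>" for \<xi> s by (rule saa_cong) auto
  have rupd: "r (fun_upd \<xi> n s) = r \<xi>" for \<xi> s by (simp add: r_def zupd)
  have "(\<integral>w. D (?z w) (w n) + r w \<partial>N) = (\<integral>\<xi>. (\<integral>s. D (?z \<xi>) s + r \<xi> \<partial>P) \<partial>?P {..<n})"
    using G_int unfolding N_def ins
    by (subst pr.product_integral_insert) (auto simp: zupd rupd)
  also have "\<dots> = (\<integral>\<xi>. gap \<xi> \<partial>?P {..<n})"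
    unfolding gap_eq using Di by (simp add: prob_space)
  finally have eq1: "(\<integral>\<xi>. gap \<xi> \<partial>?P {..<n}) = (\<integral>w. D (?z w) (w n) \<partial>N) + (\<integral>w. r w \<partial>N)"
    using DN_int[OF idN, of n] r_int[OF sub] by (simp add: N_def)
  \<comment> \<open>Transposing \<open>i\<close> and \<open>n\<close> preserves the law. It turns
    the error at the fresh sample into the error at sample \<open>i\<close> of the solution of a
    batch in which that sample has been replaced.\<close>
  define \<tau> where "\<tau> i w = (\<lambda>k\<in>{..n}. w (Transposition.transpose i n k))" for i and w :: "nat \<Rightarrow> 's"
  have tr: "Transposition.transpose i n k \<in> {..n}" if "i < n" "k \<in> {..n}" for i k
    using that by (auto simp: Transposition.transpose_def)
  have \<tau>m: "\<tau> i \<in> measurable N (?P {..n})" if "i < n" for i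
    unfolding \<tau>_def by (intro measurable_restrict comp) (use tr[OF that] in auto)
  have \<tau>d: "distr N (?P {..n}) (\<tau> i) = ?P {..n}" if "i < n" for i
    unfolding \<tau>_def N_def
    by (rule distr_PiM_reindex[where M = "\<lambda>_. P"])
      (use tr[OF that] in \<open>auto intro: prob_space_axioms inj_on_subset[OF inj_transpose]\<close>)
  have \<tau>n: "\<tau> i w n = w i" for i w by (simp add: \<tau>_def)
  have swap: "(\<integral>w. D (?z w) (w n) \<partial>N) = (\<integral>w. D (?z (\<tau> i w)) (w i) \<partial>N)" if "i < n" for i
  proof -
    have "(\<integral>w. D (?z w) (w n) \<partial>N) = (\<integral>w. D (?z w) (w n) \<partial>distr N (?P {..n}) (\<tau> i))"
      unfolding \<tau>d[OF that] by (simp only: N_def)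
    also have "\<dots> = (\<integral>w. D (?z (\<tau> i w)) (\<tau> i w n) \<partial>N)"
      using D_meas[OF comp[of n] idN sub] by (intro integral_distr[OF \<tau>m[OF that]]) (simp add: N_def)
    finally show ?thesis by (simp add: \<tau>n)
  qed
  let ?\<beta> = "2 / real n * (lx\<^sup>2 / \<mu> + ly\<^sup>2 / \<nu>)"
  \<comment> \<open>Undoing the replacement changes the average by \<open>1 / n\<close> times the
    difference of two samples, and \<open>saddle_point_stability\<close> bounds the effect on the
    solution in exactly the Lipschitz-weighted distance by which \<open>D\<close> can
    change.\<close>
  have stab: "D (?z (\<tau> i w)) (w i) \<le> D (?z w) (w i) + ?\<beta>" if "i < n" for i w
  proof -
    have diff: "empirical n p q w a b - empirical n p q (\<tau> i w) a b = 1 / real n * (f (w i) a b - f (w n) a b)" for a b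
    proof -
      have "(\<Sum>k<n. f (w k) a b) - (\<Sum>k<n. f (\<tau> i w k) a b) = (\<Sum>k<n. f (w k) a b - f (\<tau> i w k) a b)"
        by (simp add: sum_subtractf)
      also have "\<dots> = (\<Sum>k<n. if k = i then f (w i) a b - f (w n) a b else 0)"
        using that by (intro sum.cong) (auto simp: \<tau>_def Transposition.transpose_def)
      also have "\<dots> = f (w i) a b - f (w n) a b" using that by simp
      finally have eq: "(\<Sum>k<n. f (w k) a b) - (\<Sum>k<n. f (\<tau> i w k) a b) = f (w i) a b - f (w n) a b" .
      show ?thesis unfolding eq[symmetric] by (simp add: empirical_def right_diff_distrib)
    qed
    have "lx * norm (fst (?z (\<tau> i w)) - fst (?z w)) + ly * norm (snd (?z (\<tau> i w)) - snd (?z w)) \<le>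
        2 * (1 / real n) * (lx\<^sup>2 / \<mu> + ly\<^sup>2 / \<nu>)"
      by (rule saddle_point_stability[OF strong_saddle_empirical[OF p q n] saa_saddle_point[OF p q n]
            strong_saddle_empirical[OF p q n] saa_saddle_point[OF p q n] diff f_cc f_cc]) simp
    moreover have "f (w i) (fst (?z (\<tau> i w))) y - f (w i) (fst (?z w)) y \<le> lx * norm (fst (?z (\<tau> i w)) - fst (?z w))"
      using convex_concave_lipschitz_diff_le[OF f_cc zin(1)[of "\<tau> i w"] zin(1)[of w] y y] abs_le_D1 by fastforce
    moreover have "f (w i) x (snd (?z w)) - f (w i) x (snd (?z (\<tau> i w))) \<le> ly * norm (snd (?z (\<tau> i w)) - snd (?z w))"
      using convex_concave_lipschitz_diff_le[OF f_cc x x zin(2)[of w] zin(2)[of "\<tau> i w"]] abs_le_D1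
      by (fastforce simp: norm_minus_commute)
    ultimately show ?thesis unfolding D_def by simp
  qed
  have "(\<integral>w. D (?z w) (w n) \<partial>N) = 1 / real n * (\<Sum>i<n. \<integral>w. D (?z w) (w n) \<partial>N)" using n by simp
  also have "\<dots> = 1 / real n * (\<Sum>i<n. \<integral>w. D (?z (\<tau> i w)) (w i) \<partial>N)"
    using swap by (intro arg_cong2[where f = "(*)"] sum.cong) auto
  also have "\<dots> \<le> 1 / real n * (\<Sum>i<n. (\<integral>w. D (?z w) (w i) + ?\<beta> \<partial>N))"
    using stab DN_int[OF \<tau>m] DN_int[OF idN]
    by (intro mult_left_mono sum_mono integral_mono) auto
  also have "\<dots> = (\<integral>w. 1 / real n * (\<Sum>i<n. D (?z w) (w i)) \<partial>N) + ?\<beta>"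
    using n DN_int[OF idN] by (simp add: N.prob_space sum.distrib algebra_simps)
  finally have le: "(\<integral>\<xi>. gap \<xi> \<partial>?P {..<n}) \<le> (\<integral>w. 1 / real n * (\<Sum>i<n. D (?z w) (w i)) \<partial>N) + (\<integral>w. r w \<partial>N) + ?\<beta>"
    using eq1 by simp
  have sum_int: "integrable N (\<lambda>w. 1 / real n * (\<Sum>i<n. D (?z w) (w i)))"
    by (intro integrable_mult_right Bochner_Integration.integrable_sum DN_int[OF idN]) auto
  note le
  also have "(\<integral>w. 1 / real n * (\<Sum>i<n. D (?z w) (w i)) \<partial>N) + (\<integral>w. r w \<partial>N) =
      (\<integral>w. 1 / real n * (\<Sum>i<n. D (?z w) (w i)) + r w \<partial>N)"
    using sum_int r_int[OF sub] by (simp add: N_def)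
  \<comment> \<open>On its own batch the solution is a saddle point, so it beats every fixed
    comparison point.\<close>
  also have "\<dots> \<le> 0"
  proof -
    have "1 / real n * (\<Sum>i<n. D (?z w) (w i)) + r w \<le> 0" for w
    proof -
      have "1 / real n * (\<Sum>i<n. D (?z w) (w i)) + r w =
        empirical n p q w (fst (?z w)) y - empirical n p q w x (snd (?z w))"
        unfolding D_def r_def empirical_def by (simp add: sum_subtractf diff_divide_distrib)
      also have "\<dots> \<le> 0"
        using saa_saddle_point[OF p q n, of w] x y unfolding saddle_point_def by fastforce
      finally show ?thesis .
    qed
    then have "(\<integral>w. 1 / real n * (\<Sum>i<n. D (?z w) (w i)) + r w \<partial>N) \<le> (\<integral>w. 0 \<partial>N)"
      using sum_int r_int[OF sub] by (intro integral_mono Bochner_Integration.integrable_add) (auto simp: N_def)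
    then show ?thesis by simp
  qed
  finally show "(\<integral>\<xi>. gap \<xi> \<partial>?P {..<n}) \<le> ?\<beta>" by simp
qed

end

section \<open>The iterates of a run\<close>

definition penalty :: "real \<Rightarrow> 'a::real_normed_vector \<Rightarrow> real \<Rightarrow> 'a \<Rightarrow> 'a \<Rightarrow> real" where
  "penalty a x0 l c x = a / 2 * (norm (x - x0))\<^sup>2 + l / 2 * (norm (x - c))\<^sup>2"

lemma strong_penalty_penalty:
  fixes x0 c :: "'a::real_inner"
  assumes "a > 0" "l \<ge> 0"
  shows "strong_penalty S (a + l) (penalty a x0 l c)"
proof -
  have "strongly_convex_on S (a + l) (penalty a x0 l c)"
    unfolding penalty_def[abs_def]
    by (rule strongly_convex_on_add[OF strongly_convex_on_quadratic strongly_convex_on_quadratic])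
  moreover have "continuous_on S (penalty a x0 l c)"
    unfolding penalty_def[abs_def] by (intro continuous_intros)
  ultimately show ?thesis using assms by (simp add: strong_penalty_def)
qed

lemma finite_stages: "finite (stages c)"
  by (simp add: stages_def)

lemma card_stages_le: "card (stages c) \<le> 2 * rounds c + 6"
proof -
  have "card (stages c) \<le> card (Center_x ` {..rounds c}) + card (Center_y ` {..rounds c}) + card {Gap_x, Grad_x, Gap_y, Grad_y}"
    unfolding stages_def by (rule order_trans[OF card_Un_le add_mono[OF card_Un_le order_refl]])
  also have "\<dots> \<le> Suc (rounds c) + Suc (rounds c) + 4"
    by (intro add_mono order_trans[OF card_image_le]) auto
  finally show ?thesis by simp
qed

text \<open>Here \<open>\<epsilon>\<close> is the accuracy given to the run, half of the one in
  \<open>corollary4\<close>. The sample gradients are bounded at every \<open>\<xi>\<close>, and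
  they are jointly measurable because they are evaluated at random points.\<close>

locale boosted_saa = sampled_saddle_problem P X Y f lx ly
  for P :: "'s measure" and X :: "'x::euclidean_space set" and Y :: "'y::euclidean_space set"
    and f lx ly +
  fixes fgx :: "'s \<Rightarrow> 'x \<Rightarrow> 'y \<Rightarrow> 'x" and fgy :: "'s \<Rightarrow> 'x \<Rightarrow> 'y \<Rightarrow> 'y"
    and gx :: "'x \<Rightarrow> 'y \<Rightarrow> 'x" and gy :: "'x \<Rightarrow> 'y \<Rightarrow> 'y"
    and x' :: 'x and y' :: 'y
    and Lx Ly Lxy ax ay \<epsilon> p :: real
    and K :: "'s picks" and Q :: "('s, 'x, 'y) problem" and c :: params
  defines "Q \<equiv> regularized_problem X Y f fgx fgy ax ay x' y'"
    and "c \<equiv> regularized_params Lx Ly Lxy lx ly ax ay \<epsilon> p"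
  assumes pos: "ax > 0" "ay > 0" "\<epsilon> > 0" "0 < p" "p < 1" "lx > 0" "ly > 0" "Lx > 0" "Ly > 0" "Lxy > 0"
    and gradient: "\<And>x y. x \<in> X \<Longrightarrow> y \<in> Y \<Longrightarrow>
          ((\<lambda>u. \<Phi> u y) has_derivative (\<lambda>h. gx x y \<bullet> h)) (at x within X) \<and>
          ((\<lambda>v. \<Phi> x v) has_derivative (\<lambda>h. gy x y \<bullet> h)) (at y within Y)"
    and smooth_x: "\<And>x1 x2 y. x1 \<in> X \<Longrightarrow> x2 \<in> X \<Longrightarrow> y \<in> Y \<Longrightarrow>
          norm (gx x1 y - gx x2 y) \<le> Lx * norm (x1 - x2) \<and>
          norm (gy x1 y - gy x2 y) \<le> Lxy * norm (x1 - x2)"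
    and smooth_y: "\<And>x y1 y2. x \<in> X \<Longrightarrow> y1 \<in> Y \<Longrightarrow> y2 \<in> Y \<Longrightarrow>
          norm (gy x y1 - gy x y2) \<le> Ly * norm (y1 - y2) \<and>
          norm (gx x y1 - gx x y2) \<le> Lxy * norm (y1 - y2)"
    and fg_bound: "\<And>\<xi> x y. x \<in> X \<Longrightarrow> y \<in> Y \<Longrightarrow> norm (fgx \<xi> x y) \<le> lx \<and> norm (fgy \<xi> x y) \<le> ly"
    and fgx_measurable: "(\<lambda>(\<xi>, x, y). fgx \<xi> x y) \<in> borel_measurable (P \<Otimes>\<^sub>M restrict_space borel (X \<times> Y))"
    and fgy_measurable: "(\<lambda>(\<xi>, x, y). fgy \<xi> x y) \<in> borel_measurable (P \<Otimes>\<^sub>M restrict_space borel (X \<times> Y))"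
    and unbiased: "\<And>x y. x \<in> X \<Longrightarrow> y \<in> Y \<Longrightarrow>
          (\<integral>\<xi>. fgx \<xi> x y \<partial>P) = gx x y \<and> (\<integral>\<xi>. fgy \<xi> x y \<partial>P) = gy x y"
    and adapted: "adapted_picks P c K"
begin

abbreviation T where "T \<equiv> rounds c"
abbreviation m where "m \<equiv> reps c"
abbreviation \<delta> where "\<delta> \<equiv> delta c"
abbreviation \<Omega> where "\<Omega> \<equiv> sample_space P c"

lemma c_simps [simp]:
  "mu_x c = ax" "mu_y c = ay" "sm_x c = Lx + ax" "sm_y c = Ly + ay" "sm_xy c = Lxy"
  "lip_x c = lx" "lip_y c = ly" "sig_x c = 2 * lx" "sig_y c = 2 * ly" "acc c = \<epsilon>" "fail c = p"
  by (simp_all add: c_def regularized_params_def)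

lemma Q_simps [simp]: "dom_x Q = X" "dom_y Q = Y"
  "obj Q = (\<lambda>\<xi> x y. f \<xi> x y + ax / 2 * (norm (x - x'))\<^sup>2 - ay / 2 * (norm (y - y'))\<^sup>2)"
  "grad_x Q = (\<lambda>\<xi> x y. fgx \<xi> x y + ax *\<^sub>R (x - x'))"
  "grad_y Q = (\<lambda>\<xi> x y. fgy \<xi> x y - ay *\<^sub>R (y - y'))"
  by (simp_all add: Q_def regularized_problem_def)

lemma lam_x_nonneg [simp]: "lam ax i \<ge> 0" and lam_y_nonneg [simp]: "lam ay i \<ge> 0"
  using pos by (auto intro: lam_nonneg)

lemma lamT_simps: "lamT_x c = lam ax (Suc T)" "lamT_y c = lam ay (Suc T)"
  by (simp_all add: lamT_x_def lamT_y_def)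

lemma lamT_pos: "lamT_x c > 0" "lamT_y c > 0"
  using pos by (simp_all add: lamT_simps)

lemma add_lam_pos: "ax + lam ax i > 0" "ay + lam ay i > 0" "ax + lamT_x c > 0" "ay + lamT_y c > 0"
  using pos lam_x_nonneg[of i] lam_y_nonneg[of i] lamT_pos by linarith+

lemma delta_pos: "\<delta> > 0"
  using pos by (simp add: delta_def)

lemma gap_const_pos: "gap_const_x c > 0" "gap_const_y c > 0"
  unfolding gap_const_x_def gap_const_y_def c_simps
  using pos add_lam_pos(3,4) lamT_pos by (auto intro!: add_pos_nonneg)

lemma eta_pos: "eta_x c > 0" "eta_y c > 0"
  using delta_pos gap_const_pos by (simp_all add: eta_x_def eta_y_def)

lemma delta_grad_pos: "delta_grad_x c > 0" "delta_grad_y c > 0"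
  unfolding delta_grad_x_def delta_grad_y_def c_simps using pos lamT_pos eta_pos add_lam_pos
  by (auto intro!: mult_pos_pos divide_pos_pos)

lemma ratio_pos: "lx\<^sup>2 / (ax + lam ax i) + ly\<^sup>2 / ay > 0" "lx\<^sup>2 / ax + ly\<^sup>2 / (ay + lam ay i) > 0"
  by (rule add_pos_pos[OF divide_pos_pos divide_pos_pos]; use pos add_lam_pos in simp)+

lemma raw_size_pos: "raw_size c s > 0"
proof (cases s)
  case (Center_x i)
  show ?thesis unfolding Center_x raw_size.simps c_simps
    by (rule mult_pos_pos[OF _ ratio_pos(1)]) (use delta_pos in simp)
next
  case (Center_y i)
  show ?thesis unfolding Center_y raw_size.simps c_simps
    by (rule mult_pos_pos[OF _ ratio_pos(2)]) (use delta_pos in simp)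
next
  case Gap_x
  show ?thesis unfolding Gap_x raw_size.simps c_simps lamT_simps
    by (rule mult_pos_pos[OF _ ratio_pos(1)]) (use eta_pos in simp)
next
  case Gap_y
  show ?thesis unfolding Gap_y raw_size.simps c_simps lamT_simps
    by (rule mult_pos_pos[OF _ ratio_pos(2)]) (use eta_pos in simp)
qed (use pos delta_grad_pos in simp_all)

lemma batch_size_pos: "batch_size c s > 0"
  using raw_size_pos[of s] by (simp add: batch_size_def)

lemma raw_size_le: "raw_size c s \<le> real (batch_size c s)"
  unfolding batch_size_def by (rule real_nat_ceiling_ge)

lemma reps_pos: "m > 0" and reps_ge: "real m \<ge> 18 * ln ((2 * real T + 6) / p)"
proof -
  have "18 * ln ((2 * real T + 6) / p) \<le> real (nat \<lceil>18 * ln ((2 * real T + 6) / p)\<rceil>)" by linarith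
  then show "real m \<ge> 18 * ln ((2 * real T + 6) / p)" by (auto simp: reps_def Let_def)
  have "1 < (2 * real T + 6) / p" using pos by (simp add: less_divide_eq)
  then have "0 < ln ((2 * real T + 6) / p)" by (rule ln_gt_zero)
  then show "m > 0" by (auto simp: reps_def Let_def intro: Nat.gr0I)
qed

lemma finite_sample_index: "finite (sample_index c)"
proof (rule finite_subset)
  show "sample_index c \<subseteq> Sigma (stages c) (\<lambda>s. {..<m} \<times> {..<batch_size c s})"
    by (auto simp: sample_index_def)
qed (use finite_stages in auto)

lemma stages_I: "i \<le> T \<Longrightarrow> Center_x i \<in> stages c" "i \<le> T \<Longrightarrow> Center_y i \<in> stages c"
  "Gap_x \<in> stages c" "Gap_y \<in> stages c" "Grad_x \<in> stages c" "Grad_y \<in> stages c"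
  by (auto simp: stages_def)

sublocale \<Omega>: prob_space \<Omega>
  unfolding sample_space_def by (rule prob_space_power)

subsection \<open>Dependence on the past\<close>

text \<open>Indices outside \<open>sample_index\<close> are constrained as well, because a candidate
  is defined for every batch number \<open>j\<close>.\<close>

definition agree_before :: "nat \<Rightarrow> (stage \<times> nat \<times> nat \<Rightarrow> 's) \<Rightarrow> (stage \<times> nat \<times> nat \<Rightarrow> 's) \<Rightarrow> bool" where
  "agree_before t \<omega> \<omega>' \<longleftrightarrow> (\<forall>k. stage_time c (fst k) < t \<longrightarrow> \<omega> k = \<omega>' k)"

lemma pick_cong:
  assumes "agree_before t \<omega> \<omega>'" "stage_time c s < t"
  shows "pick c K \<omega> s q = pick c K \<omega>' s q"
proof -
  have "restrict \<omega> (history c s) = restrict \<omega>' (history c s)"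
    using assms by (auto simp: history_def agree_before_def fun_eq_iff restrict_def)
  then show ?thesis by (simp add: pick_def)
qed

lemma solve_cong:
  assumes "agree_before t \<omega> \<omega>'" "stage_time c s < t"
  shows "solve_x Q c \<omega> s i xc j = solve_x Q c \<omega>' s i xc j" "solve_y Q c \<omega> s i yc j = solve_y Q c \<omega>' s i yc j"
  using assms by (simp_all add: solve_x_def solve_y_def agree_before_def)

text \<open>The last stage entering the center at \<open>i > 0\<close> is
  \<open>Center_x (i - 1)\<close>, of time \<open>2 * i - 2\<close>. Its counterpart for the other
  player comes one step later, whence the different bounds on \<open>t\<close>.\<close>

lemma center_x_cong: "agree_before t \<omega> \<omega>' \<Longrightarrow> 2 * i \<le> t + 1 \<Longrightarrow> center_x Q c K \<omega> i = center_x Q c K \<omega>' i"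
proof (induction i)
  case (Suc i)
  then have *: "center_x Q c K \<omega> i = center_x Q c K \<omega>' i" "stage_time c (Center_x i) < t" by auto
  show ?case
    unfolding center_x.simps combine_def * pick_cong[OF Suc.prems(1) *(2)] solve_cong[OF Suc.prems(1) *(2)] ..
qed simp

lemma center_y_cong: "agree_before t \<omega> \<omega>' \<Longrightarrow> 2 * i \<le> t \<Longrightarrow> center_y Q c K \<omega> i = center_y Q c K \<omega>' i"
proof (induction i)
  case (Suc i)
  then have *: "center_y Q c K \<omega> i = center_y Q c K \<omega>' i" "stage_time c (Center_y i) < t" by auto
  show ?case
    unfolding center_y.simps combine_def * pick_cong[OF Suc.prems(1) *(2)] solve_cong[OF Suc.prems(1) *(2)] ..
qed simp

lemma grad_point_x_cong:
  assumes "agree_before (2 * T + 3) \<omega> \<omega>'"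
  shows "grad_point_x Q c K \<omega> = grad_point_x Q c K \<omega>'"
proof -
  have t: "stage_time c Gap_x < 2 * T + 3" by simp
  have "centerT_x Q c K \<omega> = centerT_x Q c K \<omega>'"
    unfolding centerT_x_def by (rule center_x_cong[OF assms]) simp
  then show ?thesis
    unfolding grad_point_x_def combine_def gap_candidate_x_def pick_cong[OF assms t] solve_cong[OF assms t] by simp
qed

lemma grad_point_y_cong:
  assumes "agree_before (2 * T + 5) \<omega> \<omega>'"
  shows "grad_point_y Q c K \<omega> = grad_point_y Q c K \<omega>'"
proof -
  have t: "stage_time c Gap_y < 2 * T + 5" by simp
  have "centerT_y Q c K \<omega> = centerT_y Q c K \<omega>'"
    unfolding centerT_y_def by (rule center_y_cong[OF assms]) simp
  then show ?thesis
    unfolding grad_point_y_def combine_def gap_candidate_y_def pick_cong[OF assms t] solve_cong[OF assms t] by simp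
qed

subsection \<open>Measurability of the iterates\<close>

abbreviation pen_x where "pen_x \<equiv> penalty ax x'"
abbreviation pen_y where "pen_y \<equiv> penalty ay y'"

lemma strong_pen: "wx \<ge> 0 \<Longrightarrow> strong_penalty X (ax + wx) (pen_x wx xc)"
  "wy \<ge> 0 \<Longrightarrow> strong_penalty Y (ay + wy) (pen_y wy yc)"
  using pos by (auto intro: strong_penalty_penalty)

text \<open>The regularization does not depend on the sample, so averaging a positive number of
  copies returns it, and it can move into the penalties.\<close>

lemma SAA_eq_saa:
  assumes "n > 0"
  shows "SAA Q n wx wy xc yc \<xi> = saa n (pen_x wx xc) (pen_y wy yc) \<xi>"
proof -
  have "(\<lambda>x y. 1 / real n * (\<Sum>i<n. obj Q (\<xi> i) x y) + wx / 2 * (norm (x - xc))\<^sup>2 - wy / 2 * (norm (y - yc))\<^sup>2) =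
    empirical n (pen_x wx xc) (pen_y wy yc) \<xi>"
    using assms
    by (simp add: fun_eq_iff empirical_def penalty_def sum.distrib sum_subtractf add_divide_distrib diff_divide_distrib)
  then show ?thesis by (simp add: SAA_def saa_def)
qed

lemma SAA_in:
  assumes "n > 0" "wx \<ge> 0" "wy \<ge> 0"
  shows "SAA Q n wx wy xc yc \<xi> \<in> X \<times> Y"
  unfolding SAA_eq_saa[OF assms(1)] by (rule saa_in[OF strong_pen(1,2) assms(1)]) fact+

text \<open>For \<open>j\<close> beyond the repetitions the coordinate is constantly
  \<open>undefined\<close> on the product space. Candidates are thus measurable for all
  \<open>j\<close>, as needed for selection by a pick that takes values in all of
  \<open>nat\<close>.\<close>

lemma f_sample_measurable:
  assumes "s \<in> stages c" "i < batch_size c s" "x \<in> X" "y \<in> Y"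
  shows "(\<lambda>\<omega>. f (\<omega> (s, j, i)) x y) \<in> borel_measurable \<Omega>"
proof (cases "j < m")
  case True
  then have "(s, j, i) \<in> sample_index c" using assms by (simp add: sample_index_def)
  then show ?thesis
    unfolding sample_space_def using f_measurable[OF assms(3,4)]
    by (rule measurable_PiM_sample[where g = "\<lambda>\<xi>. f \<xi> x y"])
next
  case False
  then have "(s, j, i) \<notin> sample_index c" by (simp add: sample_index_def)
  then have "f (\<omega> (s, j, i)) x y = f undefined x y" if "\<omega> \<in> space \<Omega>" for \<omega>
    using that by (auto simp: sample_space_def space_PiM PiE_def extensional_def)
  then show ?thesis by (subst measurable_cong[where g = "\<lambda>_. f undefined x y"]) auto
qed

lemma SAA_measurable:
  assumes s: "s \<in> stages c" and w: "wx \<ge> 0" "wy \<ge> 0"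
    and xc [measurable]: "xc \<in> borel_measurable \<Omega>" and yc [measurable]: "yc \<in> borel_measurable \<Omega>"
  shows "(\<lambda>\<omega>. SAA Q (batch_size c s) wx wy (xc \<omega>) (yc \<omega>) (\<lambda>l. \<omega> (s, j, l))) \<in> borel_measurable \<Omega>"
  unfolding SAA_eq_saa[OF batch_size_pos]
proof (rule saa_measurable[OF strong_pen(1)[OF w(1)] strong_pen(2)[OF w(2)] batch_size_pos])
  show "(\<lambda>\<omega>. pen_x wx (xc \<omega>) x) \<in> borel_measurable \<Omega>" "(\<lambda>\<omega>. pen_y wy (yc \<omega>) y) \<in> borel_measurable \<Omega>" for x y
    unfolding penalty_def by measurable
qed (rule f_sample_measurable[OF s])

lemma pick_measurable:
  assumes "s \<in> stages c"
  shows "(\<lambda>\<omega>. pick c K \<omega> s q) \<in> measurable \<Omega> (count_space UNIV)"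
proof -
  have "(\<lambda>\<omega>. restrict \<omega> (history c s)) \<in> measurable \<Omega> (Pi\<^sub>M (history c s) (\<lambda>_. P))"
    unfolding sample_space_def by (rule measurable_restrict_subset) (auto simp: history_def)
  moreover have "K s q \<in> measurable (Pi\<^sub>M (history c s) (\<lambda>_. P)) (count_space UNIV)"
    using adapted assms by (simp add: adapted_picks_def)
  ultimately show ?thesis unfolding pick_def by (rule measurable_compose)
qed

lemma solve_measurable:
  assumes "s \<in> stages c" "xc \<in> borel_measurable \<Omega>" "yc \<in> borel_measurable \<Omega>"
  shows "(\<lambda>\<omega>. solve_x Q c \<omega> s i (xc \<omega>) j) \<in> borel_measurable \<Omega>"
    "(\<lambda>\<omega>. solve_y Q c \<omega> s i (yc \<omega>) j) \<in> borel_measurable \<Omega>"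
  unfolding solve_x_def solve_y_def c_simps using assms
  by (auto intro!: SAA_measurable)

lemma solve_in: "solve_x Q c \<omega> s i xc j \<in> X \<times> Y" "solve_y Q c \<omega> s i yc j \<in> X \<times> Y"
  unfolding solve_x_def solve_y_def c_simps by (rule SAA_in; simp add: batch_size_pos)+

lemma selected_measurable:
  assumes "s \<in> stages c" "\<And>j. (\<lambda>\<omega>. z \<omega> j) \<in> borel_measurable \<Omega>"
  shows "(\<lambda>\<omega>. z \<omega> (pick c K \<omega> s q)) \<in> borel_measurable \<Omega>"
  by (rule measurable_compose_countable[where f = "\<lambda>j \<omega>. z \<omega> j", OF assms(2) pick_measurable[OF assms(1)]])

lemma center_x_measurable: "i \<le> Suc T \<Longrightarrow> (\<lambda>\<omega>. center_x Q c K \<omega> i) \<in> borel_measurable \<Omega>"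
proof (induction i)
  case (Suc i)
  show ?case
    unfolding center_x.simps combine_def fst_conv
    by (intro borel_measurable_fst_compose
        selected_measurable[where z = "\<lambda>\<omega>. solve_x Q c \<omega> (Center_x i) i (center_x Q c K \<omega> i)"]
        stages_I(1) solve_measurable(1)[where yc = "\<lambda>_. 0"] borel_measurable_const Suc.IH)
      (use Suc.prems in auto)
qed simp

lemma center_y_measurable: "i \<le> Suc T \<Longrightarrow> (\<lambda>\<omega>. center_y Q c K \<omega> i) \<in> borel_measurable \<Omega>"
proof (induction i)
  case (Suc i)
  show ?case
    unfolding center_y.simps combine_def snd_conv
    by (intro borel_measurable_snd_compose
        selected_measurable[where z = "\<lambda>\<omega>. solve_y Q c \<omega> (Center_y i) i (center_y Q c K \<omega> i)"]
        stages_I(2) solve_measurable(2)[where xc = "\<lambda>_. 0"] borel_measurable_const Suc.IH)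
      (use Suc.prems in auto)
qed simp

lemma gap_candidate_measurable:
  "(\<lambda>\<omega>. gap_candidate_x Q c K \<omega> j) \<in> borel_measurable \<Omega>"
  "(\<lambda>\<omega>. gap_candidate_y Q c K \<omega> j) \<in> borel_measurable \<Omega>"
  unfolding gap_candidate_x_def gap_candidate_y_def centerT_x_def centerT_y_def
  by (intro solve_measurable(1)[where yc = "\<lambda>_. 0"] stages_I center_x_measurable borel_measurable_const order_refl,
      intro solve_measurable(2)[where xc = "\<lambda>_. 0"] stages_I center_y_measurable borel_measurable_const order_refl)

lemma gap_candidate_in: "gap_candidate_x Q c K \<omega> j \<in> X \<times> Y" "gap_candidate_y Q c K \<omega> j \<in> X \<times> Y"
  unfolding gap_candidate_x_def gap_candidate_y_def by (rule solve_in)+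

lemma grad_point_measurable:
  "grad_point_x Q c K \<in> borel_measurable \<Omega>" "grad_point_y Q c K \<in> borel_measurable \<Omega>"
  unfolding grad_point_x_def[abs_def] grad_point_y_def[abs_def] combine_def
  by (intro borel_measurable_Pair borel_measurable_fst_compose borel_measurable_snd_compose
      selected_measurable[where z = "gap_candidate_x Q c K"] stages_I gap_candidate_measurable,
      intro borel_measurable_Pair borel_measurable_fst_compose borel_measurable_snd_compose
      selected_measurable[where z = "gap_candidate_y Q c K"] stages_I gap_candidate_measurable)

lemma grad_point_in: "grad_point_x Q c K \<omega> \<in> X \<times> Y" "grad_point_y Q c K \<omega> \<in> X \<times> Y"
  using gap_candidate_in(1)[of \<omega>] gap_candidate_in(2)[of \<omega>]
  by (auto simp: grad_point_x_def grad_point_y_def combine_def mem_Times_iff)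

lemma output_measurable:
  "output_x Q c K \<in> borel_measurable \<Omega>" "output_y Q c K \<in> borel_measurable \<Omega>"
  unfolding output_x_def[abs_def] output_y_def[abs_def]
  by (intro borel_measurable_fst_compose selected_measurable[where z = "gap_candidate_x Q c K"] stages_I gap_candidate_measurable,
      intro borel_measurable_snd_compose selected_measurable[where z = "gap_candidate_y Q c K"] stages_I gap_candidate_measurable)

lemma output_in: "output_x Q c K \<omega> \<in> X" "output_y Q c K \<omega> \<in> Y"
  using gap_candidate_in(1)[of \<omega>] gap_candidate_in(2)[of \<omega>]
  by (auto simp: output_x_def output_y_def mem_Times_iff)

end

section \<open>Failure probability of the stages\<close>

context boosted_saa
begin

definition pop where
  "pop wx xc wy yc = (\<lambda>x y. \<Phi> x y + pen_x wx xc x - pen_y wy yc y)"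

definition pop_saddle where
  "pop_saddle wx xc wy yc = (THE z. saddle_point X Y (pop wx xc wy yc) z)"

text \<open>The comparison point is the population saddle point and not a best response to
  \<open>v\<close>: once the past is given it is fixed, as \<open>saa_expected_gap\<close> requires,
  and the resulting gap still controls distances.\<close>

definition pop_gap where
  "pop_gap wx xc wy yc v = pop wx xc wy yc (fst v) (snd (pop_saddle wx xc wy yc)) -
     pop wx xc wy yc (fst (pop_saddle wx xc wy yc)) (snd v)"

lemma pop_strong_saddle:
  assumes "wx \<ge> 0" "wy \<ge> 0"
  shows "strong_saddle X Y (ax + wx) (ay + wy) (pop wx xc wy yc)"
  unfolding pop_def by (rule strong_saddle_population[OF strong_pen]) fact+

lemma pop_saddle_point:
  assumes "wx \<ge> 0" "wy \<ge> 0"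
  shows "saddle_point X Y (pop wx xc wy yc) (pop_saddle wx xc wy yc)"
  unfolding pop_saddle_def by (rule strong_saddle_the[OF pop_strong_saddle]) fact+

lemma pop_saddle_in:
  assumes "wx \<ge> 0" "wy \<ge> 0"
  shows "fst (pop_saddle wx xc wy yc) \<in> X" "snd (pop_saddle wx xc wy yc) \<in> Y"
  using pop_saddle_point[OF assms] by (auto simp: saddle_point_def)

lemma pop_saddle_measurable:
  assumes w: "wx \<ge> 0" "wy \<ge> 0"
    and [measurable]: "xc \<in> borel_measurable M" "yc \<in> borel_measurable M"
  shows "(\<lambda>w. pop_saddle wx (xc w) wy (yc w)) \<in> borel_measurable M"
proof (rule measurable_unique_saddle_point[OF X(1) Y(1), where F = "\<lambda>w. pop wx (xc w) wy (yc w)"])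
  show "(\<lambda>w. pop wx (xc w) wy (yc w) x y) \<in> borel_measurable M" for x y
    unfolding pop_def penalty_def by measurable
  show "continuous_on (X \<times> Y) (\<lambda>v. pop wx (xc w) wy (yc w) (fst v) (snd v))" for w
    by (rule strong_saddle_continuous[OF pop_strong_saddle[OF w]])
  show "saddle_point X Y (pop wx (xc w) wy (yc w)) (pop_saddle wx (xc w) wy (yc w))" for w
    by (rule pop_saddle_point[OF w])
  show "z = pop_saddle wx (xc w) wy (yc w)" if "saddle_point X Y (pop wx (xc w) wy (yc w)) z" for w z
    by (rule strong_saddle_unique[OF pop_strong_saddle[OF w] that pop_saddle_point[OF w]])
qed

lemma \<Phi>_measurable_compose:
  assumes "u \<in> borel_measurable M" "v \<in> borel_measurable M" "\<And>w. w \<in> space M \<Longrightarrow> u w \<in> X"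
    "\<And>w. w \<in> space M \<Longrightarrow> v w \<in> Y"
  shows "(\<lambda>w. \<Phi> (u w) (v w)) \<in> borel_measurable M"
proof -
  have "(\<lambda>w. \<Phi> (fst (u w, v w)) (snd (u w, v w))) \<in> borel_measurable M"
    by (rule measurable_Caratheodory[where g = "\<lambda>w v. \<Phi> (fst v) (snd v)" and Z = "X \<times> Y"])
      (use assms convex_concave_lipschitz_continuous[OF \<Phi>_cc] in
        \<open>auto simp: case_prod_unfold intro!: borel_measurable_Pair\<close>)
  then show ?thesis by simp
qed

lemma pop_gap_measurable:
  assumes w: "wx \<ge> 0" "wy \<ge> 0" and xc [measurable]: "xc \<in> borel_measurable M" and yc [measurable]: "yc \<in> borel_measurable M"
    and u: "u \<in> borel_measurable M" and in_XY: "\<And>w. u w \<in> X \<times> Y"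
  shows "(\<lambda>w. pop_gap wx (xc w) wy (yc w) (u w)) \<in> borel_measurable M"
proof -
  note s = pop_saddle_measurable[OF w xc yc]
  note [measurable] = borel_measurable_fst_compose[OF s] borel_measurable_snd_compose[OF s]
    borel_measurable_fst_compose[OF u] borel_measurable_snd_compose[OF u]
  have [measurable]: "(\<lambda>w. \<Phi> (fst (u w)) (snd (pop_saddle wx (xc w) wy (yc w)))) \<in> borel_measurable M"
    "(\<lambda>w. \<Phi> (fst (pop_saddle wx (xc w) wy (yc w))) (snd (u w))) \<in> borel_measurable M"
    using in_XY pop_saddle_in[OF w] by (auto intro!: \<Phi>_measurable_compose simp: mem_Times_iff)
  show ?thesis unfolding pop_gap_def pop_def penalty_def by measurable
qed

text \<open>Given the past, all batches of a stage solve the same problem with different samples.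
  One event \<open>G\<close> in the space of a single batch, chosen from the past and not depending
  on \<open>j\<close>, therefore describes them all.\<close>

lemma stage_failure:
  assumes s: "s \<in> stages c"
    and meas: "\<And>j. j < m \<Longrightarrow> {\<omega> \<in> space \<Omega>. R \<omega> j} \<in> sets \<Omega>"
    and G: "\<And>\<omega>. \<exists>G\<in>sets (Pi\<^sub>M {..<batch_size c s} (\<lambda>_. P)). 2 / 3 \<le> measure (Pi\<^sub>M {..<batch_size c s} (\<lambda>_. P)) G \<and>
      (\<forall>\<omega>' j. agree_before (stage_time c s) \<omega>' \<omega> \<longrightarrow> (\<lambda>i\<in>{..<batch_size c s}. \<omega>' (s, j, i)) \<in> G \<longrightarrow> R \<omega>' j)"
  defines "B \<equiv> {\<omega> \<in> space \<Omega>. real (card {j. j < m \<and> R \<omega> j}) \<le> real m / 2}"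
  shows "B \<in> sets \<Omega> \<and> \<Omega>.prob B \<le> exp (- real m / 18)"
proof
  let ?n = "batch_size c s"
  show B: "B \<in> sets \<Omega>" unfolding B_def by (rule sets_Collect_card_le[OF meas])
  show "\<Omega>.prob B \<le> exp (- real m / 18)"
    unfolding sample_space_def
  proof (rule conditional_majority_failure_le[OF finite_sample_index, where e = "\<lambda>j i. (s, j, i)" and n = ?n])
    show "(s, j, i) \<in> sample_index c" if "j < m" "i < ?n" for j i
      using s that by (simp add: sample_index_def)
    fix \<omega>
    from G[of \<omega>] obtain G where G: "G \<in> sets (Pi\<^sub>M {..<?n} (\<lambda>_. P))" "2 / 3 \<le> measure (Pi\<^sub>M {..<?n} (\<lambda>_. P)) G"
      and R: "\<And>\<omega>' j. agree_before (stage_time c s) \<omega>' \<omega> \<Longrightarrow> (\<lambda>i\<in>{..<?n}. \<omega>' (s, j, i)) \<in> G \<Longrightarrow> R \<omega>' j" by blast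
    have "real (card {j. j < m \<and> (\<lambda>i\<in>{..<?n}. \<omega>' (s, j, i)) \<in> G}) \<le> real m / 2"
      if \<omega>': "\<omega>' \<in> B" and ag: "\<forall>k. k \<notin> {(s, j, i) |j i. j < m \<and> i < ?n} \<longrightarrow> \<omega>' k = \<omega> k" for \<omega>'
    proof -
      \<comment> \<open>Stage \<open>s\<close> does not precede itself, so changing its batches
        keeps its past.\<close>
      have "agree_before (stage_time c s) \<omega>' \<omega>" using ag unfolding agree_before_def by fastforce
      then have "card {j. j < m \<and> (\<lambda>i\<in>{..<?n}. \<omega>' (s, j, i)) \<in> G} \<le> card {j. j < m \<and> R \<omega>' j}"
        using R by (intro card_mono) auto
      with \<omega>' show ?thesis unfolding B_def by simp
    qed
    with G show "\<exists>G\<in>sets (Pi\<^sub>M {..<?n} (\<lambda>_. P)). 2 / 3 \<le> measure (Pi\<^sub>M {..<?n} (\<lambda>_. P)) G \<and>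
      (\<forall>\<omega>'\<in>B. (\<forall>k. k \<notin> {(s, j, i) |j i. j < m \<and> i < ?n} \<longrightarrow> \<omega>' k = \<omega> k) \<longrightarrow>
        real (card {j. j < m \<and> (\<lambda>i\<in>{..<?n}. \<omega>' (s, j, i)) \<in> G}) \<le> real m / 2)" by blast
  qed (use B reps_pos in \<open>auto simp: sample_space_def inj_on_def\<close>)
qed

text \<open>The factor 6 is 2 from stability times 3 from Markov's inequality. It becomes 54 /
  \<delta> for the tolerance \<delta> / 9 of the centers and 2 / (\<eta> / 3) in the last
  round.\<close>

lemma saddle_stage_failure:
  assumes s: "s \<in> stages c" and w: "wx \<ge> 0" "wy \<ge> 0"
    and xc: "xc \<in> borel_measurable \<Omega>" and yc: "yc \<in> borel_measurable \<Omega>"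
    and past: "\<And>\<omega> \<omega>'. agree_before (stage_time c s) \<omega> \<omega>' \<Longrightarrow> xc \<omega> = xc \<omega>' \<and> yc \<omega> = yc \<omega>'"
    and "\<eta> > 0" and size: "6 / \<eta> * (lx\<^sup>2 / (ax + wx) + ly\<^sup>2 / (ay + wy)) \<le> real (batch_size c s)"
  defines "B \<equiv> {\<omega> \<in> space \<Omega>. real (card {j. j < m \<and> pop_gap wx (xc \<omega>) wy (yc \<omega>)
      (SAA Q (batch_size c s) wx wy (xc \<omega>) (yc \<omega>) (\<lambda>l. \<omega> (s, j, l))) \<le> \<eta>}) \<le> real m / 2}"
  shows "B \<in> sets \<Omega> \<and> \<Omega>.prob B \<le> exp (- real m / 18)"
  unfolding B_def
proof (rule stage_failure[OF s])
  let ?n = "batch_size c s"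
  have n: "?n > 0" by (rule batch_size_pos)
  show "{\<omega> \<in> space \<Omega>. pop_gap wx (xc \<omega>) wy (yc \<omega>) (SAA Q ?n wx wy (xc \<omega>) (yc \<omega>) (\<lambda>l. \<omega> (s, j, l))) \<le> \<eta>} \<in> sets \<Omega>" for j
    by (intro borel_measurable_le borel_measurable_const pop_gap_measurable SAA_measurable s w xc yc SAA_in n)
  fix \<omega>
    let ?p = "pen_x wx (xc \<omega>)" and ?q = "pen_y wy (yc \<omega>)"
    let ?s = "pop_saddle wx (xc \<omega>) wy (yc \<omega>)"
    let ?Pn = "Pi\<^sub>M {..<?n} (\<lambda>_. P)"
    interpret Pn: prob_space ?Pn by (rule prob_space_power)
    define gap where "gap \<xi> = pop_gap wx (xc \<omega>) wy (yc \<omega>) (saa ?n ?p ?q \<xi>)" for \<xi>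
    define G where "G = {\<xi> \<in> space ?Pn. gap \<xi> \<le> \<eta>}"
    note eg = saa_expected_gap[OF strong_pen(1)[OF w(1), of "xc \<omega>"] strong_pen(2)[OF w(2), of "yc \<omega>"] n
        pop_saddle_in[OF w, of "xc \<omega>" "yc \<omega>"]]
    have gap_int: "integrable ?Pn gap" and "Pn.expectation gap \<le> 2 / real ?n * (lx\<^sup>2 / (ax + wx) + ly\<^sup>2 / (ay + wy))"
      using eg by (simp_all add: gap_def[abs_def] pop_gap_def pop_def)
    note this(2)
    also have "\<dots> \<le> \<eta> / 3"
      using size n \<open>\<eta> > 0\<close> by (simp add: field_simps)
    finally have E: "Pn.expectation gap \<le> \<eta> / 3" .
    have gap_nn: "0 \<le> gap \<xi>" for \<xi>
    proof -
      have "saa ?n ?p ?q \<xi> \<in> X \<times> Y" by (rule saa_in[OF strong_pen(1)[OF w(1)] strong_pen(2)[OF w(2)] n])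
      then show ?thesis
        using pop_saddle_point[OF w, of "xc \<omega>" "yc \<omega>"]
        unfolding gap_def pop_gap_def saddle_point_def by (auto simp: mem_Times_iff intro: order_trans)
    qed
    have "Pn.prob G \<ge> 2 / 3" unfolding G_def
      using gap_nn by (intro Pn.prob_le_of_expectation_le gap_int E \<open>\<eta> > 0\<close>)
    moreover have "G \<in> sets ?Pn" unfolding G_def
      using gap_int by (intro borel_measurable_le) auto
    moreover have "pop_gap wx (xc \<omega>') wy (yc \<omega>') (SAA Q ?n wx wy (xc \<omega>') (yc \<omega>') (\<lambda>l. \<omega>' (s, j, l))) \<le> \<eta>"
      if ag: "agree_before (stage_time c s) \<omega>' \<omega>" and G': "(\<lambda>i\<in>{..<?n}. \<omega>' (s, j, i)) \<in> G" for \<omega>' j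
    proof -
      have "saa ?n ?p ?q (\<lambda>i\<in>{..<?n}. \<omega>' (s, j, i)) = saa ?n ?p ?q (\<lambda>l. \<omega>' (s, j, l))"
        by (rule saa_cong) simp
      with past[OF ag] G' show ?thesis by (simp add: SAA_eq_saa[OF n] G_def gap_def)
    qed
    ultimately show "\<exists>G\<in>sets ?Pn. 2 / 3 \<le> Pn.prob G \<and> (\<forall>\<omega>' j. agree_before (stage_time c s) \<omega>' \<omega> \<longrightarrow>
        (\<lambda>i\<in>{..<?n}. \<omega>' (s, j, i)) \<in> G \<longrightarrow>
        pop_gap wx (xc \<omega>') wy (yc \<omega>') (SAA Q ?n wx wy (xc \<omega>') (yc \<omega>') (\<lambda>l. \<omega>' (s, j, l))) \<le> \<eta>)" by blast
qed

text \<open>Given the past the evaluation point is fixed, and the average concentrates around the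
  mean at that point. Joint measurability of \<open>g\<close> makes both measurable when the point
  is random.\<close>

lemma gradient_stage_failure:
  fixes g :: "'s \<Rightarrow> 'x \<times> 'y \<Rightarrow> 'v::euclidean_space"
  assumes s: "s \<in> stages c"
    and g: "(\<lambda>(\<xi>, v). g \<xi> v) \<in> borel_measurable (P \<Otimes>\<^sub>M restrict_space borel (X \<times> Y))"
    and bd: "\<And>\<xi> v. v \<in> X \<times> Y \<Longrightarrow> norm (g \<xi> v) \<le> b"
    and z: "z \<in> borel_measurable \<Omega>" and z_in: "\<And>\<omega>. z \<omega> \<in> X \<times> Y"
    and past: "\<And>\<omega> \<omega>'. agree_before (stage_time c s) \<omega> \<omega>' \<Longrightarrow> z \<omega> = z \<omega>'"
    and "\<eta> > 0" and size: "3 * (2 * b)\<^sup>2 / \<eta>\<^sup>2 \<le> real (batch_size c s)"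
  defines "B \<equiv> {\<omega> \<in> space \<Omega>. real (card {j. j < m \<and> norm ((1 / real (batch_size c s)) *\<^sub>R
      (\<Sum>i<batch_size c s. g (\<omega> (s, j, i)) (z \<omega>)) - (\<integral>\<xi>. g \<xi> (z \<omega>) \<partial>P)) \<le> \<eta>}) \<le> real m / 2}"
  shows "B \<in> sets \<Omega> \<and> \<Omega>.prob B \<le> exp (- real m / 18)"
  unfolding B_def
proof (rule stage_failure[OF s])
  let ?n = "batch_size c s" and ?R = "restrict_space borel (X \<times> Y)"
  have zR: "z \<in> measurable \<Omega> ?R" using z z_in by (intro measurable_restrict_space2) auto
  have g': "(\<lambda>w. g (u w) (v w)) \<in> borel_measurable M" if "u \<in> measurable M P" "v \<in> measurable M ?R"
    for u v and M :: "'w measure"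
    using measurable_compose[OF measurable_Pair[OF that] g] by simp
  have "(\<lambda>w. g (snd w) (z (fst w))) \<in> borel_measurable (\<Omega> \<Otimes>\<^sub>M P)"
    by (intro g' measurable_snd measurable_compose[OF measurable_fst zR])
  then have mean: "(\<lambda>\<omega>. \<integral>\<xi>. g \<xi> (z \<omega>) \<partial>P) \<in> borel_measurable \<Omega>"
    by (intro borel_measurable_lebesgue_integral) (simp add: case_prod_unfold)
  have comp: "(\<lambda>\<omega>. \<omega> (s, j, i)) \<in> measurable \<Omega> P" if "j < m" "i < ?n" for j i
    unfolding sample_space_def using s that by (intro measurable_component_singleton) (simp add: sample_index_def)
  have sum_measurable: "(\<lambda>\<omega>. \<Sum>i<?n. g (\<omega> (s, j, i)) (z \<omega>)) \<in> borel_measurable \<Omega>" if "j < m" for j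
    using that by (intro borel_measurable_sum g' comp zR) auto
  have "(\<lambda>\<omega>. norm ((1 / real ?n) *\<^sub>R (\<Sum>i<?n. g (\<omega> (s, j, i)) (z \<omega>)) - (\<integral>\<xi>. g \<xi> (z \<omega>) \<partial>P))) \<in> borel_measurable \<Omega>"
    if "j < m" for j
  proof -
    note [measurable] = sum_measurable[OF that] mean
    show ?thesis by measurable
  qed
  then show "{\<omega> \<in> space \<Omega>. norm ((1 / real ?n) *\<^sub>R (\<Sum>i<?n. g (\<omega> (s, j, i)) (z \<omega>)) - (\<integral>\<xi>. g \<xi> (z \<omega>) \<partial>P)) \<le> \<eta>} \<in> sets \<Omega>"
    if "j < m" for j
    using that by (intro borel_measurable_le borel_measurable_const)
  fix \<omega>
    let ?Pn = "Pi\<^sub>M {..<?n} (\<lambda>_. P)"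
    define G where "G = {\<xi> \<in> space ?Pn. norm ((1 / real ?n) *\<^sub>R (\<Sum>i<?n. g (\<xi> i) (z \<omega>)) - (\<integral>\<xi>. g \<xi> (z \<omega>) \<partial>P)) \<le> \<eta>}"
    have "(\<lambda>\<xi>. g \<xi> (z \<omega>)) \<in> borel_measurable P"
      using z_in[of \<omega>] by (intro g' measurable_ident_sets measurable_const) (auto simp: space_restrict_space)
    from sample_mean_near[OF this bd[OF z_in] \<open>\<eta> > 0\<close> batch_size_pos size]
    have "G \<in> sets ?Pn" "measure ?Pn G \<ge> 2 / 3" unfolding G_def by blast+
    moreover have "norm ((1 / real ?n) *\<^sub>R (\<Sum>i<?n. g (\<omega>' (s, j, i)) (z \<omega>')) - (\<integral>\<xi>. g \<xi> (z \<omega>') \<partial>P)) \<le> \<eta>"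
      if "agree_before (stage_time c s) \<omega>' \<omega>" "(\<lambda>i\<in>{..<?n}. \<omega>' (s, j, i)) \<in> G" for \<omega>' j
      using that(2) unfolding past[OF that(1)] by (simp add: G_def)
    ultimately show "\<exists>G\<in>sets ?Pn. 2 / 3 \<le> measure ?Pn G \<and> (\<forall>\<omega>' j. agree_before (stage_time c s) \<omega>' \<omega> \<longrightarrow>
        (\<lambda>i\<in>{..<?n}. \<omega>' (s, j, i)) \<in> G \<longrightarrow>
        norm ((1 / real ?n) *\<^sub>R (\<Sum>i<?n. g (\<omega>' (s, j, i)) (z \<omega>')) - (\<integral>\<xi>. g \<xi> (z \<omega>') \<partial>P)) \<le> \<eta>)" by blast
qed

text \<open>The gap thresholds are three times the expected gaps for which the batches are sized,
  for instance \<open>eta_x c\<close> against \<open>eta_x c / 3\<close> in the oracle call; the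
  factor is spent on Markov's inequality. Gradients are compared with those of the regularized
  population objective at the random evaluation point.\<close>

fun good :: "stage \<Rightarrow> (stage \<times> nat \<times> nat \<Rightarrow> 's) \<Rightarrow> nat \<Rightarrow> bool" where
  "good (Center_x i) \<omega> j \<longleftrightarrow> pop_gap (lam ax i) (center_x Q c K \<omega> i) 0 0
     (solve_x Q c \<omega> (Center_x i) i (center_x Q c K \<omega> i) j) \<le> \<delta> / 9"
| "good (Center_y i) \<omega> j \<longleftrightarrow> pop_gap 0 0 (lam ay i) (center_y Q c K \<omega> i)
     (solve_y Q c \<omega> (Center_y i) i (center_y Q c K \<omega> i) j) \<le> \<delta> / 9"
| "good Gap_x \<omega> j \<longleftrightarrow> pop_gap (lamT_x c) (centerT_x Q c K \<omega>) 0 0 (gap_candidate_x Q c K \<omega> j) \<le> eta_x c"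
| "good Gap_y \<omega> j \<longleftrightarrow> pop_gap 0 0 (lamT_y c) (centerT_y Q c K \<omega>) (gap_candidate_y Q c K \<omega> j) \<le> eta_y c"
| "good Grad_x \<omega> j \<longleftrightarrow> norm (batch_grad_x Q c K \<omega> j - (gx (fst (grad_point_x Q c K \<omega>)) (snd (grad_point_x Q c K \<omega>))
     + ax *\<^sub>R (fst (grad_point_x Q c K \<omega>) - x'))) \<le> delta_grad_x c"
| "good Grad_y \<omega> j \<longleftrightarrow> norm (batch_grad_y Q c K \<omega> j - (gy (fst (grad_point_y Q c K \<omega>)) (snd (grad_point_y Q c K \<omega>))
     - ay *\<^sub>R (snd (grad_point_y Q c K \<omega>) - y'))) \<le> delta_grad_y c"

definition failure :: "stage \<Rightarrow> (stage \<times> nat \<times> nat \<Rightarrow> 's) set" where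
  "failure s = {\<omega> \<in> space \<Omega>. real (card {j. j < m \<and> good s \<omega> j}) \<le> real m / 2}"

lemma failure_bound:
  assumes s: "s \<in> stages c"
  shows "failure s \<in> sets \<Omega> \<and> \<Omega>.prob (failure s) \<le> exp (- real m / 18)"
proof (cases s)
  case (Center_x i)
  then have i: "i \<le> T" using s by (auto simp: stages_def)
  have size: "6 / (\<delta> / 9) * (lx\<^sup>2 / (ax + lam ax i) + ly\<^sup>2 / (ay + 0)) \<le> real (batch_size c s)"
    using raw_size_le[of s] by (simp add: Center_x del: lam.simps)
  have eq: "failure s = {\<omega> \<in> space \<Omega>. real (card {j. j < m \<and> pop_gap (lam ax i) (center_x Q c K \<omega> i) (0) (0)
      (SAA Q (batch_size c s) (lam ax i) (0) (center_x Q c K \<omega> i) (0) (\<lambda>l. \<omega> (s, j, l))) \<le> \<delta> / 9}) \<le> real m / 2}"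
    unfolding failure_def Center_x good.simps solve_x_def  c_simps ..
  show ?thesis unfolding eq
  proof (rule saddle_stage_failure[OF s, where xc = "\<lambda>\<omega>. center_x Q c K \<omega> i" and yc = "\<lambda>\<omega>. 0"])
    show "(\<lambda>\<omega>. center_x Q c K \<omega> i) \<in> borel_measurable \<Omega>" "(\<lambda>\<omega>. 0) \<in> borel_measurable \<Omega>"
      using center_x_measurable[of i] i by simp_all
    show "(\<lambda>\<omega>. center_x Q c K \<omega> i) \<omega> = (\<lambda>\<omega>. center_x Q c K \<omega> i) \<omega>' \<and> (\<lambda>\<omega>. 0) \<omega> = (\<lambda>\<omega>. 0) \<omega>'"
      if "agree_before (stage_time c s) \<omega> \<omega>'" for \<omega> \<omega>'
      using center_x_cong[OF that, of i] by (simp add: Center_x)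
  qed (use size delta_pos eta_pos lamT_pos pos in \<open>auto intro: lam_nonneg\<close>)
next
  case (Center_y i)
  then have i: "i \<le> T" using s by (auto simp: stages_def)
  have size: "6 / (\<delta> / 9) * (lx\<^sup>2 / (ax + 0) + ly\<^sup>2 / (ay + lam ay i)) \<le> real (batch_size c s)"
    using raw_size_le[of s] by (simp add: Center_y del: lam.simps)
  have eq: "failure s = {\<omega> \<in> space \<Omega>. real (card {j. j < m \<and> pop_gap (0) (0) (lam ay i) (center_y Q c K \<omega> i)
      (SAA Q (batch_size c s) (0) (lam ay i) (0) (center_y Q c K \<omega> i) (\<lambda>l. \<omega> (s, j, l))) \<le> \<delta> / 9}) \<le> real m / 2}"
    unfolding failure_def Center_y good.simps solve_y_def  c_simps ..
  show ?thesis unfolding eq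
  proof (rule saddle_stage_failure[OF s, where xc = "\<lambda>\<omega>. 0" and yc = "\<lambda>\<omega>. center_y Q c K \<omega> i"])
    show "(\<lambda>\<omega>. 0) \<in> borel_measurable \<Omega>" "(\<lambda>\<omega>. center_y Q c K \<omega> i) \<in> borel_measurable \<Omega>"
      using center_y_measurable[of i] i by simp_all
    show "(\<lambda>\<omega>. 0) \<omega> = (\<lambda>\<omega>. 0) \<omega>' \<and> (\<lambda>\<omega>. center_y Q c K \<omega> i) \<omega> = (\<lambda>\<omega>. center_y Q c K \<omega> i) \<omega>'"
      if "agree_before (stage_time c s) \<omega> \<omega>'" for \<omega> \<omega>'
      using center_y_cong[OF that, of i] by (simp add: Center_y)
  qed (use size delta_pos eta_pos lamT_pos pos in \<open>auto intro: lam_nonneg\<close>)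
next
  case Gap_x
  have size: "6 / (eta_x c) * (lx\<^sup>2 / (ax + lamT_x c) + ly\<^sup>2 / (ay + 0)) \<le> real (batch_size c s)"
    using raw_size_le[of s] by (simp add: Gap_x del: lam.simps)
  have eq: "failure s = {\<omega> \<in> space \<Omega>. real (card {j. j < m \<and> pop_gap (lamT_x c) (centerT_x Q c K \<omega>) (0) (0)
      (SAA Q (batch_size c s) (lamT_x c) (0) (centerT_x Q c K \<omega>) (0) (\<lambda>l. \<omega> (s, j, l))) \<le> eta_x c}) \<le> real m / 2}"
    unfolding failure_def Gap_x good.simps solve_x_def gap_candidate_x_def lamT_simps c_simps ..
  show ?thesis unfolding eq
  proof (rule saddle_stage_failure[OF s, where xc = "centerT_x Q c K" and yc = "\<lambda>\<omega>. 0"])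
    show "centerT_x Q c K \<in> borel_measurable \<Omega>" "(\<lambda>\<omega>. 0) \<in> borel_measurable \<Omega>"
      using center_x_measurable[of "Suc T"] by (simp_all add: centerT_x_def[abs_def])
    show "(centerT_x Q c K) \<omega> = (centerT_x Q c K) \<omega>' \<and> (\<lambda>\<omega>. 0) \<omega> = (\<lambda>\<omega>. 0) \<omega>'"
      if "agree_before (stage_time c s) \<omega> \<omega>'" for \<omega> \<omega>'
      using center_x_cong[OF that, of "Suc T"] by (simp add: Gap_x centerT_x_def)
  qed (use size delta_pos eta_pos lamT_pos pos in \<open>auto intro: lam_nonneg\<close>)
next
  case Gap_y
  have size: "6 / (eta_y c) * (lx\<^sup>2 / (ax + 0) + ly\<^sup>2 / (ay + lamT_y c)) \<le> real (batch_size c s)"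
    using raw_size_le[of s] by (simp add: Gap_y del: lam.simps)
  have eq: "failure s = {\<omega> \<in> space \<Omega>. real (card {j. j < m \<and> pop_gap (0) (0) (lamT_y c) (centerT_y Q c K \<omega>)
      (SAA Q (batch_size c s) (0) (lamT_y c) (0) (centerT_y Q c K \<omega>) (\<lambda>l. \<omega> (s, j, l))) \<le> eta_y c}) \<le> real m / 2}"
    unfolding failure_def Gap_y good.simps solve_y_def gap_candidate_y_def lamT_simps c_simps ..
  show ?thesis unfolding eq
  proof (rule saddle_stage_failure[OF s, where xc = "\<lambda>\<omega>. 0" and yc = "centerT_y Q c K"])
    show "(\<lambda>\<omega>. 0) \<in> borel_measurable \<Omega>" "centerT_y Q c K \<in> borel_measurable \<Omega>"
      using center_y_measurable[of "Suc T"] by (simp_all add: centerT_y_def[abs_def])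
    show "(\<lambda>\<omega>. 0) \<omega> = (\<lambda>\<omega>. 0) \<omega>' \<and> (centerT_y Q c K) \<omega> = (centerT_y Q c K) \<omega>'"
      if "agree_before (stage_time c s) \<omega> \<omega>'" for \<omega> \<omega>'
      using center_y_cong[OF that, of "Suc T"] by (simp add: Gap_y centerT_y_def)
  qed (use size delta_pos eta_pos lamT_pos pos in \<open>auto intro: lam_nonneg\<close>)
next
  case Grad_x
  let ?n = "batch_size c s"
  have n: "?n > 0" by (rule batch_size_pos)
  \<comment> \<open>The regularization adds the same vector to the average and to its mean. The
    deviation is therefore that of the unregularized sample gradient, bounded by
    \<open>2 * lx\<close> per sample.\<close>
  have dev: "batch_grad_x Q c K \<omega> j - (gx (fst (grad_point_x Q c K \<omega>)) (snd (grad_point_x Q c K \<omega>)) + ax *\<^sub>R (fst (grad_point_x Q c K \<omega>) - x')) =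
      (1 / real ?n) *\<^sub>R (\<Sum>i<?n. fgx (\<omega> (s, j, i)) (fst (grad_point_x Q c K \<omega>)) (snd (grad_point_x Q c K \<omega>))) -
      (\<integral>\<xi>. fgx \<xi> (fst (grad_point_x Q c K \<omega>)) (snd (grad_point_x Q c K \<omega>)) \<partial>P)" for \<omega> j
    using unbiased[of "fst (grad_point_x Q c K \<omega>)" "snd (grad_point_x Q c K \<omega>)"] grad_point_in(1)[of \<omega>] n
    by (simp add: Grad_x batch_grad_x_def sum.distrib scaleR_add_right sum_constant_scaleR mem_Times_iff)
  have eq: "failure s = {\<omega> \<in> space \<Omega>. real (card {j. j < m \<and> norm ((1 / real ?n) *\<^sub>R
      (\<Sum>i<?n. fgx (\<omega> (s, j, i)) (fst (grad_point_x Q c K \<omega>)) (snd (grad_point_x Q c K \<omega>))) -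
      (\<integral>\<xi>. fgx \<xi> (fst (grad_point_x Q c K \<omega>)) (snd (grad_point_x Q c K \<omega>)) \<partial>P)) \<le> delta_grad_x c}) \<le> real m / 2}"
    unfolding failure_def dev[symmetric] unfolding Grad_x good.simps ..
  show ?thesis unfolding eq
  proof (rule gradient_stage_failure[OF s, where g = "\<lambda>\<xi> v. fgx \<xi> (fst v) (snd v)" and z = "grad_point_x Q c K" and b = lx])
    show "(\<lambda>(\<xi>, v). fgx \<xi> (fst v) (snd v)) \<in> borel_measurable (P \<Otimes>\<^sub>M restrict_space borel (X \<times> Y))"
      using fgx_measurable by (simp add: case_prod_unfold)
    show "grad_point_x Q c K \<omega> = grad_point_x Q c K \<omega>'" if "agree_before (stage_time c s) \<omega> \<omega>'" for \<omega> \<omega>'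
      using that by (intro grad_point_x_cong) (simp add: Grad_x)
    show "3 * (2 * lx)\<^sup>2 / (delta_grad_x c)\<^sup>2 \<le> real ?n"
      using raw_size_le[of s] by (simp add: Grad_x)
  qed (use fg_bound grad_point_measurable grad_point_in delta_grad_pos in \<open>auto simp: mem_Times_iff\<close>)
next
  case Grad_y
  let ?n = "batch_size c s"
  have n: "?n > 0" by (rule batch_size_pos)
  have dev: "batch_grad_y Q c K \<omega> j - (gy (fst (grad_point_y Q c K \<omega>)) (snd (grad_point_y Q c K \<omega>)) - ay *\<^sub>R (snd (grad_point_y Q c K \<omega>) - y')) =
      (1 / real ?n) *\<^sub>R (\<Sum>i<?n. fgy (\<omega> (s, j, i)) (fst (grad_point_y Q c K \<omega>)) (snd (grad_point_y Q c K \<omega>))) -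
      (\<integral>\<xi>. fgy \<xi> (fst (grad_point_y Q c K \<omega>)) (snd (grad_point_y Q c K \<omega>)) \<partial>P)" for \<omega> j
    using unbiased[of "fst (grad_point_y Q c K \<omega>)" "snd (grad_point_y Q c K \<omega>)"] grad_point_in(2)[of \<omega>] n
    by (simp add: Grad_y batch_grad_y_def sum_subtractf scaleR_diff_right sum_constant_scaleR mem_Times_iff)
  have eq: "failure s = {\<omega> \<in> space \<Omega>. real (card {j. j < m \<and> norm ((1 / real ?n) *\<^sub>R
      (\<Sum>i<?n. fgy (\<omega> (s, j, i)) (fst (grad_point_y Q c K \<omega>)) (snd (grad_point_y Q c K \<omega>))) -
      (\<integral>\<xi>. fgy \<xi> (fst (grad_point_y Q c K \<omega>)) (snd (grad_point_y Q c K \<omega>)) \<partial>P)) \<le> delta_grad_y c}) \<le> real m / 2}"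
    unfolding failure_def dev[symmetric] unfolding Grad_y good.simps ..
  show ?thesis unfolding eq
  proof (rule gradient_stage_failure[OF s, where g = "\<lambda>\<xi> v. fgy \<xi> (fst v) (snd v)" and z = "grad_point_y Q c K" and b = ly])
    show "(\<lambda>(\<xi>, v). fgy \<xi> (fst v) (snd v)) \<in> borel_measurable (P \<Otimes>\<^sub>M restrict_space borel (X \<times> Y))"
      using fgy_measurable by (simp add: case_prod_unfold)
    show "grad_point_y Q c K \<omega> = grad_point_y Q c K \<omega>'" if "agree_before (stage_time c s) \<omega> \<omega>'" for \<omega> \<omega>'
      using that by (intro grad_point_y_cong) (simp add: Grad_y)
    show "3 * (2 * ly)\<^sup>2 / (delta_grad_y c)\<^sup>2 \<le> real ?n"
      using raw_size_le[of s] by (simp add: Grad_y)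
  qed (use fg_bound grad_point_measurable grad_point_in delta_grad_pos in \<open>auto simp: mem_Times_iff\<close>)
qed

lemma failure_Union:
  "(\<Union>s\<in>stages c. failure s) \<in> sets \<Omega>" "\<Omega>.prob (\<Union>s\<in>stages c. failure s) \<le> p"
proof -
  show "(\<Union>s\<in>stages c. failure s) \<in> sets \<Omega>"
    using failure_bound finite_stages by (intro sets.finite_UN) auto
  have "\<Omega>.prob (\<Union>s\<in>stages c. failure s) \<le> (\<Sum>s\<in>stages c. \<Omega>.prob (failure s))"
    using failure_bound finite_stages by (intro \<Omega>.finite_measure_subadditive_finite) auto
  also have "\<dots> \<le> (\<Sum>s\<in>stages c. exp (- real m / 18))"
    using failure_bound by (intro sum_mono) auto
  also have "\<dots> \<le> (2 * real T + 6) * exp (- real m / 18)"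
    using of_nat_mono[OF card_stages_le, where 'a = real] by (simp add: mult_right_mono)
  also have "\<dots> \<le> (2 * real T + 6) * exp (- ln ((2 * real T + 6) / p))"
    using reps_ge by (intro mult_left_mono) auto
  also have "exp (- ln ((2 * real T + 6) / p)) = p / (2 * real T + 6)"
    using pos by (simp add: exp_minus)
  also have "(2 * real T + 6) * (p / (2 * real T + 6)) = p"
  proof -
    have "2 * real T + 6 \<noteq> 0" by linarith
    then show ?thesis by simp
  qed
  finally show "\<Omega>.prob (\<Union>s\<in>stages c. failure s) \<le> p" .
qed

end

section \<open>Correctness of a run\<close>

text \<open>Extraction sees only mutual distances among the first \<open>m\<close> points. This
  covers isometries such as a change of sign, and changes at indices out of range.\<close>

lemma extract_set_cong:
  assumes "\<And>j k. j < m \<Longrightarrow> k < m \<Longrightarrow> \<rho> (z j) (z k) = \<rho>' (z' j) (z' k)"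
  shows "extract_set m \<rho> z = extract_set m \<rho>' z'"
proof -
  have r: "extract_radius m \<rho> z j = extract_radius m \<rho>' z' j" if "j < m" for j
  proof -
    have "{k. k < m \<and> \<rho> (z j) (z k) \<le> r} = {k. k < m \<and> \<rho>' (z' j) (z' k) \<le> r}" for r
      using assms[OF that] by auto
    then show ?thesis by (simp add: extract_radius_def)
  qed
  then have map: "map (extract_radius m \<rho> z) [0..<m] = map (extract_radius m \<rho>' z') [0..<m]" by simp
  show ?thesis using r unfolding extract_set_def Let_def map by auto
qed

context boosted_saa
begin

lemma pop_weight_x: "pop wx xc 0 0 = (\<lambda>x y. pop 0 0 0 0 x y + wx / 2 * (norm (x - xc))\<^sup>2)"
  by (simp add: pop_def penalty_def fun_eq_iff)

lemma pop_weight_y: "pop 0 0 wy yc = (\<lambda>x y. pop 0 0 0 0 x y - wy / 2 * (norm (y - yc))\<^sup>2)"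
  by (simp add: pop_def penalty_def fun_eq_iff)

lemma majority:
  assumes "\<omega> \<in> space \<Omega>" "\<omega> \<notin> failure s"
  shows "real (card {j. j < m \<and> good s \<omega> j}) > real m / 2"
  using assms by (simp add: failure_def not_le)

lemma pop_derivative_x:
  assumes "x \<in> X" "y \<in> Y"
  shows "((\<lambda>u. pop 0 0 0 0 u y) has_derivative (\<lambda>d. (gx x y + ax *\<^sub>R (x - x')) \<bullet> d)) (at x within X)"
proof -
  have "((\<lambda>u. ax / 2 * ((u - x') \<bullet> (u - x')) - pen_y 0 0 y) has_derivative
      (\<lambda>d. (ax *\<^sub>R (x - x')) \<bullet> d)) (at x within X)"
    by (auto intro!: derivative_eq_intros simp: fun_eq_iff inner_commute algebra_simps)
  with gradient[OF assms] have "((\<lambda>u. \<Phi> u y + (ax / 2 * ((u - x') \<bullet> (u - x')) - pen_y 0 0 y)) has_derivative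
      (\<lambda>d. gx x y \<bullet> d + (ax *\<^sub>R (x - x')) \<bullet> d)) (at x within X)"
    by (intro has_derivative_add) auto
  then show ?thesis
    by (simp add: pop_def penalty_def power2_norm_eq_inner inner_add_left add_diff_eq)
qed

lemma pop_derivative_y:
  assumes "x \<in> X" "y \<in> Y"
  shows "((\<lambda>v. - pop 0 0 0 0 x v) has_derivative (\<lambda>d. - (gy x y - ay *\<^sub>R (y - y')) \<bullet> d)) (at y within Y)"
proof -
  have "((\<lambda>v. ay / 2 * ((v - y') \<bullet> (v - y')) - pen_x 0 0 x) has_derivative
      (\<lambda>d. (ay *\<^sub>R (y - y')) \<bullet> d)) (at y within Y)"
    by (auto intro!: derivative_eq_intros simp: fun_eq_iff inner_commute algebra_simps)
  moreover have "((\<lambda>v. - \<Phi> x v) has_derivative (\<lambda>d. - (gy x y \<bullet> d))) (at y within Y)"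
    using gradient[OF assms] by (intro has_derivative_minus) auto
  ultimately have "((\<lambda>v. - \<Phi> x v + (ay / 2 * ((v - y') \<bullet> (v - y')) - pen_x 0 0 x)) has_derivative
      (\<lambda>d. - (gy x y \<bullet> d) + (ay *\<^sub>R (y - y')) \<bullet> d)) (at y within Y)"
    by (intro has_derivative_add)
  moreover have "- \<Phi> x v + (ay / 2 * ((v - y') \<bullet> (v - y')) - pen_x 0 0 x) = - pop 0 0 0 0 x v" for v
    by (simp add: pop_def penalty_def power2_norm_eq_inner)
  moreover have "- (gy x y \<bullet> d) + (ay *\<^sub>R (y - y')) \<bullet> d = - (gy x y - ay *\<^sub>R (y - y')) \<bullet> d" for d
    by (simp only: inner_minus_left inner_diff_left)
  ultimately show ?thesis by simp
qed

lemma eta_gap_const: "eta_x c * gap_const_x c = \<delta>" "eta_y c * gap_const_y c = \<delta>"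
  using gap_const_pos by (simp_all add: eta_x_def eta_y_def)

lemma output_x_bound:
  assumes \<omega>: "\<omega> \<in> space \<Omega>" and valid: "valid_picks Q c K \<omega>" and ok: "\<And>s. s \<in> stages c \<Longrightarrow> \<omega> \<notin> failure s"
    and y: "y \<in> Y"
  defines "z0 \<equiv> pop_saddle 0 0 0 0"
  shows "pop 0 0 0 0 (output_x Q c K \<omega>) y \<le> pop 0 0 0 0 (fst z0) (snd z0) + (2 * real T + 2) * \<delta>"
proof -
  let ?c = "center_x Q c K \<omega>"
  let ?s = "\<lambda>i. pop_saddle (lam ax i) (?c i) 0 0"
  note maj = majority[OF \<omega> ok]
  have "pop 0 0 0 0 (fst (gap_candidate_x Q c K \<omega> (pick c K \<omega> Grad_x 2))) y \<le>
    pop 0 0 0 0 (fst (?s 0)) (snd (?s 0)) + (2 * real T + 2) * \<delta>"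
  proof (rule boosted_side[where X = X and \<nu> = ay and \<mu> = ax and L = "Lx + ax" and M = Lxy and \<eta> = "eta_x c" and T = T
        and H = "\<lambda>i. pop (lam ax i) (?c i) 0 0" and s = ?s and c = ?c and m = m
        and zs = "\<lambda>i. solve_x Q c \<omega> (Center_x i) i (?c i)" and ks = "\<lambda>i. pick c K \<omega> (Center_x i) 1"
        and g = "\<lambda>x y. gx x y + ax *\<^sub>R (x - x')" and z = "gap_candidate_x Q c K \<omega>"
        and ?k1.0 = "pick c K \<omega> Gap_x 1" and ?k2.0 = "pick c K \<omega> Gap_x 2" and G = "batch_grad_x Q c K \<omega>"
        and kG = "pick c K \<omega> Grad_x 1" and v = "direction_x Q c K \<omega>"])
    show "strong_saddle X Y (ax + lam ax i) ay (pop (lam ax i) (?c i) 0 0)" for i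
      using pop_strong_saddle[of "lam ax i" 0 "?c i" 0] by simp
    show "saddle_point X Y (pop (lam ax i) (?c i) 0 0) (?s i)" for i
      by (rule pop_saddle_point) auto
    show "real m / 2 < real (card {j. j < m \<and>
        pop (lam ax i) (?c i) 0 0 (fst (solve_x Q c \<omega> (Center_x i) i (?c i) j)) (snd (?s i)) -
        pop (lam ax i) (?c i) 0 0 (fst (?s i)) (snd (solve_x Q c \<omega> (Center_x i) i (?c i) j)) \<le> \<delta> / 9})"
      if "i \<le> T" for i
      using maj[OF stages_I(1)[OF that]] by (simp add: pop_gap_def)
    show "real m / 2 < real (card {j. j < m \<and>
        pop (lam ax (Suc T)) (?c (Suc T)) 0 0 (fst (gap_candidate_x Q c K \<omega> j)) (snd (?s (Suc T))) -
        pop (lam ax (Suc T)) (?c (Suc T)) 0 0 (fst (?s (Suc T))) (snd (gap_candidate_x Q c K \<omega> j)) \<le> eta_x c})"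
      using maj[OF stages_I(3)] by (simp add: pop_gap_def centerT_x_def lamT_simps del: lam.simps center_x.simps)
    show "real m / 2 < real (card {j. j < m \<and> norm (batch_grad_x Q c K \<omega> j -
        (gx (fst (gap_candidate_x Q c K \<omega> (pick c K \<omega> Gap_x 1))) (snd (gap_candidate_x Q c K \<omega> (pick c K \<omega> Gap_x 2))) +
         ax *\<^sub>R (fst (gap_candidate_x Q c K \<omega> (pick c K \<omega> Gap_x 1)) - x')))
        \<le> (Lx + ax + lam ax (Suc T)) * sqrt (eta_x c / (ax + lam ax (Suc T)))})"
      using maj[OF stages_I(5)]
      by (simp add: grad_point_x_def combine_def delta_grad_x_def lamT_simps del: lam.simps)
    show "eta_x c * (3 + (18 * sqrt 2 + 45) * ((Lx + ax + lam ax (Suc T)) / (ax + lam ax (Suc T))) +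
        36 * Lxy / sqrt ((ax + lam ax (Suc T)) * ay) + 9 * Lxy\<^sup>2 / ((ax + lam ax (Suc T)) * ay)) = \<delta>"
      using eta_gap_const(1) by (simp add: gap_const_x_def lamT_simps del: lam.simps)
    show "norm (gx x1 y + ax *\<^sub>R (x1 - x') - (gx x2 y + ax *\<^sub>R (x2 - x'))) \<le> (Lx + ax) * norm (x1 - x2)"
      if "x1 \<in> X" "x2 \<in> X" "y \<in> Y" for x1 x2 y
    proof -
      have "gx x1 y + ax *\<^sub>R (x1 - x') - (gx x2 y + ax *\<^sub>R (x2 - x')) = (gx x1 y - gx x2 y) + ax *\<^sub>R (x1 - x2)"
        by (simp add: algebra_simps)
      also have "norm \<dots> \<le> Lx * norm (x1 - x2) + ax * norm (x1 - x2)"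
        using smooth_x[OF that] pos by (intro norm_triangle_mono) auto
      finally show ?thesis by (simp add: algebra_simps)
    qed
    show "direction_x Q c K \<omega> = batch_grad_x Q c K \<omega> (pick c K \<omega> Grad_x 1) +
        lam ax (Suc T) *\<^sub>R (fst (gap_candidate_x Q c K \<omega> (pick c K \<omega> Gap_x 1)) - ?c (Suc T))"
      by (simp add: direction_x_def grad_point_x_def combine_def lamT_simps centerT_x_def del: lam.simps center_x.simps)
    show "?c (Suc i) = fst (solve_x Q c \<omega> (Center_x i) i (?c i) (pick c K \<omega> (Center_x i) 1))" for i
      by (simp add: combine_def)
    show "pop (lam ax i) (?c i) 0 0 = (\<lambda>x y. pop 0 0 0 0 x y + lam ax i / 2 * (norm (x - ?c i))\<^sup>2)" for i
      by (rule pop_weight_x)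
    show "((\<lambda>u. pop 0 0 0 0 u y) has_derivative (\<lambda>d. (gx x y + ax *\<^sub>R (x - x')) \<bullet> d)) (at x within X)"
      if "x \<in> X" "y \<in> Y" for x y
      by (rule pop_derivative_x[OF that])
    show "norm (gx x y1 + ax *\<^sub>R (x - x') - (gx x y2 + ax *\<^sub>R (x - x'))) \<le> Lxy * norm (y1 - y2)"
      if "x \<in> X" "y1 \<in> Y" "y2 \<in> Y" for x y1 y2
      using smooth_y[OF that] by simp
    show "solve_x Q c \<omega> (Center_x i) i (?c i) j \<in> X \<times> Y" "gap_candidate_x Q c K \<omega> j \<in> X \<times> Y" for i j
      by (rule solve_in(1), rule gap_candidate_in(1))
  qed (use valid pos delta_pos eta_pos y in
      \<open>auto simp: valid_picks_def Let_def simp del: lam.simps center_x.simps center_y.simps\<close>)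
  \<comment> \<open>Round 0 has weight 0 and center 0, so its saddle point is
    \<open>z0\<close>.\<close>
  then show ?thesis by (simp add: output_x_def z0_def)
qed

text \<open>\<open>boosted_side\<close> is applied to the negated objective with the players
  exchanged. The picks of the second components become the first ones, and batch gradients and
  direction change sign.\<close>

lemma output_y_bound:
  assumes \<omega>: "\<omega> \<in> space \<Omega>" and valid: "valid_picks Q c K \<omega>" and ok: "\<And>s. s \<in> stages c \<Longrightarrow> \<omega> \<notin> failure s"
    and x: "x \<in> X"
  defines "z0 \<equiv> pop_saddle 0 0 0 0"
  shows "- pop 0 0 0 0 x (output_y Q c K \<omega>) \<le> - pop 0 0 0 0 (fst z0) (snd z0) + (2 * real T + 2) * \<delta>"
proof -
  let ?c = "center_y Q c K \<omega>"
  let ?s = "\<lambda>i. pop_saddle 0 0 (lam ay i) (?c i)"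
  let ?z = "gap_candidate_y Q c K \<omega>"
  let ?zs = "\<lambda>i. solve_y Q c \<omega> (Center_y i) i (?c i)"
  note maj = majority[OF \<omega> ok]
  have extract_neg: "extract_set m dist (\<lambda>j. - batch_grad_y Q c K \<omega> j) = extract_set m dist (batch_grad_y Q c K \<omega>)"
    by (rule extract_set_cong) (simp only: dist_norm minus_diff_minus norm_minus_cancel)
  have "- pop 0 0 0 0 x (fst (prod.swap (?z (pick c K \<omega> Grad_y 2)))) \<le>
    - pop 0 0 0 0 (snd (prod.swap (?s 0))) (fst (prod.swap (?s 0))) + (2 * real T + 2) * \<delta>"
  proof (rule boosted_side[where X = Y and Y = X and F = "\<lambda>y x. - pop 0 0 0 0 x y" and \<nu> = ax and \<mu> = ay
        and L = "Ly + ay" and M = Lxy and \<eta> = "eta_y c" and T = T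
        and H = "\<lambda>i y x. - pop 0 0 (lam ay i) (?c i) x y" and s = "\<lambda>i. prod.swap (?s i)" and c = ?c and m = m
        and zs = "\<lambda>i j. prod.swap (?zs i j)" and ks = "\<lambda>i. pick c K \<omega> (Center_y i) 2"
        and g = "\<lambda>y x. - (gy x y - ay *\<^sub>R (y - y'))" and z = "\<lambda>j. prod.swap (?z j)"
        and ?k1.0 = "pick c K \<omega> Gap_y 2" and ?k2.0 = "pick c K \<omega> Gap_y 1" and G = "\<lambda>j. - batch_grad_y Q c K \<omega> j"
        and kG = "pick c K \<omega> Grad_y 1" and v = "- direction_y Q c K \<omega>"])
    show "strong_saddle Y X (ay + lam ay i) ax (\<lambda>y x. - pop 0 0 (lam ay i) (?c i) x y)" for i
      using strong_saddle_swap[OF pop_strong_saddle[of 0 "lam ay i" 0 "?c i"]] by simp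
    show "saddle_point Y X (\<lambda>y x. - pop 0 0 (lam ay i) (?c i) x y) (prod.swap (?s i))" for i
      unfolding saddle_point_swap by (rule pop_saddle_point) auto
    show "real m / 2 < real (card {j. j < m \<and>
        - pop 0 0 (lam ay i) (?c i) (snd (prod.swap (?s i))) (fst (prod.swap (?zs i j))) -
        - pop 0 0 (lam ay i) (?c i) (snd (prod.swap (?zs i j))) (fst (prod.swap (?s i))) \<le> \<delta> / 9})"
      if "i \<le> T" for i
      using maj[OF stages_I(2)[OF that]] by (simp add: pop_gap_def)
    show "real m / 2 < real (card {j. j < m \<and>
        - pop 0 0 (lam ay (Suc T)) (?c (Suc T)) (snd (prod.swap (?s (Suc T)))) (fst (prod.swap (?z j))) -
        - pop 0 0 (lam ay (Suc T)) (?c (Suc T)) (snd (prod.swap (?z j))) (fst (prod.swap (?s (Suc T)))) \<le> eta_y c})"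
      using maj[OF stages_I(4)] by (simp add: pop_gap_def centerT_y_def lamT_simps del: lam.simps center_y.simps)
    show "real m / 2 < real (card {j. j < m \<and> norm (- batch_grad_y Q c K \<omega> j -
        - (gy (snd (prod.swap (?z (pick c K \<omega> Gap_y 1)))) (fst (prod.swap (?z (pick c K \<omega> Gap_y 2)))) -
         ay *\<^sub>R (fst (prod.swap (?z (pick c K \<omega> Gap_y 2))) - y')))
        \<le> (Ly + ay + lam ay (Suc T)) * sqrt (eta_y c / (ay + lam ay (Suc T)))})"
      using maj[OF stages_I(6)]
      by (simp only: good.simps grad_point_y_def combine_def delta_grad_y_def lamT_simps c_simps
          fst_conv snd_conv fst_swap snd_swap minus_diff_minus norm_minus_cancel)
    show "eta_y c * (3 + (18 * sqrt 2 + 45) * ((Ly + ay + lam ay (Suc T)) / (ay + lam ay (Suc T))) +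
        36 * Lxy / sqrt ((ay + lam ay (Suc T)) * ax) + 9 * Lxy\<^sup>2 / ((ay + lam ay (Suc T)) * ax)) = \<delta>"
      using eta_gap_const(2) by (simp add: gap_const_y_def lamT_simps mult.commute[of ax] del: lam.simps)
    show "norm (- (gy x y1 - ay *\<^sub>R (y1 - y')) - - (gy x y2 - ay *\<^sub>R (y2 - y'))) \<le> (Ly + ay) * norm (y1 - y2)"
      if "y1 \<in> Y" "y2 \<in> Y" "x \<in> X" for y1 y2 x
    proof -
      have "- (gy x y1 - ay *\<^sub>R (y1 - y')) - - (gy x y2 - ay *\<^sub>R (y2 - y')) = (gy x y2 - gy x y1) + ay *\<^sub>R (y1 - y2)"
        by (simp add: algebra_simps)
      also have "norm \<dots> \<le> Ly * norm (y1 - y2) + ay * norm (y1 - y2)"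
        using smooth_y[OF that(3) that(2,1)] pos by (intro norm_triangle_mono) (auto simp: norm_minus_commute)
      finally show ?thesis by (simp add: algebra_simps)
    qed
    show "norm (- (gy x1 y - ay *\<^sub>R (y - y')) - - (gy x2 y - ay *\<^sub>R (y - y'))) \<le> Lxy * norm (x1 - x2)"
      if "y \<in> Y" "x1 \<in> X" "x2 \<in> X" for y x1 x2
      using smooth_x[OF that(2,3,1)] by (simp add: norm_minus_commute)
    show "- direction_y Q c K \<omega> = - batch_grad_y Q c K \<omega> (pick c K \<omega> Grad_y 1) +
        lam ay (Suc T) *\<^sub>R (fst (prod.swap (?z (pick c K \<omega> Gap_y 2))) - ?c (Suc T))"
      by (simp add: direction_y_def grad_point_y_def combine_def lamT_simps centerT_y_def del: lam.simps center_y.simps)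
    show "?c (Suc i) = fst (prod.swap (?zs i (pick c K \<omega> (Center_y i) 2)))" for i
      by (simp add: combine_def)
    show "(\<lambda>y x. - pop 0 0 (lam ay i) (?c i) x y) =
        (\<lambda>y x. - pop 0 0 0 0 x y + lam ay i / 2 * (norm (y - ?c i))\<^sup>2)" for i
      unfolding pop_weight_y[of "lam ay i"] by (simp add: fun_eq_iff)
    show "((\<lambda>u. - pop 0 0 0 0 x u) has_derivative (\<lambda>d. - (gy x y - ay *\<^sub>R (y - y')) \<bullet> d)) (at y within Y)"
      if "y \<in> Y" "x \<in> X" for x y
      by (rule pop_derivative_y[OF that(2,1)])
    show "prod.swap (?zs i j) \<in> Y \<times> X" "prod.swap (?z j) \<in> Y \<times> X" for i j
      using solve_in(2)[of \<omega> "Center_y i" i "?c i" j] gap_candidate_in(2)[of \<omega> j] by (auto simp: mem_Times_iff)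
  qed (use valid pos delta_pos eta_pos x extract_neg in
      \<open>auto simp: valid_picks_def Let_def simp del: lam.simps center_x.simps center_y.simps\<close>)
  then show ?thesis by (simp add: output_y_def z0_def)
qed

text \<open>The saddle value cancels between the two one-sided bounds, and their losses add up to (4
  T + 4) \<delta>; this is why \<delta> is the accuracy divided by 4 + 4 T.\<close>

lemma output_gap:
  assumes "\<omega> \<in> space \<Omega>" "valid_picks Q c K \<omega>" "\<And>s. s \<in> stages c \<Longrightarrow> \<omega> \<notin> failure s" "x \<in> X" "y \<in> Y"
  shows "pop 0 0 0 0 (output_x Q c K \<omega>) y - pop 0 0 0 0 x (output_y Q c K \<omega>) \<le> \<epsilon>"
proof -
  have "2 * ((2 * real T + 2) * \<delta>) = \<epsilon>"
    unfolding delta_def c_simps by (simp add: field_simps)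
  with output_x_bound[OF assms(1-3,5)] output_y_bound[OF assms(1-4)] show ?thesis by linarith
qed

end

text \<open>Only the samples of the run enter, and validity of the picks keeps the indices in range, so
  modifying the problem on a null set changes neither the run nor the validity of its picks.\<close>

lemma run_cong:
  fixes Q Q' :: "('s, 'x::euclidean_space, 'y::euclidean_space) problem"
  assumes SAA: "\<And>s j wx wy xc yc. s \<in> stages c \<Longrightarrow> j < reps c \<Longrightarrow>
      SAA Q (batch_size c s) wx wy xc yc (\<lambda>l. \<omega> (s, j, l)) = SAA Q' (batch_size c s) wx wy xc yc (\<lambda>l. \<omega> (s, j, l))"
    and gx: "\<And>j x y. j < reps c \<Longrightarrow>
      (\<Sum>i<batch_size c Grad_x. grad_x Q (\<omega> (Grad_x, j, i)) x y) = (\<Sum>i<batch_size c Grad_x. grad_x Q' (\<omega> (Grad_x, j, i)) x y)"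
    and gy: "\<And>j x y. j < reps c \<Longrightarrow>
      (\<Sum>i<batch_size c Grad_y. grad_y Q (\<omega> (Grad_y, j, i)) x y) = (\<Sum>i<batch_size c Grad_y. grad_y Q' (\<omega> (Grad_y, j, i)) x y)"
    and valid: "valid_picks Q c K \<omega>"
  shows "valid_picks Q' c K \<omega>" "output_x Q c K \<omega> = output_x Q' c K \<omega>" "output_y Q c K \<omega> = output_y Q' c K \<omega>"
proof -
  let ?m = "reps c"
  have less: "k < ?m" if "k \<in> extract_set ?m \<rho> z" for k and \<rho> :: "'a \<Rightarrow> 'a \<Rightarrow> real" and z
    using that by (simp add: extract_set_def Let_def)
  have less': "k < ?m" if "k \<in> extract_set ?m \<rho> z" for k and \<rho> :: "'b \<Rightarrow> 'b \<Rightarrow> real" and z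
    using that by (simp add: extract_set_def Let_def)
  have st: "Gap_x \<in> stages c" "Gap_y \<in> stages c" "i \<le> rounds c \<Longrightarrow> Center_x i \<in> stages c"
    "i \<le> rounds c \<Longrightarrow> Center_y i \<in> stages c" for i
    by (auto simp: stages_def)
  have solve_x: "solve_x Q c \<omega> s i xc j = solve_x Q' c \<omega> s i xc j"
    and solve_y: "solve_y Q c \<omega> s i yc j = solve_y Q' c \<omega> s i yc j" if "s \<in> stages c" "j < ?m" for s i xc yc j
    using SAA[OF that] by (simp_all add: solve_x_def solve_y_def)
  note V = valid[unfolded valid_picks_def Let_def]
  have cx: "center_x Q c K \<omega> i = center_x Q' c K \<omega> i" if "i \<le> Suc (rounds c)" for i
    using that
  proof (induction i)
    case (Suc i)
    then have "pick c K \<omega> (Center_x i) 1 < ?m" using V by (auto intro: less)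
    then show ?case using Suc by (simp add: combine_def solve_x st)
  qed simp
  have cy: "center_y Q c K \<omega> i = center_y Q' c K \<omega> i" if "i \<le> Suc (rounds c)" for i
    using that
  proof (induction i)
    case (Suc i)
    then have "pick c K \<omega> (Center_y i) 2 < ?m" using V by (auto intro: less')
    then show ?case using Suc by (simp add: combine_def solve_y st)
  qed simp
  have cT: "centerT_x Q c K \<omega> = centerT_x Q' c K \<omega>" "centerT_y Q c K \<omega> = centerT_y Q' c K \<omega>"
    unfolding centerT_x_def centerT_y_def by (rule cx[OF order_refl], rule cy[OF order_refl])
  have gcx: "gap_candidate_x Q c K \<omega> j = gap_candidate_x Q' c K \<omega> j"
    and gcy: "gap_candidate_y Q c K \<omega> j = gap_candidate_y Q' c K \<omega> j" if "j < ?m" for j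
    unfolding gap_candidate_x_def gap_candidate_y_def cT using that st by (auto intro: solve_x solve_y)
  have picks: "pick c K \<omega> Gap_x 1 < ?m" "pick c K \<omega> Gap_x 2 < ?m" "pick c K \<omega> Grad_x 1 < ?m" "pick c K \<omega> Grad_x 2 < ?m"
    "pick c K \<omega> Gap_y 1 < ?m" "pick c K \<omega> Gap_y 2 < ?m" "pick c K \<omega> Grad_y 1 < ?m" "pick c K \<omega> Grad_y 2 < ?m"
    using V by (auto intro: less less')
  have gp: "grad_point_x Q c K \<omega> = grad_point_x Q' c K \<omega>" "grad_point_y Q c K \<omega> = grad_point_y Q' c K \<omega>"
    using picks by (simp_all add: grad_point_x_def grad_point_y_def combine_def gcx gcy)
  have bgx: "batch_grad_x Q c K \<omega> j = batch_grad_x Q' c K \<omega> j"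
    and bgy: "batch_grad_y Q c K \<omega> j = batch_grad_y Q' c K \<omega> j" if "j < ?m" for j
    using that by (simp_all add: batch_grad_x_def batch_grad_y_def gp gx gy)
  have dir: "direction_x Q c K \<omega> = direction_x Q' c K \<omega>" "direction_y Q c K \<omega> = direction_y Q' c K \<omega>"
    using picks by (simp_all add: direction_x_def direction_y_def gp cT bgx bgy)
  show "output_x Q c K \<omega> = output_x Q' c K \<omega>" "output_y Q c K \<omega> = output_y Q' c K \<omega>"
    using picks by (simp_all add: output_x_def output_y_def gcx gcy)
  have ex: "extract_set ?m \<rho> (\<lambda>j. fst (z j)) = extract_set ?m \<rho> (\<lambda>j. fst (z' j))"
    "extract_set ?m \<rho>' (\<lambda>j. snd (z j)) = extract_set ?m \<rho>' (\<lambda>j. snd (z' j))"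
    if "\<And>j. j < ?m \<Longrightarrow> z j = z' j" for \<rho> \<rho>' and z z' :: "nat \<Rightarrow> 'x \<times> 'y"
    using that by (intro extract_set_cong; simp)+
  have ex_grad: "extract_set ?m dist (batch_grad_x Q c K \<omega>) = extract_set ?m dist (batch_grad_x Q' c K \<omega>)"
    "extract_set ?m dist (batch_grad_y Q c K \<omega>) = extract_set ?m dist (batch_grad_y Q' c K \<omega>)"
    by (intro extract_set_cong; simp add: bgx bgy)+
  have ex_gap_x: "extract_set ?m \<rho> (\<lambda>j. fst (gap_candidate_x Q c K \<omega> j)) =
      extract_set ?m \<rho> (\<lambda>j. fst (gap_candidate_x Q' c K \<omega> j))"
    "extract_set ?m \<rho>' (\<lambda>j. snd (gap_candidate_x Q c K \<omega> j)) =
      extract_set ?m \<rho>' (\<lambda>j. snd (gap_candidate_x Q' c K \<omega> j))" for \<rho> \<rho>'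
    by (intro ex; simp add: gcx)+
  have ex_gap_y: "extract_set ?m \<rho> (\<lambda>j. fst (gap_candidate_y Q c K \<omega> j)) =
      extract_set ?m \<rho> (\<lambda>j. fst (gap_candidate_y Q' c K \<omega> j))"
    "extract_set ?m \<rho>' (\<lambda>j. snd (gap_candidate_y Q c K \<omega> j)) =
      extract_set ?m \<rho>' (\<lambda>j. snd (gap_candidate_y Q' c K \<omega> j))" for \<rho> \<rho>'
    by (intro ex; simp add: gcy)+
  have ex_x: "extract_set ?m \<rho> (\<lambda>j. fst (solve_x Q c \<omega> (Center_x i) i (center_x Q c K \<omega> i) j)) =
      extract_set ?m \<rho> (\<lambda>j. fst (solve_x Q' c \<omega> (Center_x i) i (center_x Q' c K \<omega> i) j))"
    "extract_set ?m \<rho>' (\<lambda>j. snd (solve_x Q c \<omega> (Center_x i) i (center_x Q c K \<omega> i) j)) =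
      extract_set ?m \<rho>' (\<lambda>j. snd (solve_x Q' c \<omega> (Center_x i) i (center_x Q' c K \<omega> i) j))"
    if "i \<le> rounds c" for i \<rho> \<rho>'
    using that by (intro ex; simp add: solve_x st cx)+
  have ex_y: "extract_set ?m \<rho> (\<lambda>j. fst (solve_y Q c \<omega> (Center_y i) i (center_y Q c K \<omega> i) j)) =
      extract_set ?m \<rho> (\<lambda>j. fst (solve_y Q' c \<omega> (Center_y i) i (center_y Q' c K \<omega> i) j))"
    "extract_set ?m \<rho>' (\<lambda>j. snd (solve_y Q c \<omega> (Center_y i) i (center_y Q c K \<omega> i) j)) =
      extract_set ?m \<rho>' (\<lambda>j. snd (solve_y Q' c \<omega> (Center_y i) i (center_y Q' c K \<omega> i) j))"
    if "i \<le> rounds c" for i \<rho> \<rho>'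
    using that by (intro ex; simp add: solve_y st cy)+
  show "valid_picks Q' c K \<omega>"
    using V unfolding valid_picks_def Let_def ex_gap_x ex_gap_y ex_grad dir
    by (simp add: ex_x ex_y)
qed

section \<open>From the regularized gap to the duality gap\<close>

context sampled_saddle_problem
begin

lemma \<Phi>_continuous: "a \<in> X \<Longrightarrow> continuous_on Y (\<lambda>y. \<Phi> a y)" "b \<in> Y \<Longrightarrow> continuous_on X (\<lambda>x. \<Phi> x b)"
  using convex_concave_lipschitz_continuous[OF \<Phi>_cc]
  by (auto intro!: continuous_on_curried_compose[of X Y \<Phi>] continuous_on_const continuous_on_id)

text \<open>Boundedness by compactness gives one direction and nonemptiness the other. From here on
  the gap is treated through pairs of comparison points.\<close>

lemma duality_gap_le_iff:
  assumes a: "a \<in> X" and b: "b \<in> Y"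
  shows "duality_gap X Y \<Phi> a b \<le> e \<longleftrightarrow> (\<forall>x\<in>X. \<forall>y\<in>Y. \<Phi> a y - \<Phi> x b \<le> e)"
proof
  assume le: "duality_gap X Y \<Phi> a b \<le> e"
  have "bdd_above (\<Phi> a ` Y)" "bdd_below ((\<lambda>x. \<Phi> x b) ` X)"
    using compact_continuous_image[OF \<Phi>_continuous(1)[OF a] Y(1)] compact_continuous_image[OF \<Phi>_continuous(2)[OF b] X(1)]
    by (auto intro: bounded_imp_bdd_above bounded_imp_bdd_below compact_imp_bounded)
  then have "\<Phi> a y \<le> (SUP y\<in>Y. \<Phi> a y)" "(INF x\<in>X. \<Phi> x b) \<le> \<Phi> x b" if "x \<in> X" "y \<in> Y" for x y
    using that by (auto intro: cSUP_upper cINF_lower)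
  then show "\<forall>x\<in>X. \<forall>y\<in>Y. \<Phi> a y - \<Phi> x b \<le> e" using le unfolding duality_gap_def by fastforce
next
  assume le: "\<forall>x\<in>X. \<forall>y\<in>Y. \<Phi> a y - \<Phi> x b \<le> e"
  have "(SUP y\<in>Y. \<Phi> a y) - e \<le> \<Phi> x b" if "x \<in> X" for x
  proof -
    have "(SUP y\<in>Y. \<Phi> a y) \<le> e + \<Phi> x b" using le that Y(3) by (intro cSUP_least) (auto simp: algebra_simps)
    then show ?thesis by simp
  qed
  then have "(SUP y\<in>Y. \<Phi> a y) - e \<le> (INF x\<in>X. \<Phi> x b)" using X(3) by (intro cINF_greatest) auto
  then show "duality_gap X Y \<Phi> a b \<le> e" by (simp add: duality_gap_def)
qed

end

context boosted_saa
begin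

text \<open>The regularization terms at the output have a favourable sign and are dropped; those at
  the comparison points are bounded through the diameters, because \<open>x'\<close> and
  \<open>y'\<close> are feasible.\<close>

lemma output_duality_gap:
  assumes "\<omega> \<in> space \<Omega>" "valid_picks Q c K \<omega>" "\<And>s. s \<in> stages c \<Longrightarrow> \<omega> \<notin> failure s"
    and x': "x' \<in> X" and y': "y' \<in> Y"
  shows "duality_gap X Y \<Phi> (output_x Q c K \<omega>) (output_y Q c K \<omega>) \<le>
    \<epsilon> + ax / 2 * (diameter X)\<^sup>2 + ay / 2 * (diameter Y)\<^sup>2"
  unfolding duality_gap_le_iff[OF output_in]
proof (intro ballI)
  fix x y assume x: "x \<in> X" and y: "y \<in> Y"
  have d: "ax / 2 * (norm (x - x'))\<^sup>2 \<le> ax / 2 * (diameter X)\<^sup>2" "ay / 2 * (norm (y - y'))\<^sup>2 \<le> ay / 2 * (diameter Y)\<^sup>2"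
    using pos x y x' y' X(1) Y(1)
    by (auto intro!: mult_left_mono power_mono diameter_bounded_bound compact_imp_bounded simp: dist_norm[symmetric])
  have nn: "0 \<le> ax / 2 * (norm (output_x Q c K \<omega> - x'))\<^sup>2" "0 \<le> ay / 2 * (norm (output_y Q c K \<omega> - y'))\<^sup>2"
    using pos by auto
  have "pop 0 0 0 0 u v = \<Phi> u v + ax / 2 * (norm (u - x'))\<^sup>2 - ay / 2 * (norm (v - y'))\<^sup>2" for u v
    by (simp add: pop_def penalty_def)
  note pop_eq = this
  from output_gap[OF assms(1-3) x y] d nn
  show "\<Phi> (output_x Q c K \<omega>) y - \<Phi> x (output_y Q c K \<omega>) \<le> \<epsilon> + ax / 2 * (diameter X)\<^sup>2 + ay / 2 * (diameter Y)\<^sup>2"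
    unfolding pop_eq by linarith
qed

text \<open>The gap condition ranges over uncountably many comparison points; by continuity a
  countable dense set of them decides it.\<close>

lemma duality_gap_event: "{\<omega> \<in> space \<Omega>. duality_gap X Y \<Phi> (output_x Q c K \<omega>) (output_y Q c K \<omega>) \<le> e} \<in> sets \<Omega>"
proof -
  obtain D where D: "countable D" "D \<subseteq> X \<times> Y" "X \<times> Y \<subseteq> closure D" using separable by blast
  have "{\<omega> \<in> space \<Omega>. duality_gap X Y \<Phi> (output_x Q c K \<omega>) (output_y Q c K \<omega>) \<le> e} =
    {\<omega> \<in> space \<Omega>. \<forall>v\<in>D. \<Phi> (output_x Q c K \<omega>) (snd v) - \<Phi> (fst v) (output_y Q c K \<omega>) \<le> e}"
  proof (intro Collect_cong conj_cong refl)
    fix \<omega>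
    let ?a = "output_x Q c K \<omega>" and ?b = "output_y Q c K \<omega>"
    let ?Z = "{v \<in> X \<times> Y. \<Phi> ?a (snd v) - \<Phi> (fst v) ?b \<le> e}"
    have "closed ?Z"
    proof (rule continuous_on_closed_Collect_le)
      note cont = continuous_on_curried_compose[OF convex_concave_lipschitz_continuous[OF \<Phi>_cc]]
      show "continuous_on (X \<times> Y) (\<lambda>v. \<Phi> ?a (snd v) - \<Phi> (fst v) ?b)"
        by (intro continuous_on_diff cont) (auto intro: continuous_on_fst continuous_on_snd continuous_on_id output_in)
      show "closed (X \<times> Y)" using X(1) Y(1) by (intro closed_Times compact_imp_closed)
    qed (rule continuous_on_const)
    then have "D \<subseteq> ?Z \<Longrightarrow> X \<times> Y \<subseteq> ?Z" using D(3) closure_minimal[of D ?Z] by blast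
    then show "duality_gap X Y \<Phi> ?a ?b \<le> e \<longleftrightarrow> (\<forall>v\<in>D. \<Phi> ?a (snd v) - \<Phi> (fst v) ?b \<le> e)"
      unfolding duality_gap_le_iff[OF output_in] using D(2) by fastforce
  qed
  also have "\<dots> \<in> sets \<Omega>"
  proof (rule sets.sets_Collect_countable_All'[OF _ D(1)])
    fix v assume "v \<in> D"
    then have "fst v \<in> X" "snd v \<in> Y" using D(2) by auto
    then show "{\<omega> \<in> space \<Omega>. \<Phi> (output_x Q c K \<omega>) (snd v) - \<Phi> (fst v) (output_y Q c K \<omega>) \<le> e} \<in> sets \<Omega>"
      by (intro borel_measurable_le borel_measurable_diff \<Phi>_measurable_compose output_measurable borel_measurable_const output_in)
  qed
  finally show ?thesis .
qed

lemma duality_gap_probability: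
  assumes valid: "AE \<omega> in \<Omega>. valid_picks Q c K \<omega>" and "x' \<in> X" "y' \<in> Y"
    and e: "\<epsilon> + ax / 2 * (diameter X)\<^sup>2 + ay / 2 * (diameter Y)\<^sup>2 \<le> e"
  shows "\<Omega>.prob {\<omega> \<in> space \<Omega>. duality_gap X Y \<Phi> (output_x Q c K \<omega>) (output_y Q c K \<omega>) \<le> e} \<ge> 1 - p"
proof -
  let ?F = "\<Union>s\<in>stages c. failure s"
  have "1 - p \<le> \<Omega>.prob (space \<Omega> - ?F)"
    using failure_Union by (simp add: \<Omega>.prob_compl)
  also have "\<dots> \<le> \<Omega>.prob {\<omega> \<in> space \<Omega>. duality_gap X Y \<Phi> (output_x Q c K \<omega>) (output_y Q c K \<omega>) \<le> e}"
  proof (rule \<Omega>.finite_measure_mono_AE[OF _ duality_gap_event])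
    show "AE \<omega> in \<Omega>. \<omega> \<in> space \<Omega> - ?F \<longrightarrow>
      \<omega> \<in> {\<omega> \<in> space \<Omega>. duality_gap X Y \<Phi> (output_x Q c K \<omega>) (output_y Q c K \<omega>) \<le> e}"
      using valid
    proof eventually_elim
      case (elim \<omega>)
      show ?case
      proof
        assume "\<omega> \<in> space \<Omega> - ?F"
        then show "\<omega> \<in> {\<omega> \<in> space \<Omega>. duality_gap X Y \<Phi> (output_x Q c K \<omega>) (output_y Q c K \<omega>) \<le> e}"
          using output_duality_gap[OF _ elim _ assms(2,3)] e by fastforce
      qed
    qed
  qed
  finally show ?thesis .
qed

end

section \<open>Sample count\<close>

lemma ln_ge1_ge: "1 \<le> ln_ge1 s" "ln s \<le> ln_ge1 s"
  by (simp_all add: ln_ge1_def)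

text \<open>The three ratios are at most (1 + 2 A)^2, whose logarithm is at most 6 times
  \<open>ln_ge1 A\<close>. Base 2 at most doubles this, since ln 2 is at least 1 / 2, and the
  ceiling adds one more, whence 13.\<close>

lemma rounds_le:
  assumes A: "A > 0" and pos: "mu_x c > 0" "mu_y c > 0"
    and x: "1 \<le> sm_x c / mu_x c" "sm_x c / mu_x c \<le> 1 + 2 * A" and y: "sm_y c / mu_y c \<le> 1 + 2 * A"
    and xy: "(sm_xy c)\<^sup>2 / (mu_x c * mu_y c) \<le> A\<^sup>2"
  shows "real (rounds c) \<le> 13 * ln_ge1 A"
proof -
  let ?R = "max (sm_x c / mu_x c) (max (sm_y c / mu_y c) ((sm_xy c)\<^sup>2 / (mu_x c * mu_y c)))"
  have "1 + 2 * A \<le> (1 + 2 * A)\<^sup>2" using A by (simp add: power2_eq_square algebra_simps)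
  moreover have "A\<^sup>2 \<le> (1 + 2 * A)\<^sup>2" using A by (intro power_mono) auto
  ultimately have R: "?R \<le> (1 + 2 * A)\<^sup>2"
    using x y xy by (intro max.boundedI) linarith+
  have R1: "1 \<le> ?R" using x by simp
  have "ln ?R \<le> ln ((1 + 2 * A)\<^sup>2)" using R R1 A by (subst ln_le_cancel_iff) auto
  also have "\<dots> = 2 * ln (1 + 2 * A)" using A by (simp add: ln_realpow)
  also have "ln (1 + 2 * A) \<le> ln (3 * max 1 A)" using A by (subst ln_le_cancel_iff) auto
  also have "ln (3 * max 1 A) = ln 3 + ln (max 1 A)" using A by (subst ln_mult) auto
  also have "ln 3 \<le> (2::real)" using ln_le_minus_one[of 3] by simp
  also have "ln (max 1 A) \<le> ln_ge1 A" by (auto simp: ln_ge1_def max_def)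
  finally have "ln ?R \<le> 6 * ln_ge1 A" using ln_ge1_ge(1)[of A] by simp
  moreover have "ln 2 \<ge> (1 / 2 :: real)" using ln2_ge_two_thirds by simp
  then have "12 * ln_ge1 A * (1 / 2) \<le> 12 * ln_ge1 A * ln 2"
    using ln_ge1_ge(1)[of A] by (intro mult_left_mono) auto
  ultimately have "ln ?R \<le> 12 * ln_ge1 A * ln 2" by linarith
  then have "log 2 ?R \<le> 12 * ln_ge1 A" by (simp add: log_def field_simps)
  moreover have "log 2 ?R \<ge> 0" using R1 by simp
  ultimately show ?thesis
    unfolding rounds_def using ln_ge1_ge(1)[of A] by linarith
qed

lemma rounds_ge:
  assumes "1 \<le> sm_x c / mu_x c"
  shows "max (sm_x c / mu_x c) (max (sm_y c / mu_y c) ((sm_xy c)\<^sup>2 / (mu_x c * mu_y c))) \<le> 2 ^ rounds c"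
proof -
  let ?R = "max (sm_x c / mu_x c) (max (sm_y c / mu_y c) ((sm_xy c)\<^sup>2 / (mu_x c * mu_y c)))"
  have R: "?R > 0" using assms by (simp add: less_max_iff_disj)
  have "log 2 ?R \<le> real (rounds c)" unfolding rounds_def by (rule real_nat_ceiling_ge)
  then have "?R \<le> 2 powr real (rounds c)" using R by (simp add: log_le_iff)
  then show ?thesis by (simp add: powr_realpow)
qed

text \<open>This is what the rounds are for: a last weight \<open>l\<close> that dominates
  \<open>L\<close> and the squared coupling over \<open>n\<close> brings the three ratios down to 2,
  1 and 1, however small \<open>m\<close> is. The sum is then at most 3 + 144 + 36 + 9 =
  192.\<close>

lemma gap_const_le:
  fixes m n L M l :: real
  assumes "m > 0" "n > 0" "M > 0" "L \<le> l" "0 < l" "M\<^sup>2 \<le> l * n"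
  shows "3 + (18 * sqrt 2 + 45) * ((L + l) / (m + l)) + 36 * M / sqrt ((m + l) * n) + 9 * M\<^sup>2 / ((m + l) * n) \<le> 200"
proof -
  have s2: "sqrt 2 \<le> 3 / 2" by (rule real_le_lsqrt) (auto simp: power2_eq_square)
  have "(L + l) / (m + l) \<le> 2" using assms by (simp add: divide_le_eq)
  then have "(18 * sqrt 2 + 45) * ((L + l) / (m + l)) \<le> (18 * sqrt 2 + 45) * 2"
    by (intro mult_left_mono) auto
  moreover have MM: "M\<^sup>2 \<le> (m + l) * n" 
  proof -
    have "0 \<le> m * n" using assms by simp
    then show ?thesis using assms(6) unfolding distrib_right by linarith
  qed
  then have "M \<le> sqrt ((m + l) * n)" by (rule real_le_rsqrt)
  then have "36 * M / sqrt ((m + l) * n) \<le> 36" using assms by (simp add: divide_le_eq)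
  moreover have "9 * M\<^sup>2 / ((m + l) * n) \<le> 9" using MM assms by (simp add: divide_le_eq)
  moreover have "3 + t1 + t2 + t3 \<le> 200" if "t1 \<le> (18 * sqrt 2 + 45) * 2" "t2 \<le> 36" "t3 \<le> 9" for t1 t2 t3
    using that s2 by simp
  ultimately show ?thesis by blast
qed

text \<open>With the loss factor at most 200, a gap stage has the coefficient 6 * 200 and a gradient
  stage 3 * 2^2 * 200 = 2400, the largest; a center has only 54.\<close>

lemma raw_size_bound:
  assumes pos: "mu_x c > 0" "mu_y c > 0" "sm_xy c > 0" "delta c > 0"
    and sm: "mu_x c \<le> sm_x c" "mu_y c \<le> sm_y c" and sig: "sig_x c = 2 * lip_x c" "sig_y c = 2 * lip_y c"
  shows "raw_size c s \<le> 2400 / delta c * ((lip_x c)\<^sup>2 / mu_x c + (lip_y c)\<^sup>2 / mu_y c)"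
proof -
  let ?W = "(lip_x c)\<^sup>2 / mu_x c + (lip_y c)\<^sup>2 / mu_y c" and ?T = "rounds c"
  have one: "1 \<le> sm_x c / mu_x c" using pos sm by simp
  have lx: "lamT_x c = mu_x c * 2 ^ ?T" and ly: "lamT_y c = mu_y c * 2 ^ ?T"
    by (simp_all add: lamT_x_def lamT_y_def)
  have lpos: "lamT_x c > 0" "lamT_y c > 0" using pos by (simp_all add: lx ly)
  have "sm_x c / mu_x c \<le> 2 ^ ?T" "sm_y c / mu_y c \<le> 2 ^ ?T" "(sm_xy c)\<^sup>2 / (mu_x c * mu_y c) \<le> 2 ^ ?T"
    using rounds_ge[OF one] by simp_all
  then have ge: "sm_x c \<le> lamT_x c" "sm_y c \<le> lamT_y c" "(sm_xy c)\<^sup>2 \<le> lamT_x c * mu_y c" "(sm_xy c)\<^sup>2 \<le> lamT_y c * mu_x c"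
    using pos by (simp_all add: lx ly divide_le_eq mult_ac)
  have W: "?W \<ge> 0" using pos by simp
  have gx: "gap_const_x c \<le> 200"
    unfolding gap_const_x_def using pos ge lpos by (intro gap_const_le) auto
  have gy: "gap_const_y c \<le> 200"
    unfolding gap_const_y_def mult.commute[of "mu_x c"] using pos ge lpos by (intro gap_const_le) auto
  have gpos: "gap_const_x c > 0" "gap_const_y c > 0"
    unfolding gap_const_x_def gap_const_y_def using pos lpos sm
    by (auto intro!: add_pos_nonneg mult_nonneg_nonneg divide_nonneg_nonneg)
  have inv_eta: "1 / eta_x c \<le> 200 / delta c" "1 / eta_y c \<le> 200 / delta c"
    using gx gy gpos pos by (simp_all add: eta_x_def eta_y_def divide_right_mono)
  have Wl: "(lip_x c)\<^sup>2 / (mu_x c + l) + (lip_y c)\<^sup>2 / mu_y c \<le> ?W"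
    "(lip_x c)\<^sup>2 / mu_x c + (lip_y c)\<^sup>2 / (mu_y c + l) \<le> ?W" if "l \<ge> 0" for l
    using pos that by (auto intro!: add_mono divide_left_mono mult_pos_pos add_pos_nonneg)
  have lam0: "lam (mu_x c) i \<ge> 0" "lam (mu_y c) i \<ge> 0" for i
    using pos by (auto intro: lam_nonneg)
  have center: "54 / delta c * w \<le> 2400 / delta c * ?W" if "w \<le> ?W" for w
  proof -
    have "54 / delta c * w \<le> 54 / delta c * ?W" using that pos by (intro mult_left_mono) auto
    also have "\<dots> \<le> 2400 / delta c * ?W" using W pos by (intro mult_right_mono divide_right_mono) auto
    finally show ?thesis .
  qed
  have gap: "2 / (e / 3) * w \<le> 2400 / delta c * ?W" if "w \<le> ?W" "1 / e \<le> 200 / delta c" "e > 0" for w e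
  proof -
    have "2 / (e / 3) * w \<le> 2 / (e / 3) * ?W" using that by (intro mult_left_mono) auto
    also have "\<dots> = 6 * (1 / e) * ?W" by simp
    also have "\<dots> \<le> 6 * (200 / delta c) * ?W" using that W by (intro mult_right_mono mult_left_mono) auto
    also have "\<dots> \<le> 2400 / delta c * ?W" using W pos by (intro mult_right_mono) (auto simp: divide_right_mono)
    finally show ?thesis .
  qed
  have grad: "3 * (2 * q)\<^sup>2 / ((S + l) * sqrt (e / (u + l)))\<^sup>2 \<le> 2400 / delta c * ?W"
    if "q\<^sup>2 / u \<le> ?W" "u > 0" "u \<le> S" "l > 0" "e > 0" "1 / e \<le> 200 / delta c" for q S l e u
  proof -
    \<comment> \<open>The gradient tolerance scales with \<open>S + l\<close>. As
      \<open>u \<le> S\<close>, one factor of its square cancels \<open>u + l\<close>, and the other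
      one is at least \<open>u\<close>.\<close>
    have "u * (u + l) \<le> (S + l) * (S + l)" using that by (intro mult_mono) auto
    then have "(u + l) / ((S + l) * (S + l)) \<le> (u + l) / (u * (u + l))"
      using that by (intro divide_left_mono mult_pos_pos) auto
    then have le: "(u + l) / ((S + l) * (S + l)) \<le> 1 / u"
      using that by simp
    have "((S + l) * sqrt (e / (u + l)))\<^sup>2 = ((S + l) * (S + l)) * e / (u + l)"
      using that by (simp add: power_mult_distrib power2_eq_square[of "S + l"])
    then have "3 * (2 * q)\<^sup>2 / ((S + l) * sqrt (e / (u + l)))\<^sup>2 = 12 * q\<^sup>2 * ((u + l) / ((S + l) * (S + l))) * (1 / e)"
      using that by (simp add: power_mult_distrib)
    also have "\<dots> \<le> 12 * q\<^sup>2 * (1 / u) * (1 / e)"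
      using that by (intro mult_right_mono mult_left_mono le) auto
    also have "\<dots> = 12 * (1 / e) * (q\<^sup>2 / u)" by simp
    also have "\<dots> \<le> 12 * (200 / delta c) * ?W"
      using that pos by (intro mult_mono mult_left_mono) auto
    finally show ?thesis by simp
  qed
  have epos: "eta_x c > 0" "eta_y c > 0" using gpos pos by (simp_all add: eta_x_def eta_y_def)
  have q: "(lip_x c)\<^sup>2 / mu_x c \<le> ?W" "(lip_y c)\<^sup>2 / mu_y c \<le> ?W" using pos by simp_all
  show ?thesis
  proof (cases s)
    case (Center_x i)
    show ?thesis unfolding Center_x raw_size.simps by (rule center[OF Wl(1)[OF lam0(1)]])
  next
    case (Center_y i)
    show ?thesis unfolding Center_y raw_size.simps by (rule center[OF Wl(2)[OF lam0(2)]])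
  next
    case Gap_x
    show ?thesis unfolding Gap_x raw_size.simps by (rule gap[OF Wl(1) inv_eta(1) epos(1)]) (use lpos in simp)
  next
    case Gap_y
    show ?thesis unfolding Gap_y raw_size.simps by (rule gap[OF Wl(2) inv_eta(2) epos(2)]) (use lpos in simp)
  next
    case Grad_x
    show ?thesis unfolding Grad_x raw_size.simps sig delta_grad_x_def
      by (rule grad[OF q(1) pos(1) sm(1) lpos(1) epos(1) inv_eta(1)])
  next
    case Grad_y
    show ?thesis unfolding Grad_y raw_size.simps sig delta_grad_y_def
      by (rule grad[OF q(2) pos(2) sm(2) lpos(2) epos(2) inv_eta(2)])
  qed
qed

text \<open>One unit is lost in rounding up and one in making the number odd.\<close>

lemma reps_le:
  assumes "0 < fail c" "fail c < 1"
  shows "real (reps c) \<le> 18 * ln ((2 * real (rounds c) + 6) / fail c) + 2"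
proof -
  have "1 < (2 * real (rounds c) + 6) / fail c" using assms by (simp add: less_divide_eq)
  then have "0 < ln ((2 * real (rounds c) + 6) / fail c)" by (rule ln_gt_zero)
  then have "real (nat \<lceil>18 * ln ((2 * real (rounds c) + 6) / fail c)\<rceil>) \<le> 18 * ln ((2 * real (rounds c) + 6) / fail c) + 1"
    by linarith
  then show ?thesis by (auto simp: reps_def Let_def)
qed

text \<open>The squared logarithm comes from the number of stages and from 1 / \<delta>, both linear
  in T; the repetitions give the other one. In the constant, 84 \<open>a\<close> bounds 2 T + 6 and
  14 \<open>a\<close> bounds 1 + T; 38400 is 2400 * 8 * 2 with 8 from 1 / \<delta> and 2 from the
  weights; 1514 is 18 * (83 + 1) + 2.\<close>

lemma total_samples_bound:
  fixes Lx Ly Lxy lx ly Dx Dy \<epsilon> p :: real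
  assumes pos: "Lx > 0" "Ly > 0" "Lxy > 0" "lx > 0" "ly > 0" "Dx > 0" "Dy > 0" "\<epsilon> > 0" and p: "0 < p" "p < 1"
  defines "L \<equiv> max Lx (max Ly Lxy)" and "l \<equiv> max lx ly" and "D2 \<equiv> Dx\<^sup>2 + Dy\<^sup>2"
  shows "total_samples (regularized_params Lx Ly Lxy lx ly (\<epsilon> / (2 * Dx\<^sup>2)) (\<epsilon> / (2 * Dy\<^sup>2)) (\<epsilon> / 2) p)
    \<le> (84 * 38400 * 14 * 1514) * (ln_ge1 (L * D2 / \<epsilon>))\<^sup>2 * ln_ge1 (ln_ge1 (L * D2 / \<epsilon>) / p) * (l\<^sup>2 * D2 / \<epsilon>\<^sup>2)"
proof -
  define c where "c = regularized_params Lx Ly Lxy lx ly (\<epsilon> / (2 * Dx\<^sup>2)) (\<epsilon> / (2 * Dy\<^sup>2)) (\<epsilon> / 2) p"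
  define A where "A = L * D2 / \<epsilon>"
  define a where "a = ln_ge1 A"
  define b where "b = ln_ge1 (a / p)"
  define B where "B = l\<^sup>2 * D2 / \<epsilon>\<^sup>2"
  let ?T = "real (rounds c)"
  have sel: "mu_x c = \<epsilon> / (2 * Dx\<^sup>2)" "mu_y c = \<epsilon> / (2 * Dy\<^sup>2)" "sm_x c = Lx + \<epsilon> / (2 * Dx\<^sup>2)"
    "sm_y c = Ly + \<epsilon> / (2 * Dy\<^sup>2)" "sm_xy c = Lxy" "lip_x c = lx" "lip_y c = ly" "sig_x c = 2 * lx"
    "sig_y c = 2 * ly" "acc c = \<epsilon> / 2" "fail c = p"
    by (simp_all add: c_def regularized_params_def)
  have Lge: "Lx \<le> L" "Ly \<le> L" "Lxy \<le> L" "L > 0" and lge: "lx \<le> l" "ly \<le> l" "l > 0"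
    using pos by (auto simp: L_def l_def)
  have D2: "Dx\<^sup>2 \<le> D2" "Dy\<^sup>2 \<le> D2" "D2 > 0" "4 * (Dx\<^sup>2 * Dy\<^sup>2) \<le> D2\<^sup>2"
  proof -
    show "Dx\<^sup>2 \<le> D2" "Dy\<^sup>2 \<le> D2" by (simp_all add: D2_def)
    show "D2 > 0" using pos by (simp add: D2_def add_pos_pos)
    \<comment> \<open>This trades the product of the squared diameters in the coupling ratio for
      \<open>D2\<close>, so that the single quantity \<open>A\<close> controls all three
      ratios.\<close>
    have "0 \<le> (Dx\<^sup>2 - Dy\<^sup>2)\<^sup>2" by simp
    then show "4 * (Dx\<^sup>2 * Dy\<^sup>2) \<le> D2\<^sup>2" unfolding D2_def power2_diff power2_sum by simp
  qed
  have A: "A > 0" using Lge D2 pos by (simp add: A_def)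
  have a: "a \<ge> 1" and b: "b \<ge> 1" "ln (a / p) \<le> b" by (simp_all add: a_def b_def ln_ge1_ge)
  have B: "B \<ge> 0" using D2 by (simp add: B_def)
  have mu: "mu_x c > 0" "mu_y c > 0" using pos by (simp_all add: sel)
  have ratio: "S * D\<^sup>2 / \<epsilon> \<le> A" if "S \<le> L" "D\<^sup>2 \<le> D2" "S > 0" for S D
    unfolding A_def using that D2 pos Lge by (intro divide_right_mono mult_mono) auto
  have T: "?T \<le> 13 * a"
    unfolding a_def
  proof (rule rounds_le[OF A mu])
    have "sm_x c / mu_x c = 1 + 2 * (Lx * Dx\<^sup>2 / \<epsilon>)" "sm_y c / mu_y c = 1 + 2 * (Ly * Dy\<^sup>2 / \<epsilon>)"
      using pos by (simp_all add: sel field_simps)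
    then show "1 \<le> sm_x c / mu_x c" "sm_x c / mu_x c \<le> 1 + 2 * A" "sm_y c / mu_y c \<le> 1 + 2 * A"
      using ratio[of Lx Dx] ratio[of Ly Dy] Lge D2 pos by auto
    have "(sm_xy c)\<^sup>2 / (mu_x c * mu_y c) = Lxy\<^sup>2 * (4 * (Dx\<^sup>2 * Dy\<^sup>2)) / \<epsilon>\<^sup>2"
      using pos by (simp add: sel power2_eq_square)
    also have "\<dots> \<le> L\<^sup>2 * D2\<^sup>2 / \<epsilon>\<^sup>2"
      using Lge D2 pos by (intro divide_right_mono mult_mono power_mono) auto
    finally show "(sm_xy c)\<^sup>2 / (mu_x c * mu_y c) \<le> A\<^sup>2" by (simp add: A_def power_mult_distrib power_divide)
  qed
  have delta: "delta c > 0" "1 / delta c = 8 * (1 + ?T) / \<epsilon>"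
    using pos by (simp_all add: delta_def sel field_simps)
  have W: "lx\<^sup>2 / mu_x c + ly\<^sup>2 / mu_y c \<le> 2 * l\<^sup>2 * D2 / \<epsilon>"
  proof -
    have "lx\<^sup>2 / mu_x c + ly\<^sup>2 / mu_y c = 2 * (lx\<^sup>2 * Dx\<^sup>2 + ly\<^sup>2 * Dy\<^sup>2) / \<epsilon>"
      using pos by (simp add: sel field_simps)
    also have "lx\<^sup>2 * Dx\<^sup>2 + ly\<^sup>2 * Dy\<^sup>2 \<le> l\<^sup>2 * Dx\<^sup>2 + l\<^sup>2 * Dy\<^sup>2"
      using lge pos by (intro add_mono mult_right_mono power_mono) auto
    also have "\<dots> = l\<^sup>2 * D2" by (simp add: D2_def algebra_simps)
    finally show ?thesis using pos by (simp add: divide_right_mono)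
  qed
  have raw: "raw_size c s \<le> 38400 * (1 + ?T) * B" for s
  proof -
    have "raw_size c s \<le> 2400 / delta c * (lx\<^sup>2 / mu_x c + ly\<^sup>2 / mu_y c)"
      using raw_size_bound[of c s] mu delta(1) pos by (simp add: sel)
    also have "\<dots> = 2400 * (1 / delta c) * (lx\<^sup>2 / mu_x c + ly\<^sup>2 / mu_y c)" by simp
    also have "\<dots> \<le> 2400 * (8 * (1 + ?T) / \<epsilon>) * (2 * l\<^sup>2 * D2 / \<epsilon>)"
      unfolding delta(2) using W pos by (intro mult_left_mono) auto
    also have "\<dots> = 38400 * (1 + ?T) * B" using pos by (simp add: B_def power2_eq_square)
    finally show ?thesis .
  qed
  have reps: "real (reps c) \<le> 1514 * b"
  proof -
    have pp: "0 < (2 * ?T + 6) / p" "0 < a / p" using p a by (auto intro!: divide_pos_pos add_nonneg_pos)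
    have "(2 * ?T + 6) / p \<le> 84 * (a / p)" using T a p by (simp add: divide_right_mono)
    then have "ln ((2 * ?T + 6) / p) \<le> ln (84 * (a / p))" using pp by (subst ln_le_cancel_iff) auto
    also have "\<dots> = ln 84 + ln (a / p)" using pp by (subst ln_mult) auto
    also have "\<dots> \<le> 83 + b" using ln_le_minus_one[of 84] b by simp
    finally show ?thesis using reps_le[of c] p b by (simp add: sel)
  qed
  have "total_samples c \<le> real (card (stages c)) * (real (reps c) * (38400 * (1 + ?T) * B))"
    unfolding total_samples_def using raw by (intro sum_bounded_above mult_left_mono) auto
  also have "\<dots> \<le> (84 * a) * ((1514 * b) * (38400 * (14 * a) * B))"
  proof (intro mult_mono)
    have "real (card (stages c)) \<le> 2 * ?T + 6" using of_nat_mono[OF card_stages_le[of c], where 'a = real] by simp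
    then show "real (card (stages c)) \<le> 84 * a" using T a by linarith
    show "1 + ?T \<le> 14 * a" using T a by linarith
  qed (use reps a b B in auto)
  also have "\<dots> = (84 * 38400 * 14 * 1514) * a\<^sup>2 * b * B" by (simp add: power2_eq_square)
  finally show ?thesis by (simp add: c_def a_def b_def A_def B_def)
qed

text \<open>On the given data regularity holds only almost surely, so the outputs are known to
  coincide with measurable functions only off a null set; hence the probability in the completion.
  \<open>C\<close> is quantified before all parameters, which makes it absolute.\<close>

theorem corollary4:
  fixes X :: "'x::euclidean_space set" and Y :: "'y::euclidean_space set"
    and P :: "'s measure"
    and f :: "'s \<Rightarrow> 'x \<Rightarrow> 'y \<Rightarrow> real"
    and fgx :: "'s \<Rightarrow> 'x \<Rightarrow> 'y \<Rightarrow> 'x" and fgy :: "'s \<Rightarrow> 'x \<Rightarrow> 'y \<Rightarrow> 'y"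
    and \<Phi> :: "'x \<Rightarrow> 'y \<Rightarrow> real"
    and gx :: "'x \<Rightarrow> 'y \<Rightarrow> 'x" and gy :: "'x \<Rightarrow> 'y \<Rightarrow> 'y"
    and x' :: 'x and y' :: 'y
    and Lx Ly Lxy lx ly \<epsilon> p :: real
    and K :: "'s picks"
  defines "\<Phi> \<equiv> expected_objective P f"
    and "Q \<equiv> regularized_problem X Y f fgx fgy
               (\<epsilon> / (2 * (diameter X)\<^sup>2)) (\<epsilon> / (2 * (diameter Y)\<^sup>2)) x' y'"
    and "c \<equiv> regularized_params Lx Ly Lxy lx ly
               (\<epsilon> / (2 * (diameter X)\<^sup>2)) (\<epsilon> / (2 * (diameter Y)\<^sup>2)) (\<epsilon> / 2) p"
  assumes "prob_space P"
    and "compact X" "convex X" "diameter X > 0"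
    and "compact Y" "convex Y" "diameter Y > 0"
    and "x' \<in> X" "y' \<in> Y"
    and "\<epsilon> > 0" "0 < p" "p < 1"
    and integrable: "\<And>x y. x \<in> X \<Longrightarrow> y \<in> Y \<Longrightarrow> integrable P (\<lambda>\<xi>. f \<xi> x y)"
    and convex_concave: "AE \<xi> in P. (\<forall>y\<in>Y. convex_on X (\<lambda>x. f \<xi> x y)) \<and>
                                   (\<forall>x\<in>X. concave_on Y (\<lambda>y. f \<xi> x y))"
    and "lx > 0" "ly > 0"
    and lipschitz: "AE \<xi> in P. (\<forall>y\<in>Y. lx-lipschitz_on X (\<lambda>x. f \<xi> x y)) \<and>
                               (\<forall>x\<in>X. ly-lipschitz_on Y (\<lambda>y. f \<xi> x y))"
    and gradient: "\<And>x y. x \<in> X \<Longrightarrow> y \<in> Y \<Longrightarrow>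
          ((\<lambda>u. \<Phi> u y) has_derivative (\<lambda>h. gx x y \<bullet> h)) (at x within X) \<and>
          ((\<lambda>v. \<Phi> x v) has_derivative (\<lambda>h. gy x y \<bullet> h)) (at y within Y)"
    and "Lx > 0" "Ly > 0" "Lxy > 0"
    and smooth_x: "\<And>x1 x2 y. x1 \<in> X \<Longrightarrow> x2 \<in> X \<Longrightarrow> y \<in> Y \<Longrightarrow>
          norm (gx x1 y - gx x2 y) \<le> Lx * norm (x1 - x2) \<and>
          norm (gy x1 y - gy x2 y) \<le> Lxy * norm (x1 - x2)"
    and smooth_y: "\<And>x y1 y2. x \<in> X \<Longrightarrow> y1 \<in> Y \<Longrightarrow> y2 \<in> Y \<Longrightarrow>
          norm (gy x y1 - gy x y2) \<le> Ly * norm (y1 - y2) \<and>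
          norm (gx x y1 - gx x y2) \<le> Lxy * norm (y1 - y2)"
    and sample_gradient: "AE \<xi> in P. \<forall>x\<in>X. \<forall>y\<in>Y.
          ((\<lambda>u. f \<xi> u y) has_derivative (\<lambda>h. fgx \<xi> x y \<bullet> h)) (at x within X) \<and>
          ((\<lambda>v. f \<xi> x v) has_derivative (\<lambda>h. fgy \<xi> x y \<bullet> h)) (at y within Y) \<and>
          norm (fgx \<xi> x y) \<le> lx \<and> norm (fgy \<xi> x y) \<le> ly"
    and gradient_measurable:
          "(\<lambda>(\<xi>, x, y). fgx \<xi> x y) \<in> borel_measurable (P \<Otimes>\<^sub>M restrict_space borel (X \<times> Y))"
          "(\<lambda>(\<xi>, x, y). fgy \<xi> x y) \<in> borel_measurable (P \<Otimes>\<^sub>M restrict_space borel (X \<times> Y))"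
    and unbiased: "\<And>x y. x \<in> X \<Longrightarrow> y \<in> Y \<Longrightarrow>
          (\<integral>\<xi>. fgx \<xi> x y \<partial>P) = gx x y \<and> (\<integral>\<xi>. fgy \<xi> x y \<partial>P) = gy x y"
    and adapted: "adapted_picks P c K"
    and valid: "AE \<omega> in sample_space P c. valid_picks Q c K \<omega>"
  shows "\<P>(\<omega> in completion (sample_space P c).
            duality_gap X Y \<Phi> (output_x Q c K \<omega>) (output_y Q c K \<omega>) \<le> \<epsilon>) \<ge> 1 - p \<and>
         (\<exists>C>0. \<forall>Lx Ly Lxy lx ly Dx Dy \<epsilon> p :: real.
            Lx > 0 \<and> Ly > 0 \<and> Lxy > 0 \<and> lx > 0 \<and> ly > 0 \<and> Dx > 0 \<and> Dy > 0 \<and>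
            \<epsilon> > 0 \<and> 0 < p \<and> p < 1 \<longrightarrow>
            (let L = max Lx (max Ly Lxy); l = max lx ly; D2 = Dx\<^sup>2 + Dy\<^sup>2 in
             total_samples (regularized_params Lx Ly Lxy lx ly
                 (\<epsilon> / (2 * Dx\<^sup>2)) (\<epsilon> / (2 * Dy\<^sup>2)) (\<epsilon> / 2) p)
               \<le> C * (ln_ge1 (L * D2 / \<epsilon>))\<^sup>2 * ln_ge1 (ln_ge1 (L * D2 / \<epsilon>) / p)
                   * (l\<^sup>2 * D2 / \<epsilon>\<^sup>2)))"
proof
  let ?ax = "\<epsilon> / (2 * (diameter X)\<^sup>2)" and ?ay = "\<epsilon> / (2 * (diameter Y)\<^sup>2)"
  interpret prob_space P by fact
  have ne: "X \<noteq> {}" "Y \<noteq> {}" using \<open>x' \<in> X\<close> \<open>y' \<in> Y\<close> by auto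
  define regular where "regular \<xi> \<longleftrightarrow> convex_concave_lipschitz X Y lx ly (f \<xi>) \<and>
    (\<forall>x\<in>X. \<forall>y\<in>Y. norm (fgx \<xi> x y) \<le> lx \<and> norm (fgy \<xi> x y) \<le> ly)" for \<xi>
  have "AE \<xi> in P. regular \<xi>"
    using convex_concave lipschitz sample_gradient
    by eventually_elim (auto simp: regular_def convex_concave_lipschitz_def)
  then obtain N where N: "{\<xi> \<in> space P. \<not> regular \<xi>} \<subseteq> N" "emeasure P N = 0" "N \<in> sets P"
    by (rule AE_E)
  \<comment> \<open>Setting the data to \<open>0\<close> off \<open>G\<close> makes the assumptions hold for every sample, at the price of
    changing the run on a null set only.\<close>
  define G where "G = space P - N"
  have G: "G \<in> sets P" "\<And>\<xi>. \<xi> \<in> G \<Longrightarrow> regular \<xi>" using N by (auto simp: G_def)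
  have AE_G: "AE \<xi> in P. \<xi> \<in> G" using N by (intro AE_I[of _ _ N]) (auto simp: G_def)
  define f' where "f' \<xi> x y = (if \<xi> \<in> G then f \<xi> x y else 0)" for \<xi> x y
  define fgx' where "fgx' \<xi> x y = (if \<xi> \<in> G then fgx \<xi> x y else 0)" for \<xi> x y
  define fgy' where "fgy' \<xi> x y = (if \<xi> \<in> G then fgy \<xi> x y else 0)" for \<xi> x y
  have f'_meas: "(\<lambda>\<xi>. f' \<xi> x y) \<in> borel_measurable P" if "x \<in> X" "y \<in> Y" for x y
    unfolding f'_def using borel_measurable_integrable[OF integrable[OF that]] G(1)
    by (intro measurable_If_set) auto
  have \<Phi>': "expected_objective P f' x y = \<Phi> x y" if "x \<in> X" "y \<in> Y" for x y
    unfolding \<Phi>_def expected_objective_def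
    using AE_G by (intro integral_cong_AE f'_meas that borel_measurable_integrable[OF integrable]) (auto simp: f'_def)
  have f'_cc: "convex_concave_lipschitz X Y lx ly (f' \<xi>)" for \<xi>
  proof (cases "\<xi> \<in> G")
    case True
    then show ?thesis using G(2)[OF True] by (simp add: regular_def f'_def[abs_def])
  next
    case False
    then show ?thesis
      using \<open>convex X\<close> \<open>convex Y\<close> \<open>lx > 0\<close> \<open>ly > 0\<close>
      by (auto simp: convex_concave_lipschitz_def f'_def[abs_def] concave_on_def convex_on_const intro!: lipschitz_onI)
  qed
  interpret S: sampled_saddle_problem P X Y f' lx ly
  proof unfold_locales
    show "integrable P (\<lambda>\<xi>. f' \<xi> x y)" if "x \<in> X" "y \<in> Y" for x y
      by (rule integrable_cong_AE_imp[OF integrable[OF that] f'_meas[OF that]])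
        (use AE_G in \<open>auto simp: f'_def\<close>)
  qed (use f'_cc ne \<open>compact X\<close> \<open>convex X\<close> \<open>compact Y\<close> \<open>convex Y\<close> in auto)
  let ?R = "P \<Otimes>\<^sub>M restrict_space borel (X \<times> Y)"
  have G_set: "{w \<in> space ?R. fst w \<in> G} \<in> sets ?R"
    using measurable_sets[OF measurable_fst G(1), of "restrict_space borel (X \<times> Y)"]
    by (simp add: vimage_def Int_def conj_commute)
  have fgx'_meas: "(\<lambda>(\<xi>, x, y). fgx' \<xi> x y) \<in> borel_measurable ?R"
    and fgy'_meas: "(\<lambda>(\<xi>, x, y). fgy' \<xi> x y) \<in> borel_measurable ?R"
    using measurable_If[OF gradient_measurable(1)[unfolded case_prod_unfold] measurable_const[of 0] G_set]
      measurable_If[OF gradient_measurable(2)[unfolded case_prod_unfold] measurable_const[of 0] G_set]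
    by (simp_all add: fgx'_def fgy'_def case_prod_unfold)
  have slice: "(\<lambda>\<xi>. h \<xi> x y) \<in> borel_measurable P"
    if "(\<lambda>(\<xi>, x, y). h \<xi> x y) \<in> borel_measurable ?R" "x \<in> X" "y \<in> Y"
    for h :: "'s \<Rightarrow> 'x \<Rightarrow> 'y \<Rightarrow> 'v::euclidean_space" and x y
  proof -
    have "(\<lambda>\<xi>. (\<xi>, x, y)) \<in> measurable P ?R"
      using that by (intro measurable_Pair measurable_ident_sets measurable_const) (auto simp: space_restrict_space)
    from measurable_compose[OF this that(1)] show ?thesis by simp
  qed
  define Q' where "Q' = regularized_problem X Y f' fgx' fgy' ?ax ?ay x' y'"
  interpret B: boosted_saa P X Y f' lx ly fgx' fgy' gx gy x' y' Lx Ly Lxy ?ax ?ay "\<epsilon> / 2" p K Q' c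
  proof unfold_locales
    show "((\<lambda>u. expected_objective P f' u y) has_derivative (\<lambda>h. gx x y \<bullet> h)) (at x within X) \<and>
        ((\<lambda>v. expected_objective P f' x v) has_derivative (\<lambda>h. gy x y \<bullet> h)) (at y within Y)"
      if "x \<in> X" "y \<in> Y" for x y
      using gradient[OF that] that
      by (auto intro: has_derivative_transform[of x X _ "\<lambda>u. \<Phi> u y"] has_derivative_transform[of y Y _ "\<lambda>v. \<Phi> x v"] simp: \<Phi>')
    show "norm (fgx' \<xi> x y) \<le> lx \<and> norm (fgy' \<xi> x y) \<le> ly" if "x \<in> X" "y \<in> Y" for \<xi> x y
      using G(2)[of \<xi>] that \<open>lx > 0\<close> \<open>ly > 0\<close> by (auto simp: fgx'_def fgy'_def regular_def)
    show "(\<integral>\<xi>. fgx' \<xi> x y \<partial>P) = gx x y \<and> (\<integral>\<xi>. fgy' \<xi> x y \<partial>P) = gy x y" if "x \<in> X" "y \<in> Y" for x y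
    proof -
      have "(\<integral>\<xi>. fgx' \<xi> x y \<partial>P) = (\<integral>\<xi>. fgx \<xi> x y \<partial>P)"
        by (rule integral_cong_AE[OF slice[OF fgx'_meas that] slice[OF gradient_measurable(1) that]])
          (use AE_G in \<open>auto simp: fgx'_def\<close>)
      moreover have "(\<integral>\<xi>. fgy' \<xi> x y \<partial>P) = (\<integral>\<xi>. fgy \<xi> x y \<partial>P)"
        by (rule integral_cong_AE[OF slice[OF fgy'_meas that] slice[OF gradient_measurable(2) that]])
          (use AE_G in \<open>auto simp: fgy'_def\<close>)
      ultimately show ?thesis using unbiased[OF that] by simp
    qed
    show "c \<equiv> regularized_params Lx Ly Lxy lx ly ?ax ?ay (\<epsilon> / 2) p" by (rule c_def)
    show "Q' \<equiv> regularized_problem X Y f' fgx' fgy' ?ax ?ay x' y'" by (simp add: Q'_def)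
  qed (use smooth_x smooth_y fgx'_meas fgy'_meas adapted[unfolded c_def] \<open>diameter X > 0\<close> \<open>diameter Y > 0\<close> \<open>\<epsilon> > 0\<close>
      \<open>0 < p\<close> \<open>p < 1\<close> \<open>lx > 0\<close> \<open>ly > 0\<close> \<open>Lx > 0\<close> \<open>Ly > 0\<close> \<open>Lxy > 0\<close> in \<open>simp_all\<close>)
  let ?\<Omega> = "sample_space P c"
  \<comment> \<open>A run draws finitely many samples, so almost surely all of them avoid the
    exceptional set.\<close>
  have "AE \<omega> in ?\<Omega>. \<forall>k\<in>sample_index c. \<omega> k \<in> G"
    unfolding sample_space_def
    by (intro AE_finite_allI B.finite_sample_index AE_PiM_component prob_space_axioms AE_G)
  then have same: "AE \<omega> in ?\<Omega>. valid_picks Q' c K \<omega> \<and> output_x Q c K \<omega> = output_x Q' c K \<omega> \<and>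
      output_y Q c K \<omega> = output_y Q' c K \<omega>"
    using valid
  proof eventually_elim
    case (elim \<omega>)
    have in_G: "\<omega> (s, j, i) \<in> G" if "s \<in> stages c" "j < reps c" "i < batch_size c s" for s j i
      using elim(1) that by (auto simp: sample_index_def)
    have obj: "obj Q (\<omega> (s, j, i)) = obj Q' (\<omega> (s, j, i))" if "s \<in> stages c" "j < reps c" "i < batch_size c s" for s j i
      using in_G[OF that] by (simp add: Q_def Q'_def regularized_problem_def f'_def)
    have dom: "dom_x Q = dom_x Q'" "dom_y Q = dom_y Q'" by (simp_all add: Q_def Q'_def regularized_problem_def)
    have "SAA Q (batch_size c s) wx wy xc yc (\<lambda>l. \<omega> (s, j, l)) = SAA Q' (batch_size c s) wx wy xc yc (\<lambda>l. \<omega> (s, j, l))"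
      if "s \<in> stages c" "j < reps c" for s j wx wy xc yc
      using obj[OF that] by (simp add: SAA_def dom)
    moreover have "(\<Sum>i<batch_size c Grad_x. grad_x Q (\<omega> (Grad_x, j, i)) x y) =
        (\<Sum>i<batch_size c Grad_x. grad_x Q' (\<omega> (Grad_x, j, i)) x y)" if "j < reps c" for j x y
      using in_G[OF B.stages_I(5) that]
      by (intro sum.cong) (auto simp: Q_def Q'_def regularized_problem_def fgx'_def)
    moreover have "(\<Sum>i<batch_size c Grad_y. grad_y Q (\<omega> (Grad_y, j, i)) x y) =
        (\<Sum>i<batch_size c Grad_y. grad_y Q' (\<omega> (Grad_y, j, i)) x y)" if "j < reps c" for j x y
      using in_G[OF B.stages_I(6) that]
      by (intro sum.cong) (auto simp: Q_def Q'_def regularized_problem_def fgy'_def)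
    ultimately show ?case using run_cong[of c Q \<omega> Q' K] elim(2) by blast
  qed
  let ?E = "{\<omega> \<in> space (completion ?\<Omega>). duality_gap X Y \<Phi> (output_x Q c K \<omega>) (output_y Q c K \<omega>) \<le> \<epsilon>}"
  let ?E' = "{\<omega> \<in> space ?\<Omega>. duality_gap X Y (expected_objective P f') (output_x Q' c K \<omega>) (output_y Q' c K \<omega>) \<le> \<epsilon>}"
  have gap_eq: "duality_gap X Y (expected_objective P f') a b = duality_gap X Y \<Phi> a b" if "a \<in> X" "b \<in> Y" for a b
    unfolding duality_gap_def using \<Phi>' that by (simp cong: SUP_cong INF_cong)
  have "1 - p \<le> measure ?\<Omega> ?E'"
  proof (rule B.duality_gap_probability)
    show "AE \<omega> in ?\<Omega>. valid_picks Q' c K \<omega>" using same by eventually_elim simp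
    \<comment> \<open>With the chosen weights each regularization term amounts to
      \<open>\<epsilon> / 4\<close>.\<close>
    show "\<epsilon> / 2 + ?ax / 2 * (diameter X)\<^sup>2 + ?ay / 2 * (diameter Y)\<^sup>2 \<le> \<epsilon>"
      using \<open>diameter X > 0\<close> \<open>diameter Y > 0\<close> by (simp add: field_simps)
  qed fact+
  also have "\<dots> = measure (completion ?\<Omega>) ?E'"
    by (rule measure_completion[OF B.duality_gap_event, symmetric])
  also have "\<dots> = measure (completion ?\<Omega>) ?E"
  proof -
    have iff: "AE \<omega> in completion ?\<Omega>. \<omega> \<in> ?E' \<longleftrightarrow> \<omega> \<in> ?E"
      using AE_completion[OF same] by eventually_elim (auto simp: gap_eq B.output_in)
    have E': "?E' \<in> sets (completion ?\<Omega>)" using B.duality_gap_event by (rule sets_completionI_sets)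
    \<comment> \<open>Agreement with a measurable event off a null set gives measurability in the
      completion.\<close>
    have "?E \<in> sets (completion ?\<Omega>)" by (rule completion.in_sets_AE[OF iff E']) auto
    with iff E' show ?thesis by (rule measure_eq_AE)
  qed
  finally show "1 - p \<le> measure (completion ?\<Omega>) ?E" .
next
  show "\<exists>C>0. \<forall>Lx Ly Lxy lx ly Dx Dy \<epsilon> p :: real.
            Lx > 0 \<and> Ly > 0 \<and> Lxy > 0 \<and> lx > 0 \<and> ly > 0 \<and> Dx > 0 \<and> Dy > 0 \<and>
            \<epsilon> > 0 \<and> 0 < p \<and> p < 1 \<longrightarrow>
            (let L = max Lx (max Ly Lxy); l = max lx ly; D2 = Dx\<^sup>2 + Dy\<^sup>2 in
             total_samples (regularized_params Lx Ly Lxy lx ly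
                 (\<epsilon> / (2 * Dx\<^sup>2)) (\<epsilon> / (2 * Dy\<^sup>2)) (\<epsilon> / 2) p)
               \<le> C * (ln_ge1 (L * D2 / \<epsilon>))\<^sup>2 * ln_ge1 (ln_ge1 (L * D2 / \<epsilon>) / p)
                   * (l\<^sup>2 * D2 / \<epsilon>\<^sup>2))"
    unfolding Let_def
    by (intro exI[of _ "84 * 38400 * 14 * 1514"] conjI allI impI total_samples_bound) simp_all
qed

end
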